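(* Let $\mathbb H\subseteq\mathbb F^{sep}$ be a finite separable extension of $\mathbb F$ of degree $m$. Then: (a) There exist, for $\mathcal D$-almost all $s$, finite separable extensions $\mathfrak H_s\subseteq\mathfrak F_s^{sep}$ of $\mathfrak F_s$ of degree $m$ such that $\mathfrak H:=\prod_s\mathfrak H_s/\mathcal D$ satisfies $\mathfrak H\cap\mathbb F^{alg}=\mathbb H$; explicitly, if $\mathbb H=\mathbb F(\alpha)$ and $\alpha=\mathrm{ulim}_s\alpha_s$ with $\alpha_s\in\mathfrak F_s^{sep}$, one may take $\mathfrak H_s=\mathfrak F_s(\alpha_s)$, and then $\mathfrak H=\mathcal U(\mathbb F)(\alpha)$ is a separable extension of $\mathcal U(\mathbb F)$ of degree $m$. The family is unique: if $\mathfrak G_s\subseteq\mathfrak F_s^{alg}$ are separable extensions of $\mathfrak F_s$ of degree $m$ for $\mathcal D$-almost all $s$ with $(\prod_s\mathfrak G_s/\mathcal D)\cap\mathbb F^{alg}=\mathbb H$, then $\mathfrak G_s=\mathfrak H_s$ for $\mathcal D$-almost all $s$. (b) If moreover $\mathbb H/\mathbb F$ is Galois with group $G$, then: (i) $\mathfrak H_s/\mathfrak F_s$ is Galois of degree $m$ with $\mathrm{Gal}(\mathfrak H_s/\mathfrak F_s)\cong G$ for $\mathcal D$-almost all $s$; (ii) $\mathfrak H/\mathcal U(\mathbb F)$ is Galois of degree $m$ with $\mathrm{Gal}(\mathfrak H/\mathcal U(\mathbb F))\cong G$; (iii) $G=\{\sigma|_{\mathbb H}:\sigma\in\mathrm{Gal}(\mathfrak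 H/\mathcal U(\mathbb F))\}$ and $\mathrm{Gal}(\mathfrak H/\mathcal U(\mathbb F))=\prod_s\mathrm{Gal}(\mathfrak H_s/\mathfrak F_s)/\mathcal D$ (acting by $\mathrm{ulim}_sa_s\mapsto\mathrm{ulim}_s\sigma_s(a_s)$).
   Context: Let $S$ be an infinite set, $\mathcal D$ a nonprincipal ultrafilter on $S$; ultraproducts $\prod_sA_s/\mathcal D$ consist of tuples modulo agreement on a set in $\mathcal D$, classes written $\mathrm{ulim}_sa_s$, componentwise operations. For each $s$ let $\mathbb F_s$ be a field, $\mathfrak F_s=\mathbb F_s(t)$; $\mathfrak K=\prod_s\mathbb F_s/\mathcal D$, $\mathbb F=\mathfrak K(t)\subseteq\mathcal U(\mathbb F)=\prod_s\mathfrak F_s/\mathcal D$ (via $\sum_i(\mathrm{ulim}_sa_{i,s})t^i\mapsto\mathrm{ulim}_s\sum_ia_{i,s}t^i$). Fix algebraic closures $\mathfrak F_s^{alg}$ with separable closures $\mathfrak F_s^{sep}\subseteq\mathfrak F_s^{alg}$; $\mathbb F^{alg}$ is the set of elements of $\prod_s\mathfrak F_s^{alg}/\mathcal D$ algebraic over $\mathbb F$, and $\mathbb F^{sep}\subseteq\mathbb F^{alg}$ the separable closure of $\mathbb F$; one has $\mathbb F^{sep}\subseteq\prod_s\mathfrak F_s^{sep}/\mathcal D$. The fields $\mathfrak H_s$ of part (a) are called the $s$-th shadows of $\mathbb H$ and $\mathfrak H$ its ultra-shadow. *)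

theory Defs
  imports "HOL-Algebra.Algebra"
begin

definition nonprincipal_ultrafilter :: "'s filter \<Rightarrow> bool" where
  "nonprincipal_ultrafilter D \<longleftrightarrow>
     D \<noteq> bot \<and> (\<forall>P. eventually P D \<or> eventually (\<lambda>s. \<not> P s) D)
     \<and> (\<forall>s0. \<not> eventually (\<lambda>s. s = s0) D)"

definition ucls :: "'s filter \<Rightarrow> ('s \<Rightarrow> 'a) \<Rightarrow> ('s \<Rightarrow> 'a) set" where
  "ucls D f = {g. eventually (\<lambda>s. g s = f s) D}"

definition urep :: "'s filter \<Rightarrow> ('s \<Rightarrow> 'a) set \<Rightarrow> ('s \<Rightarrow> 'a)" where
  "urep D x = (SOME f. ucls D f = x)"

text \<open>Ultraproduct of sets A s (A s only needs to be meaningful for D-almost all s).\<close>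
definition ultraprod :: "'s filter \<Rightarrow> ('s \<Rightarrow> 'a set) \<Rightarrow> ('s \<Rightarrow> 'a) set set" where
  "ultraprod D A = {ucls D f | f. eventually (\<lambda>s. f s \<in> A s) D}"

definition umult :: "'s filter \<Rightarrow> ('s \<Rightarrow> ('a, 'b) ring_scheme) \<Rightarrow> ('s \<Rightarrow> 'a) set \<Rightarrow> ('s \<Rightarrow> 'a) set \<Rightarrow> ('s \<Rightarrow> 'a) set" where
  "umult D R x y = ucls D (\<lambda>s. urep D x s \<otimes>\<^bsub>R s\<^esub> urep D y s)"

definition uadd :: "'s filter \<Rightarrow> ('s \<Rightarrow> ('a, 'b) ring_scheme) \<Rightarrow> ('s \<Rightarrow> 'a) set \<Rightarrow> ('s \<Rightarrow> 'a) set \<Rightarrow> ('s \<Rightarrow> 'a) set" where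
  "uadd D R x y = ucls D (\<lambda>s. urep D x s \<oplus>\<^bsub>R s\<^esub> urep D y s)"

definition ultra_ring :: "'s filter \<Rightarrow> ('s \<Rightarrow> ('a, 'b) ring_scheme) \<Rightarrow> ('s \<Rightarrow> 'a) set ring" where
  "ultra_ring D R =
     \<lparr> carrier = ultraprod D (\<lambda>s. carrier (R s)),
       monoid.mult = umult D R,
       one = ucls D (\<lambda>s. \<one>\<^bsub>R s\<^esub>),
       ring.zero = ucls D (\<lambda>s. \<zero>\<^bsub>R s\<^esub>),
       ring.add = uadd D R \<rparr>"

definition uact :: "'s filter \<Rightarrow> ('s \<Rightarrow> 'a \<Rightarrow> 'a) \<Rightarrow> ('s \<Rightarrow> 'a) set \<Rightarrow> ('s \<Rightarrow> 'a) set" where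
  "uact D \<sigma> x = ucls D (\<lambda>s. \<sigma> s (urep D x s))"

text \<open>Formal derivative of a polynomial in HOL-Algebra list representation
  (leading coefficient first): [a_n,...,a_0] \<mapsto> [n a_n, ..., 1 a_1].\<close>
definition pderiv_list :: "('a, 'b) ring_scheme \<Rightarrow> 'a list \<Rightarrow> 'a list" where
  "pderiv_list R p =
     ring.normalize R (map (\<lambda>(a, i). add_pow R (i::nat) a) (zip (butlast p) (rev [1..<length p])))"

definition separable_poly :: "('a, 'b) ring_scheme \<Rightarrow> 'a list \<Rightarrow> bool" where
  "separable_poly R p \<longleftrightarrow>
     (\<forall>q \<in> carrier (poly_ring R). q pdivides\<^bsub>R\<^esub> p \<and> q pdivides\<^bsub>R\<^esub> pderiv_list R p \<longrightarrow> degree q = 0)"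

definition separable_elt :: "('a, 'b) ring_scheme \<Rightarrow> 'a set \<Rightarrow> 'a \<Rightarrow> bool" where
  "separable_elt R K x \<longleftrightarrow>
     x \<in> carrier R \<and> \<not> ring.transcendental R K x \<and> separable_poly R (ring.Irr R K x)"

definition fin_sep_ext :: "('a, 'b) ring_scheme \<Rightarrow> 'a set \<Rightarrow> 'a set \<Rightarrow> nat \<Rightarrow> bool" where
  "fin_sep_ext R K E m \<longleftrightarrow>
     subfield K R \<and> subfield E R \<and> K \<subseteq> E \<and> ring.dimension R m K E
     \<and> (\<forall>x\<in>E. separable_elt R K x)"

definition splits_in :: "('a, 'b) ring_scheme \<Rightarrow> 'a set \<Rightarrow> 'a list \<Rightarrow> bool" where
  "splits_in R E p \<longleftrightarrow>
     (\<exists>c rs. c \<in> E \<and> set rs \<subseteq> E \<and>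
        p = foldr (\<lambda>r q. [\<one>\<^bsub>R\<^esub>, \<ominus>\<^bsub>R\<^esub> r] \<otimes>\<^bsub>poly_ring R\<^esub> q) rs [c])"

definition normal_ext :: "('a, 'b) ring_scheme \<Rightarrow> 'a set \<Rightarrow> 'a set \<Rightarrow> bool" where
  "normal_ext R K E \<longleftrightarrow> (\<forall>x\<in>E. splits_in R E (ring.Irr R K x))"

definition galois_ext :: "('a, 'b) ring_scheme \<Rightarrow> 'a set \<Rightarrow> 'a set \<Rightarrow> nat \<Rightarrow> bool" where
  "galois_ext R K E m \<longleftrightarrow> fin_sep_ext R K E m \<and> normal_ext R K E"

definition Gal :: "('a, 'b) ring_scheme \<Rightarrow> 'a set \<Rightarrow> 'a set \<Rightarrow> ('a \<Rightarrow> 'a) monoid" where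
  "Gal R K E =
     \<lparr> carrier = {\<sigma>. \<sigma> \<in> extensional E \<and> bij_betw \<sigma> E E
                 \<and> (\<forall>x\<in>E. \<forall>y\<in>E. \<sigma> (x \<oplus>\<^bsub>R\<^esub> y) = \<sigma> x \<oplus>\<^bsub>R\<^esub> \<sigma> y
                                 \<and> \<sigma> (x \<otimes>\<^bsub>R\<^esub> y) = \<sigma> x \<otimes>\<^bsub>R\<^esub> \<sigma> y)
                 \<and> (\<forall>x\<in>K. \<sigma> x = x)},
       monoid.mult = (\<lambda>\<sigma> \<tau>. restrict (\<sigma> \<circ> \<tau>) E),
       one = restrict id E \<rparr>"

end

theory Submission
  imports Defs
begin

text \<open>
  Elements of \<open>UF\<close> that are algebraic over \<open>F\<close> already lie in \<open>F\<close>: by the rational root theorem the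
  numerators and denominators of the coordinates divide coefficients of bounded degree. Hence
  minimal polynomials over \<open>F\<close> of elements of \<open>Falg\<close> stay irreducible over \<open>UF\<close> (their factors
  have coefficients in \<open>UF \<inter> Falg\<close>). Writing \<open>HH = F(\<alpha>)\<close> by the primitive element theorem, degrees,
  distinct roots and the position of the roots of the minimal polynomial of \<open>\<alpha>\<close> transfer to the
  coordinates, which gives the fields \<open>FF s (\<alpha>s s)\<close>. Separability and normality of \<open>K(x)\<close> are both
  read off the roots of the minimal polynomial of \<open>x\<close> by counting conjugates, and
  automorphisms are determined by the root to which they send the primitive element.
\<close>

section \<open>Roots and separability\<close>

text \<open>A tuple of polynomials has a limit over the ultraproduct only when its degrees are
  bounded: the ultrafilter then selects one degree that occurs almost everywhere, and the
  coefficients pass to the limit one by one. Every step from coordinates to the limit is shaped by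
  this. The fractions in \<open>relatively_closed\<close> come with explicit length bounds, elements
  of a shadow are written with powers below a fixed degree, and automorphisms are handled through
  the root of a fixed polynomial. In the other direction, finitely many conditions are intersected.
  No assumption is made on the characteristic or the size of the fields \<open>Fs s\<close>. Finite
  constant fields are harmless because \<open>F\<close> contains all powers of the transcendental
  \<open>t\<close>, so that the primitive element theorem for infinite fields applies.
  Inseparability is kept away by counting: inside an algebraically closed field an algebraic element
  is separable exactly when it has as many conjugates as its degree, and such counts survive the
  passage between \<open>F\<close>, \<open>UF\<close> and the coordinates.\<close>

fun (in ring) deriv_eval :: "'a list \<Rightarrow> 'a \<Rightarrow> 'a" where
  "deriv_eval [] x = \<zero>"
| "deriv_eval (a # p) x = ([length p] \<cdot> a) \<otimes> x [^] (length p - 1) \<oplus> deriv_eval p x"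

lemma (in ring) deriv_eval_closed:
  assumes "set p \<subseteq> carrier R" "x \<in> carrier R"
  shows "deriv_eval p x \<in> carrier R"
  using assms by (induct p) auto

lemma (in ring) deriv_eval_normalize:
  assumes "set p \<subseteq> carrier R" "x \<in> carrier R"
  shows "deriv_eval (normalize p) x = deriv_eval p x"
  using assms by (induct p) (auto simp: deriv_eval_closed)

text \<open>\<open>deriv_eval\<close> is the value of the formal derivative by recursion on the
  coefficients. \<open>pderiv_list\<close> strips leading zeros, which do occur in positive
  characteristic, so the values are compared before normalization.\<close>

lemma (in ring) eval_pderiv_list:
  assumes "set p \<subseteq> carrier R" "x \<in> carrier R"
  shows "eval (pderiv_list R p) x = deriv_eval p x"
proof -
  define d where "d p = map (\<lambda>(a, i). add_pow R (i::nat) a) (zip (butlast p) (rev [1..<length p]))"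
    for p :: "'a list"
  have d_closed: "set (d p) \<subseteq> carrier R"
    using assms(1) by (auto simp: d_def dest!: set_zip_leftD in_set_butlastD)
  have "eval (d p) x = deriv_eval p x"
    using assms(1)
  proof (induct p)
    case (Cons a p)
    show ?case
    proof (cases "p = []")
      case False
      then have "rev [1..<length (a # p)] = length p # rev [1..<length p]"
        by (cases "length p") auto
      then have "d (a # p) = ([length p] \<cdot> a) # d p"
        using False by (simp add: d_def)
      moreover have "length (d p) = length p - 1"
        by (simp add: d_def)
      ultimately show ?thesis
        using Cons by simp
    qed (use Cons assms in \<open>simp add: d_def\<close>)
  qed (simp add: d_def)
  then show ?thesis
    using eval_normalize[OF d_closed assms(2)] by (simp add: pderiv_list_def d_def)
qed

lemma (in ring) deriv_eval_add_same_length: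
  assumes "set p \<subseteq> carrier R" "set q \<subseteq> carrier R" "length p = length q" "x \<in> carrier R"
  shows "deriv_eval (map2 (\<oplus>) p q) x = deriv_eval p x \<oplus> deriv_eval q x"
  using assms(3,1,2)
proof (induct p q rule: list_induct2)
  case (Cons a p b q)
  have [simp]: "[n] \<cdot> (a \<oplus> b) = [n] \<cdot> a \<oplus> [n] \<cdot> b" for n :: nat
    using Cons add.nat_pow_distrib[of a b n] by simp
  show ?case
    using Cons assms(4) by (simp add: l_distr deriv_eval_closed a_ac)
qed simp

text \<open>Appending a coefficient is Horner's step from \<open>p\<close> to
  \<open>p * X + b\<close>, so this is the product rule for a factor \<open>X\<close>.\<close>

lemma (in ring) deriv_eval_append:
  assumes "set p \<subseteq> carrier R" "b \<in> carrier R" "x \<in> carrier R"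
  shows "deriv_eval (p @ [b]) x = deriv_eval p x \<otimes> x \<oplus> eval p x"
  using assms(1)
proof (induct p)
  case Nil
  then show ?case using assms by simp
next
  case (Cons a p)
  \<comment> \<open>For \<open>p = []\<close> the exponents do not match, since subtraction on
    naturals truncates, but then the factor \<open>[0] \<cdot> a\<close> is zero.\<close>
  have *: "([length p] \<cdot> a) \<otimes> x [^] (length p - Suc 0) \<otimes> x = ([length p] \<cdot> a) \<otimes> x [^] length p"
    using Cons assms by (cases "length p") (auto simp: m_assoc)
  have "deriv_eval ((a # p) @ [b]) x
      = ([Suc (length p)] \<cdot> a) \<otimes> x [^] length p \<oplus> (deriv_eval p x \<otimes> x \<oplus> eval p x)"
    using Cons by simp
  also have "\<dots> = (([length p] \<cdot> a) \<otimes> x [^] length p \<oplus> a \<otimes> x [^] length p)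
      \<oplus> (deriv_eval p x \<otimes> x \<oplus> eval p x)"
    using Cons assms by (simp add: l_distr a_ac)
  also have "\<dots> = (([length p] \<cdot> a) \<otimes> x [^] length p \<oplus> deriv_eval p x \<otimes> x)
      \<oplus> (a \<otimes> x [^] length p \<oplus> eval p x)"
    using Cons assms by (simp add: deriv_eval_closed eval_in_carrier a_ac)
  also have "\<dots> = deriv_eval (a # p) x \<otimes> x \<oplus> eval (a # p) x"
    using Cons assms by (simp add: l_distr deriv_eval_closed *)
  finally show ?case .
qed

lemma (in cring) deriv_eval_scalar:
  assumes "set p \<subseteq> carrier R" "c \<in> carrier R" "x \<in> carrier R"
  shows "deriv_eval (map ((\<otimes>) c) p) x = c \<otimes> deriv_eval p x"
  using assms(1)
proof (induct p)
  case (Cons a p)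
  have "([length p] \<cdot> (c \<otimes> a)) \<otimes> x [^] n = c \<otimes> (([length p] \<cdot> a) \<otimes> x [^] n)" for n :: nat
    using Cons assms add_pow_rdistr[of c a "length p"]
      m_assoc[of c "[length p] \<cdot> a" "x [^] n"] by simp
  then show ?case
    using Cons assms by (simp add: r_distr deriv_eval_closed)
qed (use assms in simp)

lemma (in ring) map_one_mult: "set p \<subseteq> carrier R \<Longrightarrow> map ((\<otimes>) \<one>) p = p"
  by (induct p) auto

lemma (in ring) map2_add_closed:
  assumes "set p \<subseteq> carrier R" "set q \<subseteq> carrier R"
  shows "set (map2 (\<oplus>) p q) \<subseteq> carrier R"
  using assms by (force dest: set_zip_leftD set_zip_rightD)

text \<open>Product rule for \<open>(X - y) * q\<close> at \<open>y\<close>: the term with the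
  derivative of \<open>q\<close> carries the factor \<open>y - y\<close>.\<close>

lemma (in domain) deriv_eval_linear_factor:
  assumes "q \<in> carrier (poly_ring R)" "y \<in> carrier R"
  shows "deriv_eval ([\<one>, \<ominus> y] \<otimes>\<^bsub>poly_ring R\<^esub> q) y = eval q y"
proof (cases "q = []")
  case True
  then show ?thesis
    using poly_mult_zero(2)[of "[\<one>, \<ominus> y]"] assms by (simp add: univ_poly_mult del: poly_mult.simps)
next
  case False
  have q: "set q \<subseteq> carrier R"
    using assms(1) by (metis polynomial_incl univ_poly_carrier)
  have mq: "set (map ((\<otimes>) (\<ominus> y)) q) \<subseteq> carrier R"
    using q assms by auto
  let ?m = "map ((\<otimes>) (\<ominus> y)) q"
  have "set (q @ [\<zero>]) \<subseteq> carrier R" and "set (\<zero> # ?m) \<subseteq> carrier R"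
    using q mq by auto
  then have map2c: "set (map2 (\<oplus>) (q @ [\<zero>]) (\<zero> # ?m)) \<subseteq> carrier R"
    by (rule map2_add_closed)
  have a: "poly_add ?m [] = normalize ?m"
    using poly_add_zero'(1)[OF mq] .
  \<comment> \<open>The product unfolds to the shifted \<open>q\<close> plus a normalized multiple
    of \<open>q\<close>. The inner normalization is removed and the lists are padded to equal
    length, so that the derivative can be taken coefficientwise.\<close>
  have "poly_mult [\<one>, \<ominus> y] q = poly_add (q @ [\<zero>]) (normalize ?m)"
    using a by (simp add: map_one_mult[OF q] del: poly_add.simps)
  also have "\<dots> = poly_add (normalize ?m) (q @ [\<zero>])"
    using poly_add_comm[of "q @ [\<zero>]" "normalize ?m"] q normalize_in_carrier[OF mq] by simp
  also have "\<dots> = poly_add ?m (q @ [\<zero>])"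
    using poly_add_normalize(1)[OF mq, of "q @ [\<zero>]"] q by simp
  also have "\<dots> = poly_add (q @ [\<zero>]) ?m"
    using poly_add_comm[of "q @ [\<zero>]" ?m] q mq by simp
  also have "\<dots> = normalize (map2 (\<oplus>) (q @ [\<zero>]) (\<zero> # ?m))"
    by simp
  finally have "deriv_eval (poly_mult [\<one>, \<ominus> y] q) y
      = deriv_eval (map2 (\<oplus>) (q @ [\<zero>]) (\<zero> # ?m)) y"
    using deriv_eval_normalize[OF map2c assms(2)] by simp
  also have "\<dots> = deriv_eval (q @ [\<zero>]) y \<oplus> deriv_eval (\<zero> # ?m) y"
    using q mq assms(2) by (intro deriv_eval_add_same_length) auto
  also have "\<dots> = (deriv_eval q y \<otimes> y \<oplus> eval q y) \<oplus> \<ominus> y \<otimes> deriv_eval q y"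
    using q assms(2) deriv_eval_append[OF q zero_closed assms(2)]
      deriv_eval_scalar[OF q, of "\<ominus> y" y] by (simp add: deriv_eval_closed)
  also have "\<dots> = eval q y"
    using deriv_eval_closed[OF q assms(2)] eval_in_carrier[OF q assms(2)] assms(2) by algebra
  finally show ?thesis
    by (simp add: univ_poly_mult)
qed

text \<open>After \<open>X - y\<close> is split off, the derivative at \<open>y\<close> is the value
  of the cofactor, which vanishes exactly when \<open>y\<close> has multiplicity at least
  two.\<close>

lemma (in field) deriv_eval_root_eq_zero_iff:
  assumes p: "p \<in> carrier (poly_ring R)" and y: "is_root p y"
  shows "deriv_eval p y = \<zero> \<longleftrightarrow> count (roots p) y \<noteq> 1"
proof -
  have yc: "y \<in> carrier R" and p0: "p \<noteq> []"
    using y by (auto simp: is_root_def)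
  obtain q where q: "q \<in> carrier (poly_ring R)" and pq: "p = [\<one>, \<ominus> y] \<otimes>\<^bsub>poly_ring R\<^esub> q"
    using is_root_imp_pdivides[OF p y] unfolding pdivides_def by (auto elim: dividesE)
  have q0: "q \<noteq> []"
    using p0 pq poly_mult_zero(2)[of "[\<one>, \<ominus> y]"] yc
    by (auto simp: univ_poly_mult simp del: poly_mult.simps)
  have "roots p = add_mset y (roots q)"
    using poly_mult_degree_one_monic_imp_same_roots[OF yc q q0] pq by simp
  moreover have "deriv_eval p y = eval q y"
    using deriv_eval_linear_factor[OF q yc] pq by simp
  moreover have "count (roots q) y = 0 \<longleftrightarrow> \<not> is_root q y"
    using roots_mem_iff_is_root[OF q, of y] by (simp add: count_eq_zero_iff)
  ultimately show ?thesis
    using q0 yc by (simp add: is_root_def)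
qed

section \<open>Multiplicities and the number of distinct roots\<close>

lemma size_eq_card_set_mset_iff: "size M = card (set_mset M) \<longleftrightarrow> (\<forall>x\<in>#M. count M x = 1)"
proof
  assume "size M = card (set_mset M)"
  then have "size (mset_set (set_mset M)) = size M"
    by simp
  moreover have "mset_set (set_mset M) \<subseteq># M"
    by (rule mset_set_set_mset_msubset)
  ultimately have "mset_set (set_mset M) = M"
    by (metis mset_subset_size subset_mset.le_imp_less_or_eq nat_less_le)
  then show "\<forall>x\<in>#M. count M x = 1"
    by (metis count_mset_set(1) finite_set_mset)
next
  assume "\<forall>x\<in>#M. count M x = 1"
  then show "size M = card (set_mset M)"
    by (simp add: size_multiset_overloaded_eq)
qed

lemma (in domain) set_mset_roots:
  "p \<in> carrier (poly_ring R) \<Longrightarrow> set_mset (roots p) = {y. is_root p y}"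
  using roots_mem_iff_is_root by blast

lemma (in field) card_roots_le_degree:
  assumes "p \<in> carrier (poly_ring R)"
  shows "card {y. is_root p y} \<le> degree p"
  using size_roots_le_degree[OF assms] size_mset_mono[OF mset_set_set_mset_msubset, of "roots p"]
  by (simp add: set_mset_roots[OF assms])

context algebraically_closed
begin

lemma root_exists:
  assumes "q \<in> carrier (poly_ring L)" "degree q \<noteq> 0"
  obtains y where "is_root q y"
proof -
  have "size (roots q) = degree q"
    using roots_over_carrier[OF assms(1)] by (simp add: splitted_def)
  then have "roots q \<noteq> {#}"
    using assms(2) by auto
  then show thesis
    using that roots_mem_iff_is_root[OF assms(1)] by blast
qed

text \<open>A nonconstant common divisor of \<open>p\<close> and its derivative has a root here, and
  conversely a common root yields a common linear factor.\<close>

lemma separable_poly_iff_simple_roots: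
  assumes p: "p \<in> carrier (poly_ring L)" "p \<noteq> []"
  shows "separable_poly L p \<longleftrightarrow> (\<forall>y. is_root p y \<longrightarrow> deriv_eval p y \<noteq> \<zero>)"
proof
  have pc: "set p \<subseteq> carrier L"
    using p(1) by (metis polynomial_incl univ_poly_carrier)
  have dc: "pderiv_list L p \<in> carrier (poly_ring L)"
  proof -
    have "set (map (\<lambda>(a, i). add_pow L (i::nat) a) (zip (butlast p) (rev [1..<length p]))) \<subseteq> carrier L"
      using pc by (auto dest!: set_zip_leftD in_set_butlastD)
    then show ?thesis
      unfolding pderiv_list_def using normalize_gives_polynomial univ_poly_carrier by blast
  qed
  {
    assume sep: "separable_poly L p"
    show "\<forall>y. is_root p y \<longrightarrow> deriv_eval p y \<noteq> \<zero>"
    proof (intro allI impI notI)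
      fix y assume y: "is_root p y" and d: "deriv_eval p y = \<zero>"
      then have yc: "y \<in> carrier L" by (simp add: is_root_def)
      have lin: "[\<one>, \<ominus> y] \<in> carrier (poly_ring L)"
        using yc by (auto simp: univ_poly_def polynomial_def)
      have "[\<one>, \<ominus> y] pdivides pderiv_list L p"
      \<comment> \<open>\<open>is_root\<close> excludes the zero polynomial, so a vanishing
        derivative, as for \<open>X^p - a\<close> in characteristic \<open>p\<close>, is treated
        apart: every linear factor divides it.\<close>
      proof (cases "pderiv_list L p = []")
        case True
        then show ?thesis
          using pdivides_zero[OF carrier_is_subring lin] by simp
      next
        case False
        then have "is_root (pderiv_list L p) y"
          using d eval_pderiv_list[OF pc yc] yc by (simp add: is_root_def)
        then show ?thesis
          by (rule is_root_imp_pdivides[OF dc])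
      qed
      then show False
        using sep lin is_root_imp_pdivides[OF p(1) y] by (force simp: separable_poly_def)
    qed
  next
    assume simple: "\<forall>y. is_root p y \<longrightarrow> deriv_eval p y \<noteq> \<zero>"
    show "separable_poly L p"
      unfolding separable_poly_def
    proof (intro ballI impI, rule ccontr)
      fix q assume q: "q \<in> carrier (poly_ring L)" "q pdivides p \<and> q pdivides pderiv_list L p"
        and "degree q \<noteq> 0"
      then obtain y where y: "is_root q y"
        using root_exists by blast
      then have yc: "y \<in> carrier L" and "eval q y = \<zero>" by (simp_all add: is_root_def)
      then have "is_root p y" and "eval (pderiv_list L p) y = \<zero>"
        using pdivides_imp_root_sharing[OF q(1) _ yc] q(2) p(2) by (auto simp: is_root_def)
      then show False
        using simple eval_pderiv_list[OF pc yc] by auto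
    qed
  }
qed

text \<open>With multiplicities there are always \<open>degree p\<close> roots, so the number of
  distinct ones detects repetition. In this form separability is inherited by divisors and
  transferred to coordinates.\<close>

lemma separable_poly_iff_card_roots:
  assumes p: "p \<in> carrier (poly_ring L)" "p \<noteq> []"
  shows "separable_poly L p \<longleftrightarrow> card {y. is_root p y} = degree p"
proof -
  have "size (roots p) = degree p"
    using roots_over_carrier[OF p(1)] by (simp add: splitted_def)
  moreover have "separable_poly L p \<longleftrightarrow> (\<forall>y\<in>#roots p. count (roots p) y = 1)"
    using separable_poly_iff_simple_roots[OF p] deriv_eval_root_eq_zero_iff[OF p(1)]
      roots_mem_iff_is_root[OF p(1)] by blast
  ultimately show ?thesis
    using size_eq_card_set_mset_iff[of "roots p"] set_mset_roots[OF p(1)] by auto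
qed

end

section \<open>Minimal polynomials over a subfield\<close>

lemma (in domain) Irr_facts:
  assumes "subfield K R" "x \<in> carrier R" "(algebraic over K) x"
  shows "Irr K x \<in> carrier (poly_ring R)" "Irr K x \<noteq> []" "set (Irr K x) \<subseteq> K"
    "degree (Irr K x) > 0" "is_root (Irr K x) x"
proof -
  note I = IrrE[OF assms]
  show 1: "Irr K x \<in> carrier (poly_ring R)"
    using carrier_polynomial_shell[OF subfieldE(1)[OF assms(1)] I(1)] .
  show 2: "Irr K x \<noteq> []"
    using pirreducibleE(1)[OF subfieldE(1)[OF assms(1)] I(1,2)] .
  show "set (Irr K x) \<subseteq> K"
    using I(1) by (metis polynomial_incl univ_poly_carrier)
  show "degree (Irr K x) > 0"
    using pirreducible_degree[OF assms(1) I(1,2)] by linarith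
  show "is_root (Irr K x) x"
    using 2 I(4) assms(2) by (simp add: is_root_def)
qed

lemma (in algebraically_closed) separable_elt_iff:
  assumes K: "subfield K L" and x: "x \<in> carrier L"
  shows "separable_elt L K x \<longleftrightarrow>
    (algebraic over K) x \<and> card {y. is_root (Irr K x) y} = degree (Irr K x)"
  using separable_poly_iff_card_roots[OF Irr_facts(1,2)[OF K x]] x
  by (auto simp: separable_elt_def over_def)

section \<open>Splitting, embeddings and primitive elements\<close>

lemma (in domain) linear_factor_product_closed:
  assumes "subring S R" "set rs \<subseteq> S" "c \<in> S" "c \<noteq> \<zero>"
  shows "foldr (\<lambda>r q. [\<one>, \<ominus> r] \<otimes>\<^bsub>poly_ring R\<^esub> q) rs [c] \<in> carrier (S[X])"
  using assms(2)
proof (induct rs)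
  case Nil
  then show ?case
    using assms by (auto simp: univ_poly_def polynomial_def)
next
  case (Cons r rs)
  then have "[\<one>, \<ominus> r] \<in> carrier (S[X])"
    using subringE(3,5)[OF assms(1)] by (auto simp: univ_poly_def polynomial_def)
  moreover have "monoid.mult (poly_ring R) = monoid.mult (S[X])"
    by (simp add: univ_poly_mult)
  ultimately show ?case
    using Cons ring.ring_simprules(5)[OF univ_poly_is_ring[OF assms(1)]] by simp
qed

lemma (in field) monic_splitted_eq_product:
  assumes "p \<in> carrier (poly_ring R)" "p \<noteq> []" "lead_coeff p = \<one>" "splitted p"
  shows "\<exists>rs. set rs \<subseteq> {y. is_root p y} \<and>
    p = foldr (\<lambda>r q. [\<one>, \<ominus> r] \<otimes>\<^bsub>poly_ring R\<^esub> q) rs [\<one>]"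
  using assms
proof (induct "degree p" arbitrary: p)
  case 0
  then have "p = [\<one>]"
    by (cases p) auto
  then show ?case
    by (intro exI[of _ "[]"]) simp
next
  case (Suc n)
  then have "roots p \<noteq> {#}"
    by (auto simp: splitted_def)
  then obtain y where y: "is_root p y"
    using roots_mem_iff_is_root[OF Suc(3)] by blast
  then have yc: "y \<in> carrier R"
    by (simp add: is_root_def)
  obtain q where q: "q \<in> carrier (poly_ring R)" and pq: "p = [\<one>, \<ominus> y] \<otimes>\<^bsub>poly_ring R\<^esub> q"
    using is_root_imp_pdivides[OF Suc(3) y] unfolding pdivides_def by (auto elim: dividesE)
  have q0: "q \<noteq> []"
    using Suc(4) pq poly_mult_zero(2)[of "[\<one>, \<ominus> y]"] yc
    by (auto simp: univ_poly_mult simp del: poly_mult.simps)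
  have rp: "roots p = add_mset y (roots q)"
    using poly_mult_degree_one_monic_imp_same_roots[OF yc q q0] pq by simp
  have lin: "polynomial (carrier R) [\<one>, \<ominus> y]"
    using yc by (auto simp: polynomial_def)
  have qp: "polynomial (carrier R) q"
    using q by (simp add: univ_poly_carrier)
  have "degree p = 1 + degree q"
    using poly_mult_degree_eq[OF carrier_is_subring lin qp] q0 pq by (simp add: univ_poly_mult)
  moreover have "lead_coeff q = \<one>"
  proof -
    have "lead_coeff q \<in> carrier R"
      using q0 polynomial_incl[OF qp] by (cases q) auto
    then show ?thesis
      using poly_mult_lead_coeff[OF carrier_is_subring lin qp] q0 pq Suc(5)
      by (simp add: univ_poly_mult)
  qed
  moreover have "splitted q"
    using Suc(6) rp calculation(1) by (simp add: splitted_def)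
  ultimately obtain rs where rs: "set rs \<subseteq> {y. is_root q y}"
    "q = foldr (\<lambda>r q. [\<one>, \<ominus> r] \<otimes>\<^bsub>poly_ring R\<^esub> q) rs [\<one>]"
    using Suc(1)[OF _ q q0] Suc(2) by auto
  have "{y. is_root q y} \<subseteq> {y. is_root p y}"
    using rp set_mset_roots[OF q] set_mset_roots[OF Suc(3)] by auto
  then show ?case
    using rs pq y by (intro exI[of _ "y # rs"]) auto
qed

lemma (in field) splits_inI:
  assumes "p \<in> carrier (poly_ring R)" "p \<noteq> []" "lead_coeff p = \<one>" "splitted p"
    "{y. is_root p y} \<subseteq> E" "\<one> \<in> E"
  shows "splits_in R E p"
  using monic_splitted_eq_product[OF assms(1-4)] assms(5,6) unfolding splits_in_def by blast

text \<open>The coefficients are polynomial expressions in the roots. Applied to the subring of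
  elements algebraic over a small field, this shows that a polynomial over a larger field has
  algebraic coefficients once its roots are algebraic.\<close>

lemma (in field) monic_splitted_coeffs:
  assumes "p \<in> carrier (poly_ring R)" "p \<noteq> []" "lead_coeff p = \<one>" "splitted p"
    "{y. is_root p y} \<subseteq> S" "subring S R"
  shows "p \<in> carrier (S[X])"
proof -
  obtain rs where "set rs \<subseteq> {y. is_root p y}"
    and "p = foldr (\<lambda>r q. [\<one>, \<ominus> r] \<otimes>\<^bsub>poly_ring R\<^esub> q) rs [\<one>]"
    using monic_splitted_eq_product[OF assms(1-4)] by blast
  then show ?thesis
    using linear_factor_product_closed[OF assms(6) _ subringE(3)[OF assms(6)] one_not_zero, of rs]
      assms(5) by auto
qed

lemma (in field) roots_in_if_splits_in:
  assumes p: "p \<in> carrier (poly_ring R)" and split: "splits_in R E p" and E: "subring E R"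
  shows "{y. is_root p y} \<subseteq> E"
proof -
  let ?f = "\<lambda>r q. [\<one>, \<ominus> r] \<otimes>\<^bsub>poly_ring R\<^esub> q"
  obtain c rs where c: "c \<in> E" "set rs \<subseteq> E" and prs: "p = foldr ?f rs [c]"
    using split unfolding splits_in_def by blast
  have rc: "set rs \<subseteq> carrier R"
    using c(2) subringE(1)[OF E] by auto
  \<comment> \<open>\<open>splits_in\<close> admits \<open>c = \<zero>\<close>, where the product is
    the zero polynomial \<open>[]\<close> or the unnormalized list \<open>[\<zero>]\<close>. Neither
    is possible for a polynomial that has a root.\<close>
  have zero: "foldr ?f rs [\<zero>] \<in> {[\<zero>], []}" if "set rs \<subseteq> carrier R" for rs
    using that
  proof (induct rs)
    case (Cons r rs)
    have "poly_mult [\<one>, \<ominus> r] [\<zero>] = poly_mult [\<zero>] [\<one>, \<ominus> r]"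
      using Cons(2) by (intro poly_mult_comm) auto
    also have "\<dots> = []"
      using poly_mult_replicate_zero(1)[of "[\<one>, \<ominus> r]" 1] Cons(2) by auto
    finally have "poly_mult [\<one>, \<ominus> r] [\<zero>] = []" .
    moreover have "poly_mult [\<one>, \<ominus> r] [] = []"
      using Cons(2) by (intro poly_mult_zero) auto
    ultimately show ?case
      using Cons by (auto simp: univ_poly_mult simp del: poly_mult.simps)
  qed simp
  have roots: "x \<in> set rs" if "eval (foldr ?f rs [c]) x = \<zero>" "x \<in> carrier R" "c \<noteq> \<zero>"
    "set rs \<subseteq> carrier R" for x rs
    using that
  proof (induct rs)
    case Nil
    then show ?case
      using c subringE(1)[OF E] by auto
  next
    case (Cons r rs)
    have r: "r \<in> carrier R"
      using Cons(5) by auto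
    have "foldr ?f rs [c] \<in> carrier (poly_ring R)"
      using linear_factor_product_closed[OF carrier_is_subring, of rs c] Cons(4,5) c
        subringE(1)[OF E] by auto
    then have fc: "set (foldr ?f rs [c]) \<subseteq> carrier R"
      by (metis polynomial_incl univ_poly_carrier)
    have "eval [\<one>, \<ominus> r] x \<otimes> eval (foldr ?f rs [c]) x = \<zero>"
      using eval_poly_mult[OF _ fc Cons(3), of "[\<one>, \<ominus> r]"] Cons(2) r
      by (simp add: univ_poly_mult del: poly_mult.simps)
    then have "eval [\<one>, \<ominus> r] x = \<zero> \<or> eval (foldr ?f rs [c]) x = \<zero>"
      using integral_iff eval_in_carrier[OF fc Cons(3)] eval_in_carrier[of "[\<one>, \<ominus> r]" x] r Cons(3)
      by auto
    then show ?case
    proof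
      assume "eval [\<one>, \<ominus> r] x = \<zero>"
      then have "x = r"
        using r_right_minus_eq[OF Cons(3) r] r Cons(3) by (simp add: minus_eq)
      then show ?thesis by simp
    qed (use Cons in auto)
  qed
  show ?thesis
  proof
    fix y assume "y \<in> {y. is_root p y}"
    then have y: "y \<in> carrier R" "eval p y = \<zero>" "p \<noteq> []"
      by (auto simp: is_root_def)
    have "c \<noteq> \<zero>"
    proof
      assume "c = \<zero>"
      then have "p = [\<zero>]"
        using zero[OF rc] prs y(3) by (simp del: foldr.simps)
      then show False
        using p by (simp add: univ_poly_def polynomial_def)
    qed
    then show "y \<in> E"
      using roots[OF _ y(1) _ rc] y(2) prs c(2) by blast
  qed
qed

section \<open>Embeddings over a base field\<close>

definition (in ring) embedding_over :: "'a set \<Rightarrow> 'a set \<Rightarrow> ('a \<Rightarrow> 'a) \<Rightarrow> bool" where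
  "embedding_over K E \<tau> \<longleftrightarrow> \<tau> ` E \<subseteq> carrier R \<and> (\<forall>k\<in>K. \<tau> k = k) \<and>
     (\<forall>x\<in>E. \<forall>y\<in>E. \<tau> (x \<oplus> y) = \<tau> x \<oplus> \<tau> y \<and> \<tau> (x \<otimes> y) = \<tau> x \<otimes> \<tau> y)"

lemma (in ring) embedding_over_pow:
  assumes "embedding_over K E \<tau>" "subring K R" "subring E R" "x \<in> E"
  shows "x [^] (n::nat) \<in> E" "\<tau> (x [^] n) = \<tau> x [^] n"
proof -
  show "x [^] n \<in> E" for n :: nat
    using assms subringE(3,6)[OF assms(3)] by (induct n) auto
  then show "\<tau> (x [^] n) = \<tau> x [^] n"
    using assms subringE(3)[OF assms(2)] by (induct n) (auto simp: embedding_over_def)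
qed

lemma (in ring) eval_in_subring:
  assumes "subring E R" "set p \<subseteq> E" "x \<in> E"
  shows "eval p x \<in> E"
proof -
  have "x [^] n \<in> E" for n :: nat
    using assms subringE(3,6)[OF assms(1)] by (induct n) auto
  then show ?thesis
    using assms subringE(2,6,7)[OF assms(1)] by (induct p) auto
qed

lemma (in ring) embedding_over_eval:
  assumes "embedding_over K E \<tau>" "subring K R" "subring E R" "set p \<subseteq> E" "x \<in> E"
  shows "\<tau> (eval p x) = eval (map \<tau> p) (\<tau> x)"
  using assms(4)
proof (induct p)
  case Nil
  then show ?case
    using assms(1) subringE(2)[OF assms(2)] by (simp add: embedding_over_def)
next
  case (Cons a p)
  have "a \<otimes> x [^] length p \<in> E" "eval p x \<in> E"
    using Cons embedding_over_pow[OF assms(1-3,5)] subringE(6)[OF assms(3)]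
      eval_in_subring[OF assms(3) _ assms(5)] by auto
  then show ?case
    using Cons embedding_over_pow[OF assms(1-3,5)] assms(1) by (simp add: embedding_over_def)
qed

lemma (in ring) embedding_over_eval_base:
  assumes "embedding_over K E \<tau>" "subring K R" "subring E R" "K \<subseteq> E" "set p \<subseteq> K" "x \<in> E"
  shows "\<tau> (eval p x) = eval p (\<tau> x)"
proof -
  have "map \<tau> p = p"
    using assms(1,5) by (intro map_idI) (auto simp: embedding_over_def)
  then show ?thesis
    using embedding_over_eval[OF assms(1-3) _ assms(6), of p] assms(4,5) by auto
qed

text \<open>A nonzero difference with image zero is invertible in \<open>E\<close>, and applying
  \<open>\<tau>\<close> to the product with its inverse gives
  \<open>\<tau> \<one> = \<zero>\<close>. But \<open>\<tau>\<close> fixes zero and one because they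
  lie in \<open>K\<close>.\<close>

lemma (in field) embedding_over_inj:
  assumes \<tau>: "embedding_over K E \<tau>" and K: "subring K R" and E: "subfield E R"
  shows "inj_on \<tau> E"
proof (rule inj_onI, rule ccontr)
  note Es = subringE[OF subfieldE(1)[OF E]]
  have z: "\<tau> \<zero> = \<zero>" "\<tau> \<one> = \<one>"
    using \<tau> subringE(2,3)[OF K] by (auto simp: embedding_over_def)
  fix x y assume xy: "x \<in> E" "y \<in> E" "\<tau> x = \<tau> y" "x \<noteq> y"
  then have c: "x \<in> carrier R" "y \<in> carrier R" "\<tau> x \<in> carrier R" "\<tau> (\<ominus> y) \<in> carrier R" "\<ominus> y \<in> E"
    using Es(1,5) \<tau> by (auto simp: embedding_over_def)
  have "\<tau> y \<oplus> \<tau> (\<ominus> y) = \<tau> (y \<oplus> \<ominus> y)"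
    using \<tau> xy c by (simp add: embedding_over_def)
  then have "\<tau> (x \<oplus> \<ominus> y) = \<zero>"
    using \<tau> xy c z by (simp add: embedding_over_def r_neg)
  moreover have d: "x \<oplus> \<ominus> y \<in> E - {\<zero>}"
    using xy c Es(7) r_right_minus_eq by (auto simp: minus_eq)
  ultimately have "\<tau> ((x \<oplus> \<ominus> y) \<otimes> inv (x \<oplus> \<ominus> y)) = \<zero> \<otimes> \<tau> (inv (x \<oplus> \<ominus> y))"
    using \<tau> subfield_m_inv(1)[OF E d] by (simp add: embedding_over_def)
  then have "\<tau> \<one> = \<zero> \<otimes> \<tau> (inv (x \<oplus> \<ominus> y))"
    using subfield_m_inv(2)[OF E d] by simp
  moreover have "\<tau> (inv (x \<oplus> \<ominus> y)) \<in> carrier R"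
    using \<tau> subfield_m_inv(1)[OF E d] by (auto simp: embedding_over_def)
  ultimately show False
    using z by simp
qed

lemma (in domain) simple_extension_cases:
  assumes "subfield K R" "x \<in> carrier R" "y \<in> simple_extension K x"
  obtains p where "p \<in> carrier (K[X])" "set p \<subseteq> K" "y = eval p x"
  using assms(3) simple_extension_as_eval_img[OF subfieldE(3)[OF assms(1)] assms(2)]
  by (metis (no_types, lifting) imageE polynomial_incl univ_poly_carrier)

lemma (in domain) embedding_over_simple_extension_eq:
  assumes "subfield K R" "x \<in> carrier R"
    "embedding_over K (simple_extension K x) \<rho>" "embedding_over K (simple_extension K x) \<tau>"
    "\<rho> x = \<tau> x" "y \<in> simple_extension K x"
  shows "\<rho> y = \<tau> y"
proof -
  note K = subfieldE(1)[OF assms(1)]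
  note E = simple_extension_is_subring[OF K assms(2)] simple_extension_incl[OF subringE(1)[OF K] assms(2)]
    and x = simple_extension_mem[OF K assms(2)]
  obtain p where "set p \<subseteq> K" "y = eval p x"
    using simple_extension_cases[OF assms(1,2,6)] by blast
  then show ?thesis
    using embedding_over_eval_base[OF assms(3) K E _ x] embedding_over_eval_base[OF assms(4) K E _ x]
      assms(5) by metis
qed

lemma (in domain) Irr_pdivides_iff:
  assumes "subfield K R" "x \<in> carrier R" "(algebraic over K) x" "p \<in> carrier (K[X])"
  shows "Irr K x pdivides p \<longleftrightarrow> eval p x = \<zero>"
  using Irr_minimal[OF assms] pdivides_imp_root_sharing[OF Irr_facts(1)[OF assms(1-3)] _ assms(2), of p]
    IrrE(4)[OF assms(1-3)] by blast

text \<open>The map sends \<open>p(x)\<close> to \<open>p(y)\<close>. It is well defined because a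
  polynomial over \<open>K\<close> vanishing at \<open>x\<close> is a multiple of
  \<open>Irr K x\<close>, which vanishes at \<open>y\<close>. The last conclusion exposes the
  formula for the counting of conjugates.\<close>

lemma (in field) conjugate_embedding:
  assumes K: "subfield K R" and x: "x \<in> carrier R" "(algebraic over K) x"
    and y: "is_root (Irr K x) y"
  obtains \<tau> where "embedding_over K (simple_extension K x) \<tau>" "\<tau> x = y"
    "\<And>p. p \<in> carrier (K[X]) \<Longrightarrow> \<tau> (eval p x) = eval p y"
proof -
  have yc: "y \<in> carrier R" "eval (Irr K x) y = \<zero>"
    using y by (auto simp: is_root_def)
  note Ks = subfieldE(1)[OF K]
  interpret X: ring_hom_ring "K[X]" R "\<lambda>p. eval p x"
    using eval_ring_hom[OF Ks x(1)] .
  interpret Y: ring_hom_ring "K[X]" R "\<lambda>p. eval p y"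
    using eval_ring_hom[OF Ks yc(1)] .
  note img = simple_extension_as_eval_img[OF subfieldE(3)[OF K] x(1)]
  define \<tau> where "\<tau> z = eval (SOME p. p \<in> carrier (K[X]) \<and> eval p x = z) y" for z
  have wd: "eval p y = eval q y" if "p \<in> carrier (K[X])" "q \<in> carrier (K[X])" "eval p x = eval q x" for p q
  proof -
    have "p \<ominus>\<^bsub>K[X]\<^esub> q \<in> carrier (K[X])" "eval (p \<ominus>\<^bsub>K[X]\<^esub> q) x = \<zero>"
      using that X.hom_closed[of q] by (simp_all add: X.R.minus_eq r_neg)
    then have "Irr K x pdivides (p \<ominus>\<^bsub>K[X]\<^esub> q)"
      using Irr_minimal[OF K x] by blast
    then have "eval (p \<ominus>\<^bsub>K[X]\<^esub> q) y = \<zero>"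
      using pdivides_imp_root_sharing[OF Irr_facts(1)[OF K x] _ yc(1)] yc(2) by blast
    then show ?thesis
      using that Y.hom_closed by (simp add: X.R.minus_eq r_right_minus_eq minus_eq[symmetric])
  qed
  have ev: "\<tau> (eval p x) = eval p y" if "p \<in> carrier (K[X])" for p
  proof -
    let ?q = "SOME q. q \<in> carrier (K[X]) \<and> eval q x = eval p x"
    have "?q \<in> carrier (K[X]) \<and> eval ?q x = eval p x"
      by (rule someI[of _ p]) (use that in auto)
    then show ?thesis
      unfolding \<tau>_def using wd[OF _ that, of ?q] by blast
  qed
  show thesis
  proof (rule that)
    show "\<tau> (eval p x) = eval p y" if "p \<in> carrier (K[X])" for p
      using ev[OF that] .
    have "\<tau> (eval X x) = eval X y"
      using ev[OF var_closed(1)[OF Ks]] .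
    then show "\<tau> x = y"
      using eval_var x(1) yc(1) by simp
    show "embedding_over K (simple_extension K x) \<tau>"
      unfolding embedding_over_def
    proof (intro conjI ballI)
      show "\<tau> ` simple_extension K x \<subseteq> carrier R"
        using ev Y.hom_closed by (auto simp: img)
      show "\<tau> k = k" if "k \<in> K" for k
      \<comment> \<open>\<open>[k]\<close> is a polynomial only for nonzero \<open>k\<close>; the
        constant zero is the empty list.\<close>
      proof (cases "k = \<zero>")
        case True
        then show ?thesis
          using ev[of "[]"] by (simp add: univ_poly_def polynomial_def)
      next
        case False
        then have "[k] \<in> carrier (K[X])" "k \<in> carrier R"
          using that subfieldE(3)[OF K] by (auto simp: univ_poly_def polynomial_def)
        then show ?thesis
          using ev[of "[k]"] by simp
      qed
      fix u v assume "u \<in> simple_extension K x" "v \<in> simple_extension K x"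
      then obtain p q where pq: "p \<in> carrier (K[X])" "q \<in> carrier (K[X])" "u = eval p x" "v = eval q x"
        unfolding img by auto
      show "\<tau> (u \<oplus> v) = \<tau> u \<oplus> \<tau> v"
        using ev[of "p \<oplus>\<^bsub>K[X]\<^esub> q"] ev pq by simp
      show "\<tau> (u \<otimes> v) = \<tau> u \<otimes> \<tau> v"
        using ev[of "p \<otimes>\<^bsub>K[X]\<^esub> q"] ev pq by simp
    qed
  qed
qed

lemma (in ring) embedding_overD:
  assumes "embedding_over K E \<tau>"
  shows "\<And>x. x \<in> E \<Longrightarrow> \<tau> x \<in> carrier R" "\<And>k. k \<in> K \<Longrightarrow> \<tau> k = k"
    "\<And>x y. \<lbrakk>x \<in> E; y \<in> E\<rbrakk> \<Longrightarrow> \<tau> (x \<oplus> y) = \<tau> x \<oplus> \<tau> y"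
    "\<And>x y. \<lbrakk>x \<in> E; y \<in> E\<rbrakk> \<Longrightarrow> \<tau> (x \<otimes> y) = \<tau> x \<otimes> \<tau> y"
  using assms by (auto simp: embedding_over_def)

lemma (in ring) subring_minus_mult_closed:
  assumes "subring S R" "a \<in> S" "b \<in> S" "c \<in> S"
  shows "a \<ominus> b \<otimes> c \<in> S"
  using subringE(5)[OF assms(1) subringE(6)[OF assms(1,3,4)]] subringE(7)[OF assms(1,2)]
  by (simp add: minus_eq)

lemma (in ring) embedding_over_subset:
  assumes "embedding_over K E \<tau>" "K' \<subseteq> K" "E' \<subseteq> E"
  shows "embedding_over K' E' \<tau>"
  unfolding embedding_over_def
proof (intro conjI ballI)
  note D = embedding_overD[OF assms(1)]
  show "\<tau> ` E' \<subseteq> carrier R"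
    using D(1) assms(3) by blast
  show "\<tau> k = k" if "k \<in> K'" for k
    using D(2) assms(2) that by blast
  fix x y assume "x \<in> E'" "y \<in> E'"
  then have "x \<in> E" "y \<in> E"
    using assms(3) by auto
  then show "\<tau> (x \<oplus> y) = \<tau> x \<oplus> \<tau> y" "\<tau> (x \<otimes> y) = \<tau> x \<otimes> \<tau> y"
    by (rule D(3), rule D(4))
qed

section \<open>Simple algebraic extensions, degrees and conjugates\<close>

lemma (in field) generate_field_insert_algebraic:
  assumes K: "subfield K R" and x: "x \<in> carrier R" "(algebraic over K) x"
  shows "generate_field R (insert x K) = simple_extension K x"
proof
  have c: "insert x K \<subseteq> carrier R"
    using subfieldE(3)[OF K] x by auto
  have "subfield (simple_extension K x) R"
    using simple_extension_is_subfield[OF K x(1)] x(2) by blast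
  moreover have "insert x K \<subseteq> simple_extension K x"
    using simple_extension_mem[OF subfieldE(1)[OF K] x(1)]
      simple_extension_incl[OF subfieldE(3)[OF K] x(1)] by auto
  ultimately show "generate_field R (insert x K) \<subseteq> simple_extension K x"
    using generate_field_min_subfield1[OF c] by blast
  have "subring (generate_field R (insert x K)) R"
    using generate_field_is_subfield[OF c] subfieldE(1) by blast
  then show "simple_extension K x \<subseteq> generate_field R (insert x K)"
    by (rule simple_extension_subring_incl) (auto intro: generate_field.incl)
qed

lemma (in field) algebraic_simple_extension:
  assumes "subfield K R" "x \<in> carrier R" "(algebraic over K) x"
  shows "subfield (simple_extension K x) R" "K \<subseteq> simple_extension K x" "x \<in> simple_extension K x"
    "simple_extension K x \<subseteq> carrier R" "subring (simple_extension K x) R"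
    "\<And>y. y \<in> simple_extension K x \<Longrightarrow> (algebraic over K) y"
    "dimension (degree (Irr K x)) K (simple_extension K x)"
  using simple_extension_is_subfield[OF assms(1,2)] simple_extension_incl[OF subfieldE(3)[OF assms(1)] assms(2)]
    simple_extension_mem[OF subfieldE(1)[OF assms(1)] assms(2)]
    simple_extension_in_carrier[OF subfieldE(3)[OF assms(1)] assms(2)]
    simple_extension_is_subring[OF subfieldE(1)[OF assms(1)] assms(2)]
    simple_extesion_mem_imp_algebraic[OF assms]
    dimension_simple_extension[OF assms] assms(3) by auto

text \<open>Since \<open>K(y)\<close> lies in \<open>K(x)\<close>, adjoining \<open>x\<close> to it
  gives \<open>K(x)\<close> again, and dimensions multiply along the tower.\<close>

lemma (in field) degree_Irr_tower:
  assumes K: "subfield K R" and x: "x \<in> carrier R" "(algebraic over K) x"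
    and y: "y \<in> simple_extension K x"
  shows "degree (Irr K y) * degree (Irr (simple_extension K y) x) = degree (Irr K x)"
    and "simple_extension (simple_extension K y) x = simple_extension K x"
proof -
  note E = algebraic_simple_extension[OF K x]
  have yc: "y \<in> carrier R" "(algebraic over K) y"
    using E(4,6) y by auto
  note L = algebraic_simple_extension[OF K yc]
  have xL: "(algebraic over (simple_extension K y)) x"
    using algebraic_mono[OF L(2) x(2)] .
  show eq: "simple_extension (simple_extension K y) x = simple_extension K x"
  proof
    have "simple_extension K y \<subseteq> simple_extension K x"
      using simple_extension_subring_incl[OF E(5,2) y] .
    then show "simple_extension (simple_extension K y) x \<subseteq> simple_extension K x"
      by (rule simple_extension_subring_incl[OF E(5) _ E(3)])
    show "simple_extension K x \<subseteq> simple_extension (simple_extension K y) x"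
      using mono_simple_extension[OF L(2)] .
  qed
  have "dimension (degree (Irr K y) * degree (Irr (simple_extension K y) x)) K (simple_extension K x)"
    using telescopic_base[OF K L(1) L(7)] dimension_simple_extension[OF L(1) x(1) xL] eq by simp
  then show "degree (Irr K y) * degree (Irr (simple_extension K y) x) = degree (Irr K x)"
    using dimension_is_inj[OF K _ E(7)] by blast
qed

text \<open>Conjugates \<open>a\<close> of \<open>x\<close> with the same value \<open>p a\<close>
  define embeddings that agree on \<open>K(p x)\<close>. Hence they map the minimal polynomial of
  \<open>x\<close> over \<open>K(p x)\<close> to one and the same polynomial, and all these
  \<open>a\<close> are roots of it. The embedding \<open>\<tau>\<close> belonging to one member
  \<open>b\<close> of the fibre serves to write this polynomial down.\<close>

lemma (in field) card_conjugates_fibre_le: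
  assumes K: "subfield K R" and x: "x \<in> carrier R" "(algebraic over K) x"
    and p: "p \<in> carrier (K[X])"
  shows "card {a. is_root (Irr K x) a \<and> eval p a = y} \<le> degree (Irr (simple_extension K (eval p x)) x)"
proof (cases "{a. is_root (Irr K x) a \<and> eval p a = y} = {}")
  case False
  then obtain b where b: "is_root (Irr K x) b" "eval p b = y"
    by auto
  define z where "z = eval p x"
  note E = algebraic_simple_extension[OF K x]
  have zE: "z \<in> simple_extension K x"
    using p simple_extension_as_eval_img[OF subfieldE(3)[OF K] x(1)] by (auto simp: z_def)
  then have zc: "z \<in> carrier R" "(algebraic over K) z"
    using E(4,6) by auto
  note L = algebraic_simple_extension[OF K zc]
  have xL: "(algebraic over (simple_extension K z)) x"
    using algebraic_mono[OF L(2) x(2)] .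
  have LE: "simple_extension K z \<subseteq> simple_extension K x"
    using simple_extension_subring_incl[OF E(5,2) zE] .
  obtain \<tau> where \<tau>: "embedding_over K (simple_extension K x) \<tau>" "\<tau> x = b"
    "\<And>p. p \<in> carrier (K[X]) \<Longrightarrow> \<tau> (eval p x) = eval p b"
    using conjugate_embedding[OF K x b(1)] by blast
  let ?k = "Irr (simple_extension K z) x"
  note k = Irr_facts[OF L(1) x(1) xL]
  have km: "lead_coeff ?k = \<one>" "eval ?k x = \<zero>"
    using IrrE[OF L(1) x(1) xL] by auto
  have one: "\<tau> \<one> = \<one>" and zero: "\<tau> \<zero> = \<zero>"
    using \<tau>(1) subringE(2,3)[OF subfieldE(1)[OF K]] by (auto simp: embedding_over_def)
  have hd: "hd (map \<tau> ?k) = \<one>"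
    using k(2) km(1) one by (simp add: hd_map)
  have kc: "map \<tau> ?k \<in> carrier (poly_ring R)"
    using k(3) LE \<tau>(1) hd by (auto simp: univ_poly_def polynomial_def embedding_over_def)
  have "{a. is_root (Irr K x) a \<and> eval p a = y} \<subseteq> {a. is_root (map \<tau> ?k) a}"
  proof clarify
    fix a assume a: "is_root (Irr K x) a" "y = eval p a"
    obtain \<rho> where \<rho>: "embedding_over K (simple_extension K x) \<rho>" "\<rho> x = a"
      "\<And>p. p \<in> carrier (K[X]) \<Longrightarrow> \<rho> (eval p x) = eval p a"
      using conjugate_embedding[OF K x a(1)] by blast
    have "embedding_over K (simple_extension K z) \<rho>" "embedding_over K (simple_extension K z) \<tau>"
      using embedding_over_subset[OF \<rho>(1) order_refl LE] embedding_over_subset[OF \<tau>(1) order_refl LE]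
      by auto
    moreover have "\<rho> z = \<tau> z"
      using \<rho>(3)[OF p] \<tau>(3)[OF p] a b by (simp add: z_def)
    ultimately have m: "map \<rho> ?k = map \<tau> ?k"
      using embedding_over_simple_extension_eq[OF K zc(1)] k(3) by auto
    have e: "\<rho> (eval ?k x) = eval (map \<rho> ?k) (\<rho> x)"
      using embedding_over_eval[OF \<rho>(1) subfieldE(1)[OF K] E(5) _ E(3), of ?k] k(3) LE by blast
    have "\<rho> \<zero> = \<zero>"
      using \<rho>(1) subringE(2)[OF subfieldE(1)[OF K]] by (auto simp: embedding_over_def)
    then have "eval (map \<tau> ?k) a = \<zero>"
      using e unfolding m \<rho>(2) km(2) by simp
    then show "is_root (map \<tau> ?k) a"
      using a(1) k(2) by (simp add: is_root_def)
  qed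
  then have "card {a. is_root (Irr K x) a \<and> eval p a = y} \<le> card {a. is_root (map \<tau> ?k) a}"
    by (rule card_mono[OF finite_number_of_roots[OF kc]])
  also have "\<dots> \<le> degree ?k"
    using card_roots_le_degree[OF kc] by simp
  finally show ?thesis
    by (simp add: z_def)
next
  case True
  show ?thesis unfolding True by simp
qed

text \<open>Each value \<open>p a\<close> is taken by at most \<open>[K(x) : K(p x)]\<close> of the \<open>[K(x) : K]\<close> conjugates
  \<open>a\<close> of \<open>x\<close>, so at least \<open>[K(p x) : K]\<close> values occur.\<close>
lemma (in field) conjugates_of_eval:
  assumes K: "subfield K R" and x: "x \<in> carrier R" "(algebraic over K) x"
    and sep: "card {a. is_root (Irr K x) a} = degree (Irr K x)"
    and p: "p \<in> carrier (K[X])"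
  shows "{a. is_root (Irr K (eval p x)) a} = eval p ` {a. is_root (Irr K x) a}"
    and "card {a. is_root (Irr K (eval p x)) a} = degree (Irr K (eval p x))"
proof -
  define z where "z = eval p x"
  define A where "A = {a. is_root (Irr K x) a}"
  define e where "e = degree (Irr (simple_extension K z) x)"
  note E = algebraic_simple_extension[OF K x]
  have zE: "z \<in> simple_extension K x"
    using p simple_extension_as_eval_img[OF subfieldE(3)[OF K] x(1)] by (auto simp: z_def)
  then have zc: "z \<in> carrier R" "(algebraic over K) z"
    using E(4,6) by auto
  have finA: "finite A"
    unfolding A_def using finite_number_of_roots[OF Irr_facts(1)[OF K x]] .
  have finB: "finite {a. is_root (Irr K z) a}"
    using finite_number_of_roots[OF Irr_facts(1)[OF K zc]] .
  have tower: "degree (Irr K z) * e = degree (Irr K x)"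
    unfolding e_def by (rule degree_Irr_tower(1)[OF K x zE])
  have e0: "e > 0"
    using tower Irr_facts(4)[OF K x] by (cases e) auto
  have sub: "eval p ` A \<subseteq> {a. is_root (Irr K z) a}"
  proof clarify
    fix a assume "a \<in> A"
    then obtain \<tau> where \<tau>: "embedding_over K (simple_extension K x) \<tau>"
      "\<And>p. p \<in> carrier (K[X]) \<Longrightarrow> \<tau> (eval p x) = eval p a"
      using conjugate_embedding[OF K x] unfolding A_def by blast
    have "\<tau> (eval (Irr K z) z) = eval (Irr K z) (\<tau> z)"
      using embedding_over_eval_base[OF \<tau>(1) subfieldE(1)[OF K] E(5,2) Irr_facts(3)[OF K zc] zE] .
    moreover have "\<tau> z = eval p a" "\<tau> \<zero> = \<zero>" "\<tau> z \<in> carrier R"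
      using \<tau> p subringE(2)[OF subfieldE(1)[OF K]] zE by (auto simp: z_def embedding_over_def)
    ultimately show "is_root (Irr K z) (eval p a)"
      using IrrE(4)[OF K zc] Irr_facts(2)[OF K zc] by (simp add: is_root_def)
  qed
  have "degree (Irr K z) * e = card A"
    using tower sep by (simp add: A_def)
  also have "\<dots> = (\<Sum>y\<in>eval p ` A. card {a \<in> A. eval p a = y})"
    using sum.image_gen[OF finA, of "\<lambda>_. 1::nat" "eval p"] by simp
  also have "\<dots> \<le> card (eval p ` A) * e"
    using card_conjugates_fibre_le[OF K x p] sum_bounded_above[of "eval p ` A" "\<lambda>y. card {a \<in> A. eval p a = y}" e]
    by (simp add: A_def e_def z_def)
  finally have le: "degree (Irr K z) \<le> card (eval p ` A)"
    using e0 by simp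
  \<comment> \<open>With the previous inequality and the next one the chain returns to
    \<open>degree (Irr K z)\<close>, so equality holds throughout, which gives both claims.\<close>
  also have le2: "\<dots> \<le> card {a. is_root (Irr K z) a}"
    by (rule card_mono[OF finB sub])
  also have le3: "\<dots> \<le> degree (Irr K z)"
    by (rule card_roots_le_degree[OF Irr_facts(1)[OF K zc]])
  finally have "card {a. is_root (Irr K z) a} = degree (Irr K z)"
    using le le2 le3 by linarith
  moreover have "eval p ` A = {a. is_root (Irr K z) a}"
    using card_subset_eq[OF finB sub] le le2 le3 by linarith
  ultimately show "{a. is_root (Irr K (eval p x)) a} = eval p ` {a. is_root (Irr K x) a}"
    and "card {a. is_root (Irr K (eval p x)) a} = degree (Irr K (eval p x))"
    by (simp_all add: z_def A_def)
qed

lemma (in field) mem_if_degree_Irr_eq_one: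
  assumes K: "subfield K R" and x: "x \<in> carrier R" "(algebraic over K) x"
    and deg: "degree (Irr K x) = 1"
  shows "x \<in> K"
proof -
  obtain u v where uv: "Irr K x = [u, v]"
    using deg by (cases "Irr K x"; cases "tl (Irr K x)"; auto)
  have "u = \<one>" and v: "v \<in> K" "v \<in> carrier R"
    using IrrE(3)[OF K x] Irr_facts(3)[OF K x] uv subfieldE(3)[OF K] by auto
  then have "x \<oplus> v = \<zero>"
    using IrrE(4)[OF K x] uv x(1) by simp
  then have "x = \<ominus> v"
    using x(1) v by (simp add: sum_zero_eq_neg)
  then show ?thesis
    using subringE(5)[OF subfieldE(1)[OF K]] v by simp
qed

section \<open>The primitive element theorem\<close>

context algebraically_closed
begin

text \<open>The roots of a divisor form a submultiset, so simplicity of the roots is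
  inherited.\<close>

lemma card_roots_eq_degree_if_pdivides:
  assumes p: "p \<in> carrier (poly_ring L)" and q: "q \<in> carrier (poly_ring L)" "q \<noteq> []"
    and pq: "p pdivides q" and sep: "card {a. is_root q a} = degree q"
  shows "card {a. is_root p a} = degree p"
proof -
  have sz: "size (roots p) = degree p" "size (roots q) = degree q"
    using roots_over_carrier[OF p] roots_over_carrier[OF q(1)] by (simp_all add: splitted_def)
  have one: "\<forall>a\<in>#roots q. count (roots q) a = 1"
    using sep sz size_eq_card_set_mset_iff[of "roots q"] set_mset_roots[OF q(1)] by simp
  have sub: "roots p \<subseteq># roots q"
    by (rule pdivides_imp_roots_incl[OF p q pq])
  have "\<forall>a\<in>#roots p. count (roots p) a = 1"
  proof
    fix a assume a: "a \<in># roots p"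
    then have "count (roots q) a = 1"
      using one mset_subset_eqD[OF sub] by blast
    then show "count (roots p) a = 1"
      using mset_subset_eq_count[OF sub, of a] a count_greater_zero_iff[of "roots p" a] by linarith
  qed
  then show ?thesis
    using sz size_eq_card_set_mset_iff[of "roots p"] set_mset_roots[OF p] by simp
qed

lemma Irr_pdivides_Irr:
  assumes "subfield K L" "subfield K' L" "K \<subseteq> K'" "x \<in> carrier L" "(algebraic over K) x"
  shows "Irr K' x pdivides Irr K x"
proof -
  have "Irr K x \<in> carrier (K'[X])"
    using IrrE(1)[OF assms(1,4,5)] assms(3) by (auto simp: univ_poly_def polynomial_def)
  then show ?thesis
    using Irr_minimal[OF assms(2,4) algebraic_mono[OF assms(3,5)]] IrrE(4)[OF assms(1,4,5)] by blast
qed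

lemma separable_mono:
  assumes "subfield K L" "subfield K' L" "K \<subseteq> K'" "x \<in> carrier L" "(algebraic over K) x"
    and "card {a. is_root (Irr K x) a} = degree (Irr K x)"
  shows "card {a. is_root (Irr K' x) a} = degree (Irr K' x)"
  using card_roots_eq_degree_if_pdivides[OF _ _ _ Irr_pdivides_Irr[OF assms(1-5)] assms(6)]
    Irr_facts(1,2)[OF assms(1,4,5)] Irr_facts(1)[OF assms(2,4) algebraic_mono[OF assms(3,5)]] by blast

text \<open>Put \<open>g = x + c y\<close>. A root \<open>b\<close> of the minimal polynomial of
  \<open>y\<close> over \<open>K(g)\<close> comes from an embedding fixing \<open>g\<close>, which
  sends \<open>x\<close> to a conjugate \<open>a\<close> with \<open>a + c b = x + c y\<close>. If
  \<open>b\<close> differed from \<open>y\<close>, then \<open>c = (a - x) / (y - b)\<close>, and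
  finitely many such values are avoided. Separability is asked of \<open>y\<close> alone because the
  first element will later be an arbitrary algebraic one.\<close>

theorem primitive_element:
  assumes K: "subfield K L" and inf: "infinite K"
    and x: "x \<in> carrier L" "(algebraic over K) x"
    and y: "y \<in> carrier L" "(algebraic over K) y"
    and sep: "card {a. is_root (Irr K y) a} = degree (Irr K y)"
  obtains c where "c \<in> K" "x \<in> simple_extension K (x \<oplus> c \<otimes> y)" "y \<in> simple_extension K (x \<oplus> c \<otimes> y)"
proof -
  \<comment> \<open>Pairs with \<open>b = y\<close> contribute an unspecified value of
    \<open>inv \<zero>\<close>; this does not affect finiteness.\<close>
  let ?bad = "(\<lambda>(a, b). (a \<ominus> x) \<otimes> inv (y \<ominus> b)) ` ({a. is_root (Irr K x) a} \<times> {b. is_root (Irr K y) b})"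
  have "finite ?bad"
    using finite_number_of_roots[OF Irr_facts(1)[OF K x]] finite_number_of_roots[OF Irr_facts(1)[OF K y]]
    by simp
  then obtain c where c: "c \<in> K" "c \<notin> ?bad"
    using inf by (meson finite_subset subsetI)
  define g where "g = x \<oplus> c \<otimes> y"
  let ?L = "simple_extension K g" and ?M = "simple_extension (simple_extension K g) y"
  have cc: "c \<in> carrier L"
    using c subfieldE(3)[OF K] by auto
  have gc: "g \<in> carrier L"
    using x y cc by (simp add: g_def)
  have "(algebraic over K) g"
    using subringE(6,7)[OF subfieldE(1)[OF subfield_of_algebraics[OF K]]] x y cc
      algebraic_self[OF subfieldE(1)[OF K] c(1)] by (simp add: g_def)
  note G = algebraic_simple_extension[OF K gc this]
  have yG: "(algebraic over ?L) y"
    using algebraic_mono[OF G(2) y(2)] .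
  note E = algebraic_simple_extension[OF G(1) y(1) yG]
  let ?h = "Irr ?L y"
  have xg: "x = g \<ominus> c \<otimes> y"
    using x(1) y(1) cc unfolding g_def by algebra
  have cG: "c \<in> ?L"
    using G(2) c by auto
  have xE: "x \<in> ?M"
  proof -
    have "g \<in> ?M" "c \<in> ?M"
      using E(2) G(3) cG by auto
    then show ?thesis
      using subring_minus_mult_closed[OF E(5) _ _ E(3)] xg by simp
  qed
  have "{b. is_root ?h b} = {y}"
  proof
    show "{b. is_root ?h b} \<subseteq> {y}"
    proof clarify
      fix b assume b: "is_root ?h b"
      then have bc: "b \<in> carrier L"
        by (simp add: is_root_def)
      obtain \<tau> where \<tau>: "embedding_over ?L ?M \<tau>" "\<tau> y = b"
        using conjugate_embedding[OF G(1) y(1) yG b] by blast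
      have \<tau>K: "embedding_over K ?M \<tau>"
        using \<tau>(1) G(2) unfolding embedding_over_def by blast
      have "eval (Irr K y) b = \<zero>"
        using pdivides_imp_root_sharing[OF Irr_facts(1)[OF G(1) y(1) yG]
            Irr_pdivides_Irr[OF K G(1,2) y] bc] b by (simp add: is_root_def)
      then have rb: "is_root (Irr K y) b"
        using bc Irr_facts(2)[OF K y] by (simp add: is_root_def)
      have "\<tau> (eval (Irr K x) x) = eval (Irr K x) (\<tau> x)"
        using embedding_over_eval_base[OF \<tau>K subfieldE(1)[OF K] E(5) subset_trans[OF G(2) E(2)]
            Irr_facts(3)[OF K x] xE] .
      moreover have "\<tau> \<zero> = \<zero>"
        using \<tau>K subringE(2)[OF subfieldE(1)[OF K]] by (auto simp: embedding_over_def)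
      moreover have \<tau>x: "\<tau> x \<in> carrier L"
        using \<tau>(1) xE by (auto simp: embedding_over_def)
      ultimately have ax: "is_root (Irr K x) (\<tau> x)"
        using IrrE(4)[OF K x] Irr_facts(2)[OF K x] by (simp add: is_root_def)
      have "\<tau> (x \<oplus> c \<otimes> y) = \<tau> x \<oplus> \<tau> c \<otimes> \<tau> y"
      proof -
        have "c \<in> ?M"
          using E(2) cG by blast
        moreover from this have "c \<otimes> y \<in> ?M"
          using E(3) subringE(6)[OF E(5)] by blast
        ultimately show ?thesis
          using embedding_overD(3,4)[OF \<tau>(1)] xE E(3) by metis
      qed
      moreover have "\<tau> g = g" "\<tau> c = c"
        using \<tau>(1) G(3) cG by (auto simp: embedding_over_def)
      ultimately have eq: "g = \<tau> x \<oplus> c \<otimes> b"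
        using \<tau>(2) by (simp add: g_def)
      show "b = y"
      proof (rule ccontr)
        assume "b \<noteq> y"
        then have ne: "y \<ominus> b \<noteq> \<zero>" and yb: "y \<ominus> b \<in> carrier L"
          using r_right_minus_eq[OF y(1) bc] y(1) bc by auto
        have "\<tau> x = (\<tau> x \<oplus> c \<otimes> b) \<ominus> c \<otimes> b"
          using \<tau>x cc bc by algebra
        then have "\<tau> x \<ominus> x = ((x \<oplus> c \<otimes> y) \<ominus> c \<otimes> b) \<ominus> x"
          using eq by (simp add: g_def)
        also have "\<dots> = c \<otimes> (y \<ominus> b)"
          using x(1) y(1) cc bc by algebra
        finally have "\<tau> x \<ominus> x = c \<otimes> (y \<ominus> b)" .
        then have "(\<tau> x \<ominus> x) \<otimes> inv (y \<ominus> b) = c \<otimes> ((y \<ominus> b) \<otimes> inv (y \<ominus> b))"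
          using cc yb ne field_Units by (simp add: m_assoc)
        then have "c = (\<tau> x \<ominus> x) \<otimes> inv (y \<ominus> b)"
          using cc yb ne field_Units by simp
        then show False
          using c(2) ax rb by force
      qed
    qed
    show "{y} \<subseteq> {b. is_root ?h b}"
      using Irr_facts(5)[OF G(1) y(1) yG] by simp
  qed
  \<comment> \<open>Separability of \<open>y\<close> persists over \<open>?L\<close>, so the degree
    is the number of roots, which is one.\<close>
  then have "degree ?h = 1"
    using separable_mono[OF K G(1,2) y sep] by simp
  then have yG: "y \<in> ?L"
    by (rule mem_if_degree_Irr_eq_one[OF G(1) y(1) yG])
  have "x \<in> ?L"
    using subring_minus_mult_closed[OF G(5,3) cG yG] xg by simp
  then show thesis
    using that[OF c(1)] yG by (simp add: g_def)
qed

end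

section \<open>Base fields that are relatively closed in a larger field\<close>

context algebraically_closed
begin

text \<open>The roots of \<open>Irr K' x\<close> are roots of \<open>Irr K x\<close>, hence
  algebraic over \<open>K\<close>, and so are the coefficients. These also lie in \<open>K'\<close>,
  thus in \<open>K\<close> by \<open>closed\<close>. Both polynomials are then monic over
  \<open>K\<close> and divide each other.\<close>

lemma Irr_eq_if_relatively_closed:
  assumes K: "subfield K L" and K': "subfield K' L" and sub: "K \<subseteq> K'"
    and closed: "\<And>y. \<lbrakk>y \<in> K'; (algebraic over K) y\<rbrakk> \<Longrightarrow> y \<in> K"
    and x: "x \<in> carrier L" "(algebraic over K) x"
  shows "Irr K' x = Irr K x"
proof -
  let ?A = "{y \<in> carrier L. (algebraic over K) y}"
  let ?k = "Irr K' x"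
  have x': "(algebraic over K') x"
    using algebraic_mono[OF sub x(2)] .
  note k = Irr_facts[OF K' x(1) x'] and f = Irr_facts[OF K x]
  have "{y. is_root ?k y} \<subseteq> ?A"
  proof clarify
    fix y assume y: "is_root ?k y"
    then have yc: "y \<in> carrier L"
      by (simp add: is_root_def)
    then have "eval (Irr K x) y = \<zero>"
      using pdivides_imp_root_sharing[OF k(1) Irr_pdivides_Irr[OF K K' sub x]] y
      by (simp add: is_root_def)
    then show "y \<in> carrier L \<and> (algebraic over K) y"
      using algebraicI[OF IrrE(1)[OF K x] f(2)] yc by blast
  qed
  then have "?k \<in> carrier (?A[X])"
    using monic_splitted_coeffs[OF k(1,2) IrrE(3)[OF K' x(1) x'] roots_over_carrier[OF k(1)]]
      subfieldE(1)[OF subfield_of_algebraics[OF K]] by blast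
  then have "set ?k \<subseteq> ?A"
    by (metis polynomial_incl univ_poly_carrier)
  then have "set ?k \<subseteq> K"
    using k(3) closed by blast
  then have kK: "?k \<in> carrier (K[X])"
    using IrrE(1)[OF K' x(1) x'] by (auto simp: univ_poly_def polynomial_def)
  have "?k pdivides Irr K x" "Irr K x pdivides ?k"
    using Irr_pdivides_Irr[OF K K' sub x] Irr_pdivides_iff[OF K x kK] IrrE(4)[OF K' x(1) x'] by auto
  then have "?k \<sim>\<^bsub>K[X]\<^esub> Irr K x"
    using pdivides_iff_shell[OF K] kK IrrE(1)[OF K x] by (simp add: associated_def)
  then obtain c where c: "c \<in> K - {\<zero>}" "?k = [c] \<otimes>\<^bsub>K[X]\<^esub> Irr K x"
    using associated_polynomials_iff[OF K kK IrrE(1)[OF K x]] by blast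
  then have kc: "?k = map ((\<otimes>) c) (Irr K x)"
    using poly_mult_const(1)[OF subfieldE(1)[OF K] _ c(1)] IrrE(1)[OF K x]
    by (simp add: univ_poly_mult univ_poly_carrier del: poly_mult.simps)
  moreover have "c \<in> carrier L" "set (Irr K x) \<subseteq> carrier L"
    using c(1) subfieldE(3)[OF K] f(3) by auto
  ultimately have "c = \<one>"
    using IrrE(3)[OF K x] IrrE(3)[OF K' x(1) x'] f(2) by (simp add: hd_map)
  then show ?thesis
    using kc map_one_mult \<open>set (Irr K x) \<subseteq> carrier L\<close> by simp
qed

text \<open>For an algebraic \<open>y\<close> in \<open>K'(x)\<close> a primitive element
  \<open>g\<close> of \<open>K(x, y)\<close> lies in \<open>K'(x)\<close>. Minimal polynomials over
  \<open>K\<close> and \<open>K'\<close> agree, so the degree of \<open>g\<close> over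
  \<open>K\<close> is at most that of \<open>x\<close>. As \<open>K(g)\<close> contains
  \<open>x\<close>, the element \<open>g\<close> has degree one over \<open>K(x)\<close>.\<close>

lemma relatively_closed_simple_extension:
  assumes K: "subfield K L" "infinite K" and K': "subfield K' L" and sub: "K \<subseteq> K'"
    and closed: "\<And>y. \<lbrakk>y \<in> K'; (algebraic over K) y\<rbrakk> \<Longrightarrow> y \<in> K"
    and x: "x \<in> carrier L" "(algebraic over K) x"
    and sep: "card {a. is_root (Irr K x) a} = degree (Irr K x)"
  shows "{y \<in> simple_extension K' x. (algebraic over K) y} = simple_extension K x"
proof
  have x': "(algebraic over K') x"
    using algebraic_mono[OF sub x(2)] .
  note E = algebraic_simple_extension[OF K(1) x] and E' = algebraic_simple_extension[OF K' x(1) x']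
  show "simple_extension K x \<subseteq> {y \<in> simple_extension K' x. (algebraic over K) y}"
    using E(6) mono_simple_extension[OF sub] by auto
  show "{y \<in> simple_extension K' x. (algebraic over K) y} \<subseteq> simple_extension K x"
  proof clarify
    fix y assume y: "y \<in> simple_extension K' x" "(algebraic over K) y"
    then have yc: "y \<in> carrier L"
      using E'(4) by blast
    obtain c where c: "c \<in> K" and yg: "y \<in> simple_extension K (y \<oplus> c \<otimes> x)"
      and xg: "x \<in> simple_extension K (y \<oplus> c \<otimes> x)"
      using primitive_element[OF K yc y(2) x sep] by blast
    define g where "g = y \<oplus> c \<otimes> x"
    have gE': "g \<in> simple_extension K' x"
      using subringE(6,7)[OF E'(5)] y(1) E'(2,3) c sub by (auto simp: g_def)
    have cc: "c \<in> carrier L"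
      using c subfieldE(3)[OF K(1)] by blast
    have galg: "(algebraic over K) g"
      using subringE(6,7)[OF subfieldE(1)[OF subfield_of_algebraics[OF K(1)]]] x y(2) yc cc
        algebraic_self[OF subfieldE(1)[OF K(1)] c] by (simp add: g_def)
    have gc: "g \<in> carrier L"
      using x(1) yc cc by (simp add: g_def)
    note tower = degree_Irr_tower(1)[OF K(1) gc galg, of x]
    have xpos: "degree (Irr K x) > 0"
      by (rule Irr_facts(4)[OF K(1) x])
    have gE: "(algebraic over (simple_extension K x)) g"
      using algebraic_mono[OF E(2) galg] .
    have "degree (Irr K' g) * degree (Irr (simple_extension K' g) x) = degree (Irr K' x)"
      by (rule degree_Irr_tower(1)[OF K' x(1) x' gE'])
    moreover have "degree (Irr K' x) > 0"
      by (rule Irr_facts(4)[OF K' x(1) x'])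
    ultimately have "degree (Irr K' g) \<le> degree (Irr K' x)"
      by (metis dvd_imp_le dvd_triv_left)
    then have "degree (Irr K g) \<le> degree (Irr K x)"
      using Irr_eq_if_relatively_closed[OF K(1) K' sub closed] x gc galg by simp
    moreover have "degree (Irr K x) * degree (Irr (simple_extension K x) g) = degree (Irr K g)"
      using tower xg by (simp add: g_def)
    ultimately have "degree (Irr (simple_extension K x) g) \<le> 1"
      using xpos by (metis mult.right_neutral mult_le_cancel1)
    then have "degree (Irr (simple_extension K x) g) = 1"
      using Irr_facts(4)[OF E(1) gc gE] by linarith
    then have "g \<in> simple_extension K x"
      by (rule mem_if_degree_Irr_eq_one[OF E(1) gc gE])
    then show "y \<in> simple_extension K x"
      using simple_extension_subring_incl[OF E(5,2)] yg by (auto simp: g_def)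
  qed
qed

end

section \<open>Finite separable and Galois extensions\<close>

lemma (in field) degree_Irr_le_dimension:
  assumes K: "subfield K R" and E: "subring E R" and m: "dimension m K E" and x: "x \<in> E"
  shows "(algebraic over K) x" "degree (Irr K x) \<le> m"
    "degree (Irr K x) = m \<Longrightarrow> simple_extension K x = E"
proof -
  have xc: "x \<in> carrier R"
    using x subringE(1)[OF E] by blast
  show alg: "(algebraic over K) x"
    using finite_dimension_imp_algebraic[OF K E finite_dimensionI[OF m] x] .
  have pow: "x [^] (n::nat) \<in> E" for n
    using x subringE(3,6)[OF E] by (induct n) auto
  then have sub: "set (exp_base x (degree (Irr K x))) \<subseteq> E"
    by (auto simp: exp_base_def)
  \<comment> \<open>The powers of \<open>x\<close> below its degree are independent; when there are
    \<open>m\<close> of them they span \<open>E\<close>.\<close>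
  note ind = exp_base_independent[OF K xc alg]
  show "degree (Irr K x) \<le> m"
    using independent_length_le_dimension[OF K m ind sub] by (simp add: exp_base_def)
  show "simple_extension K x = E" if "degree (Irr K x) = m"
    using independent_length_eq_dimension[OF K m ind sub] that Span_exp_base[OF K xc alg]
    by (simp add: exp_base_def)
qed

context algebraically_closed
begin

text \<open>Degrees of elements of \<open>E\<close> are bounded by \<open>m\<close>, so some
  \<open>x\<close> has maximal degree. A primitive element for \<open>x\<close> and any
  \<open>y\<close> in \<open>E\<close> cannot have larger degree, hence it lies in
  \<open>K(x)\<close>, and \<open>y\<close> with it.\<close>

lemma fin_sep_ext_imp_simple:
  assumes ext: "fin_sep_ext L K E m" and inf: "infinite K"
  obtains x where "x \<in> E" "separable_elt L K x" "simple_extension K x = E" "degree (Irr K x) = m"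
proof -
  have K: "subfield K L" and E: "subring E L" and sub: "K \<subseteq> E" and m: "dimension m K E"
    and sep: "\<And>x. x \<in> E \<Longrightarrow> separable_elt L K x"
    using ext subfieldE(1) by (auto simp: fin_sep_ext_def)
  note le = degree_Irr_le_dimension[OF K E m]
  define x where "x = (ARG_MAX (\<lambda>x. degree (Irr K x)) x. x \<in> E)"
  have x: "x \<in> E" and max: "\<And>y. y \<in> E \<Longrightarrow> degree (Irr K y) \<le> degree (Irr K x)"
    using arg_max_nat_lemma[of "\<lambda>x. x \<in> E" \<one> "\<lambda>x. degree (Irr K x)" "Suc m"] le(2) subringE(3)[OF E]
    by (auto simp: x_def less_Suc_eq_le)
  have xc: "x \<in> carrier L"
    using x subringE(1)[OF E] by blast
  note xs = sep[OF x, unfolded separable_elt_iff[OF K xc]]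
  note S = algebraic_simple_extension[OF K xc conjunct1[OF xs]]
  have "E \<subseteq> simple_extension K x"
  proof
    fix y assume y: "y \<in> E"
    then have yc: "y \<in> carrier L"
      using subringE(1)[OF E] by blast
    obtain c where c: "c \<in> K" and yg: "y \<in> simple_extension K (y \<oplus> c \<otimes> x)"
      and xg: "x \<in> simple_extension K (y \<oplus> c \<otimes> x)"
      using primitive_element[OF K inf yc le(1)[OF y] xc] xs by blast
    define g where "g = y \<oplus> c \<otimes> x"
    have gE: "g \<in> E"
      using c sub x y subringE(6,7)[OF E] by (auto simp: g_def)
    then have gc: "g \<in> carrier L"
      using subringE(1)[OF E] by blast
    have ga: "(algebraic over (simple_extension K x)) g"
      using algebraic_mono[OF S(2) le(1)[OF gE]] .
    have "degree (Irr K x) * degree (Irr (simple_extension K x) g) = degree (Irr K g)"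
      using degree_Irr_tower(1)[OF K gc le(1)[OF gE]] xg by (simp add: g_def)
    then have "degree (Irr K x) * degree (Irr (simple_extension K x) g) \<le> degree (Irr K x) * 1"
      using max[OF gE] by simp
    then have "degree (Irr (simple_extension K x) g) \<le> 1"
      using Irr_facts(4)[OF K xc] xs by (metis mult_le_cancel1)
    then have "degree (Irr (simple_extension K x) g) = 1"
      using Irr_facts(4)[OF S(1) gc ga] by linarith
    then have "g \<in> simple_extension K x"
      by (rule mem_if_degree_Irr_eq_one[OF S(1) gc ga])
    then show "y \<in> simple_extension K x"
      using simple_extension_subring_incl[OF S(5,2)] yg by (auto simp: g_def)
  qed
  moreover have "simple_extension K x \<subseteq> E"
    using simple_extension_subring_incl[OF E sub x] .
  ultimately have eq: "simple_extension K x = E"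
    by simp
  then have "degree (Irr K x) = m"
    using dimension_is_inj[OF K _ m] S(7) by simp
  then show thesis
    using that x sep eq by blast
qed

text \<open>Every element is a value \<open>p(x)\<close>, and by \<open>conjugates_of_eval\<close>
  it has as many conjugates as its degree.\<close>

lemma fin_sep_ext_simple_extension:
  assumes K: "subfield K L" and x: "separable_elt L K x"
  shows "fin_sep_ext L K (simple_extension K x) (degree (Irr K x))"
proof -
  have xc: "x \<in> carrier L"
    using x by (simp add: separable_elt_def)
  note xs = x[unfolded separable_elt_iff[OF K xc]]
  note E = algebraic_simple_extension[OF K xc conjunct1[OF xs]]
  have "separable_elt L K y" if y: "y \<in> simple_extension K x" for y
  proof -
    obtain p where "p \<in> carrier (K[X])" "y = eval p x"
      using simple_extension_cases[OF K xc y] by blast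
    then have "card {a. is_root (Irr K y) a} = degree (Irr K y)"
      using conjugates_of_eval(2)[OF K xc] xs by blast
    then show ?thesis
      using separable_elt_iff[OF K] E(4,6) y by blast
  qed
  then show ?thesis
    using K E by (simp add: fin_sep_ext_def)
qed

text \<open>Normality is decided at the generator: the conjugates of \<open>p(x)\<close> are the
  values \<open>p(a)\<close> at the conjugates \<open>a\<close> of \<open>x\<close>.\<close>

lemma galois_ext_simple_extension:
  assumes K: "subfield K L" and x: "separable_elt L K x"
    and roots: "{a. is_root (Irr K x) a} \<subseteq> simple_extension K x"
  shows "galois_ext L K (simple_extension K x) (degree (Irr K x))"
proof -
  have xc: "x \<in> carrier L"
    using x by (simp add: separable_elt_def)
  note xs = x[unfolded separable_elt_iff[OF K xc]]
  note E = algebraic_simple_extension[OF K xc conjunct1[OF xs]]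
  have "splits_in L (simple_extension K x) (Irr K y)" if y: "y \<in> simple_extension K x" for y
  proof -
    have yc: "y \<in> carrier L" "(algebraic over K) y"
      using E(4,6) y by auto
    obtain p where p: "p \<in> carrier (K[X])" "set p \<subseteq> K" "y = eval p x"
      using simple_extension_cases[OF K xc y] by blast
    then have "{a. is_root (Irr K y) a} = eval p ` {a. is_root (Irr K x) a}"
      using conjugates_of_eval(1)[OF K xc] xs by blast
    also have "\<dots> \<subseteq> simple_extension K x"
      using roots eval_in_subring[OF E(5) _ ] p(2) E(2) by blast
    finally show ?thesis
      using splits_inI[OF Irr_facts(1,2)[OF K yc] IrrE(3)[OF K yc]
          roots_over_carrier[OF Irr_facts(1)[OF K yc]]] subringE(3)[OF E(5)] by blast
  qed
  then show ?thesis
    using fin_sep_ext_simple_extension[OF K x] by (simp add: galois_ext_def normal_ext_def)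
qed

lemma galois_ext_imp_roots:
  assumes "galois_ext L K E m" "x \<in> E"
  shows "{a. is_root (Irr K x) a} \<subseteq> E"
proof -
  have K: "subfield K L" and E: "subring E L" and m: "dimension m K E"
    and split: "splits_in L E (Irr K x)"
    using assms subfieldE(1) by (auto simp: galois_ext_def fin_sep_ext_def normal_ext_def)
  have "x \<in> carrier L"
    using assms(2) subringE(1)[OF E] by blast
  then show ?thesis
    using roots_in_if_splits_in[OF Irr_facts(1)[OF K] split E]
      degree_Irr_le_dimension(1)[OF K E m assms(2)] by blast
qed

end

section \<open>Automorphisms\<close>

lemma (in ring) Gal_iff:
  "\<rho> \<in> carrier (Gal R K E) \<longleftrightarrow> \<rho> \<in> extensional E \<and> bij_betw \<rho> E E \<and>
    (\<forall>x\<in>E. \<forall>y\<in>E. \<rho> (x \<oplus> y) = \<rho> x \<oplus> \<rho> y \<and> \<rho> (x \<otimes> y) = \<rho> x \<otimes> \<rho> y) \<and> (\<forall>x\<in>K. \<rho> x = x)"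
  by (simp add: Gal_def)

lemma (in ring) Gal_embedding:
  assumes "\<rho> \<in> carrier (Gal R K E)" "E \<subseteq> carrier R"
  shows "embedding_over K E \<rho>" "\<rho> ` E = E" "\<rho> \<in> extensional E"
  using assms by (auto simp: Gal_iff embedding_over_def bij_betw_def)

lemma (in field) embedding_over_root:
  assumes K: "subfield K R" and E: "subring E R" "K \<subseteq> E" and \<tau>: "embedding_over K E \<tau>"
    and x: "x \<in> E" "(algebraic over K) x"
  shows "is_root (Irr K x) (\<tau> x)"
proof -
  have xc: "x \<in> carrier R"
    using x subringE(1)[OF E(1)] by blast
  have "\<tau> (eval (Irr K x) x) = eval (Irr K x) (\<tau> x)"
    using embedding_over_eval_base[OF \<tau> subfieldE(1)[OF K] E Irr_facts(3)[OF K xc x(2)] x(1)] .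
  then show ?thesis
    using IrrE(4)[OF K xc x(2)] Irr_facts(2)[OF K xc x(2)] embedding_overD(1)[OF \<tau> x(1)]
      embedding_overD(2)[OF \<tau> subringE(2)[OF subfieldE(1)[OF K]]] by (simp add: is_root_def)
qed

text \<open>An embedding of an algebraic extension into itself permutes the finitely many roots of each
  minimal polynomial, hence is onto.\<close>
lemma (in field) embedding_over_bij:
  assumes K: "subfield K R" and E: "subfield E R" "K \<subseteq> E" and \<tau>: "embedding_over K E \<tau>" "\<tau> ` E \<subseteq> E"
    and alg: "\<And>x. x \<in> E \<Longrightarrow> (algebraic over K) x"
  shows "bij_betw \<tau> E E"
proof -
  note Es = subfieldE(1)[OF E(1)]
  have inj: "inj_on \<tau> E"
    using embedding_over_inj[OF \<tau>(1) subfieldE(1)[OF K] E(1)] .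
  have "x \<in> \<tau> ` E" if x: "x \<in> E" for x
  proof -
    have xc: "x \<in> carrier R"
      using x subringE(1)[OF Es] by blast
    let ?A = "{a \<in> E. is_root (Irr K x) a}"
    have fin: "finite ?A"
      using finite_number_of_roots[OF Irr_facts(1)[OF K xc alg[OF x]]] by simp
    have "\<tau> ` ?A \<subseteq> ?A"
    proof clarify
      fix a assume a: "a \<in> E" "is_root (Irr K x) a"
      have "\<tau> (eval (Irr K x) a) = eval (Irr K x) (\<tau> a)"
        using embedding_over_eval_base[OF \<tau>(1) subfieldE(1)[OF K] Es E(2)
            Irr_facts(3)[OF K xc alg[OF x]] a(1)] .
      moreover have "\<tau> \<zero> = \<zero>"
        using embedding_overD(2)[OF \<tau>(1) subringE(2)[OF subfieldE(1)[OF K]]] .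
      ultimately show "\<tau> a \<in> E \<and> is_root (Irr K x) (\<tau> a)"
        using a \<tau>(2) subringE(1)[OF Es] by (auto simp: is_root_def)
    qed
    moreover have "inj_on \<tau> ?A"
      using inj by (rule inj_on_subset) auto
    ultimately have "\<tau> ` ?A = ?A"
      using fin by (simp add: endo_inj_surj)
    moreover have "x \<in> ?A"
      using x Irr_facts(5)[OF K xc alg[OF x]] by simp
    ultimately show ?thesis by blast
  qed
  then show ?thesis
    using inj \<tau>(2) by (auto simp: bij_betw_def)
qed

lemma (in field) GalI:
  assumes K: "subfield K R" and E: "subfield E R" "K \<subseteq> E" and \<tau>: "embedding_over K E \<tau>" "\<tau> ` E \<subseteq> E"
    and alg: "\<And>x. x \<in> E \<Longrightarrow> (algebraic over K) x"
  shows "restrict \<tau> E \<in> carrier (Gal R K E)"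
proof -
  have "bij_betw (restrict \<tau> E) E E"
    using embedding_over_bij[OF assms] by (simp cong: bij_betw_cong)
  then show ?thesis
    using \<tau>(1) E subringE(6,7)[OF subfieldE(1)[OF E(1)]]
    by (auto simp: Gal_iff embedding_over_def subset_iff)
qed

lemma (in field) Gal_simple_extension_eqI:
  assumes K: "subfield K R" and x: "x \<in> carrier R" "(algebraic over K) x"
    and \<rho>: "\<rho> \<in> carrier (Gal R K (simple_extension K x))"
    and \<tau>: "\<tau> \<in> carrier (Gal R K (simple_extension K x))" and eq: "\<rho> x = \<tau> x"
  shows "\<rho> = \<tau>"
proof (rule extensionalityI)
  note E = algebraic_simple_extension[OF K x]
  show "\<rho> \<in> extensional (simple_extension K x)" "\<tau> \<in> extensional (simple_extension K x)"
    using Gal_embedding(3)[OF \<rho> E(4)] Gal_embedding(3)[OF \<tau> E(4)] by auto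
  show "\<rho> y = \<tau> y" if "y \<in> simple_extension K x" for y
    using embedding_over_simple_extension_eq[OF K x(1) Gal_embedding(1)[OF \<rho> E(4)]
        Gal_embedding(1)[OF \<tau> E(4)] eq that] .
qed

lemma (in field) Gal_simple_extension_exists:
  assumes K: "subfield K R" and x: "x \<in> carrier R" "(algebraic over K) x"
    and y: "is_root (Irr K x) y" "y \<in> simple_extension K x"
  obtains \<rho> where "\<rho> \<in> carrier (Gal R K (simple_extension K x))" "\<rho> x = y"
proof -
  note E = algebraic_simple_extension[OF K x]
  obtain \<tau> where \<tau>: "embedding_over K (simple_extension K x) \<tau>" "\<tau> x = y"
    "\<And>p. p \<in> carrier (K[X]) \<Longrightarrow> \<tau> (eval p x) = eval p y"
    using conjugate_embedding[OF K x y(1)] by blast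
  have "\<tau> ` simple_extension K x \<subseteq> simple_extension K x"
  proof clarify
    fix z assume "z \<in> simple_extension K x"
    then obtain p where p: "p \<in> carrier (K[X])" "set p \<subseteq> K" "z = eval p x"
      using simple_extension_cases[OF K x(1)] by blast
    then have "\<tau> z = eval p y"
      using \<tau>(3) by simp
    also have "\<dots> \<in> simple_extension K x"
      using eval_in_subring[OF E(5) _ y(2), of p] p(2) E(2) by blast
    finally show "\<tau> z \<in> simple_extension K x" .
  qed
  then have "restrict \<tau> (simple_extension K x) \<in> carrier (Gal R K (simple_extension K x))"
    by (rule GalI[OF K E(1,2) \<tau>(1) _ E(6)])
  then show thesis
    using that E(3) \<tau>(2) by simp
qed

text \<open>Evaluation at \<open>x\<close> embeds the group into the roots of
  \<open>Irr K x\<close>. Finiteness later allows all products in the group to be transferred to a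
  common set of coordinates.\<close>

lemma (in field) finite_Gal_simple_extension:
  assumes K: "subfield K R" and x: "x \<in> carrier R" "(algebraic over K) x"
  shows "finite (carrier (Gal R K (simple_extension K x)))"
proof (rule inj_on_finite)
  note E = algebraic_simple_extension[OF K x]
  show "inj_on (\<lambda>\<rho>. \<rho> x) (carrier (Gal R K (simple_extension K x)))"
    using Gal_simple_extension_eqI[OF K x] by (auto intro: inj_onI)
  show "(\<lambda>\<rho>. \<rho> x) ` carrier (Gal R K (simple_extension K x)) \<subseteq> {a. is_root (Irr K x) a}"
    using embedding_over_root[OF K E(5,2) Gal_embedding(1)[OF _ E(4)] E(3) x(2)] by auto
  show "finite {a. is_root (Irr K x) a}"
    by (rule finite_number_of_roots[OF Irr_facts(1)[OF K x]])
qed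

text \<open>Automorphisms over \<open>K'\<close> preserve algebraicity over \<open>K\<close>, so by
  \<open>closed\<close> they map \<open>K(x)\<close> to itself. Both groups correspond, through the
  image of \<open>x\<close>, to roots of the same minimal polynomial: a root lying in
  \<open>K'(x)\<close> is algebraic over \<open>K\<close> and hence already in \<open>K(x)\<close>.
  Normality plays no part in this comparison of automorphism groups.\<close>

lemma (in field) restrict_Gal_iso:
  assumes K: "subfield K R" and K': "subfield K' R" "K \<subseteq> K'"
    and x: "x \<in> carrier R" "(algebraic over K) x" and Irr: "Irr K' x = Irr K x"
    and closed: "{y \<in> simple_extension K' x. (algebraic over K) y} = simple_extension K x"
  shows "(\<lambda>\<rho>. restrict \<rho> (simple_extension K x)) \<in>
    iso (Gal R K' (simple_extension K' x)) (Gal R K (simple_extension K x))"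
proof -
  let ?E = "simple_extension K x" and ?E' = "simple_extension K' x"
  let ?r = "\<lambda>\<rho>. restrict \<rho> ?E"
  have x': "(algebraic over K') x"
    using algebraic_mono[OF K'(2) x(2)] .
  note E = algebraic_simple_extension[OF K x] and E' = algebraic_simple_extension[OF K'(1) x(1) x']
  have EE': "?E \<subseteq> ?E'"
    using closed by blast
  have stable: "embedding_over K ?E \<rho>" "\<rho> ` ?E \<subseteq> ?E" if \<rho>: "\<rho> \<in> carrier (Gal R K' ?E')" for \<rho>
  proof -
    note G = Gal_embedding[OF \<rho> E'(4)]
    show emb: "embedding_over K ?E \<rho>"
      using embedding_over_subset[OF G(1) K'(2) EE'] .
    show "\<rho> ` ?E \<subseteq> ?E"
    proof clarify
      fix y assume y: "y \<in> ?E"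
      then have "is_root (Irr K y) (\<rho> y)"
        using embedding_over_root[OF K E(5,2) emb y E(6)[OF y]] by simp
      moreover have "\<rho> y \<in> ?E'"
        using y EE' G(2) by blast
      moreover have "y \<in> carrier R"
        using y E(4) by blast
      ultimately have "\<rho> y \<in> {y \<in> ?E'. (algebraic over K) y}"
        using algebraicI[OF IrrE(1)[OF K _ E(6)[OF y]]] by (simp add: is_root_def)
      then show "\<rho> y \<in> ?E"
        using closed by simp
    qed
  qed
  have mem: "?r \<rho> \<in> carrier (Gal R K ?E)" if "\<rho> \<in> carrier (Gal R K' ?E')" for \<rho>
    using GalI[OF K E(1,2) stable[OF that] E(6)] .
  have "?r \<in> hom (Gal R K' ?E') (Gal R K ?E)"
  proof (rule homI)
    show "?r (\<rho> \<otimes>\<^bsub>Gal R K' ?E'\<^esub> \<tau>) = ?r \<rho> \<otimes>\<^bsub>Gal R K ?E\<^esub> ?r \<tau>"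
      if "\<rho> \<in> carrier (Gal R K' ?E')" "\<tau> \<in> carrier (Gal R K' ?E')" for \<rho> \<tau>
      using stable(2)[OF that(2)] EE' by (auto simp: Gal_def fun_eq_iff restrict_def image_subset_iff)
  qed (rule mem)
  moreover have "inj_on ?r (carrier (Gal R K' ?E'))"
  proof (rule inj_onI)
    fix \<rho> \<tau> assume G: "\<rho> \<in> carrier (Gal R K' ?E')" "\<tau> \<in> carrier (Gal R K' ?E')" and "?r \<rho> = ?r \<tau>"
    then have "\<rho> x = \<tau> x"
      using E(3) by (metis restrict_apply')
    then show "\<rho> = \<tau>"
      by (rule Gal_simple_extension_eqI[OF K'(1) x(1) x' G])
  qed
  moreover have "carrier (Gal R K ?E) \<subseteq> ?r ` carrier (Gal R K' ?E')"
  proof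
    fix \<rho> assume \<rho>: "\<rho> \<in> carrier (Gal R K ?E)"
    note G = Gal_embedding[OF \<rho> E(4)]
    have "is_root (Irr K' x) (\<rho> x)"
      using embedding_over_root[OF K E(5,2) G(1) E(3) x(2)] Irr by simp
    moreover have "\<rho> x \<in> ?E'"
      using G(2) E(3) EE' by blast
    ultimately obtain \<tau> where \<tau>: "\<tau> \<in> carrier (Gal R K' ?E')" "\<tau> x = \<rho> x"
      using Gal_simple_extension_exists[OF K'(1) x(1) x'] by blast
    then have "?r \<tau> = \<rho>"
      using Gal_simple_extension_eqI[OF K x mem[OF \<tau>(1)] \<rho>] E(3) by simp
    then show "\<rho> \<in> ?r ` carrier (Gal R K' ?E')"
      using \<tau>(1) by blast
  qed
  ultimately show ?thesis
    using mem by (auto simp: iso_def bij_betw_def)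
qed

section \<open>Ultraproducts of algebraically closed fields\<close>

text \<open>\<open>p\<close> is a multiple of the minimal polynomial, the degree bound makes the
  cofactor constant, and leading coefficients make it one. The criterion suits coordinate
  polynomials, for which minimality of the degree is what can be transferred.\<close>

lemma (in domain) Irr_eqI:
  assumes K: "subfield K R" and x: "x \<in> carrier R"
    and p: "p \<in> carrier (K[X])" "p \<noteq> []" "lead_coeff p = \<one>" "eval p x = \<zero>"
    and deg: "degree p \<le> degree (Irr K x)"
  shows "p = Irr K x"
proof -
  have alg: "(algebraic over K) x"
    using algebraicI[OF p(1,2,4)] .
  note Ks = subfieldE(1)[OF K] and f = IrrE[OF K x alg]
  obtain q where q: "q \<in> carrier (K[X])" "p = Irr K x \<otimes>\<^bsub>K[X]\<^esub> q"
    using Irr_minimal[OF K x alg p(1,4)] pdivides_iff_shell[OF K f(1) p(1)] by (auto elim: dividesE)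
  have pf: "polynomial K (Irr K x)" and pq: "polynomial K q"
    using f(1) q(1) by (simp_all add: univ_poly_carrier)
  have q0: "q \<noteq> []"
    using poly_mult_zero(2)[OF polynomial_in_carrier[OF Ks pf]] q(2) p(2)
    by (auto simp: univ_poly_mult)
  have f0: "Irr K x \<noteq> []"
    by (rule Irr_facts(2)[OF K x alg])
  have "degree p = degree (Irr K x) + degree q"
    using poly_mult_degree_eq[OF Ks pf pq] f0 q0 q(2) by (simp add: univ_poly_mult)
  then have "degree q = 0"
    using deg by simp
  then obtain c where c: "q = [c]"
    using q0 by (cases q) auto
  then have cc: "c \<in> K - {\<zero>}" "c \<in> carrier R"
    using pq subfieldE(3)[OF K] by (auto simp: polynomial_def)
  then have "c = \<one>"
    using poly_mult_lead_coeff[OF Ks pf pq f0 q0] f(3) p(3) q(2) c by (simp add: univ_poly_mult)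
  then show ?thesis
    using poly_mult_one(2)[OF Ks pf] q(2) c by (simp add: univ_poly_mult)
qed

section \<open>Transfer between the coordinates and the ultraproduct\<close>

locale ultraproduct =
  fixes D :: "'s filter" and Om :: "'s \<Rightarrow> 'a ring"
  assumes D: "nonprincipal_ultrafilter D" and algebraically_closed_Om: "algebraically_closed (Om s)"
begin

interpretation Om: algebraically_closed "Om s" for s
  by (rule algebraically_closed_Om)

abbreviation "U \<equiv> ultra_ring D Om"

lemma D_ne: "D \<noteq> bot" "\<not> eventually (\<lambda>s. False) D"
  using D by (simp_all add: nonprincipal_ultrafilter_def trivial_limit_def)

lemma eventually_not_iff: "eventually (\<lambda>s. \<not> P s) D \<longleftrightarrow> \<not> eventually P D"
proof
  assume "eventually (\<lambda>s. \<not> P s) D"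
  show "\<not> eventually P D"
  proof
    assume "eventually P D"
    then have "eventually (\<lambda>s. False) D"
      using \<open>eventually (\<lambda>s. \<not> P s) D\<close> by (rule eventually_elim2) simp
    then show False
      using D_ne(2) by simp
  qed
next
  have "eventually P D \<or> eventually (\<lambda>s. \<not> P s) D"
    using D unfolding nonprincipal_ultrafilter_def by blast
  then show "eventually (\<lambda>s. \<not> P s) D" if "\<not> eventually P D"
    using that by blast
qed

text \<open>If each of the finitely many alternatives failed almost everywhere, so would their
  disjunction. This is the device that freezes a degree from a bounded range.\<close>

lemma eventually_bex_finite:
  assumes "finite I" "eventually (\<lambda>s. \<exists>i\<in>I. P i s) D"
  obtains i where "i \<in> I" "eventually (P i) D"
proof (rule ccontr)
  assume "\<not> thesis"
  then have "\<forall>i\<in>I. eventually (\<lambda>s. \<not> P i s) D"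
    using that eventually_not_iff by blast
  then have "eventually (\<lambda>s. \<forall>i\<in>I. \<not> P i s) D"
    using assms(1) by (simp add: eventually_ball_finite)
  then have "eventually (\<lambda>s. \<not> (\<exists>i\<in>I. P i s)) D"
    by (rule eventually_mono) blast
  then show False
    using assms(2) eventually_not_iff by blast
qed

lemma eventually_choice:
  assumes "eventually (\<lambda>s. \<exists>x. P s x) D"
  obtains f where "eventually (\<lambda>s. P s (f s)) D"
proof (rule that)
  show "eventually (\<lambda>s. P s (SOME x. P s x)) D"
    using assms by (rule eventually_mono) (rule someI_ex)
qed

lemma ucls_eq_iff: "ucls D f = ucls D g \<longleftrightarrow> eventually (\<lambda>s. f s = g s) D"
proof
  assume eq: "ucls D f = ucls D g"
  have "f \<in> ucls D f"
    by (simp add: ucls_def)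
  then have "f \<in> ucls D g"
    unfolding eq .
  then show "eventually (\<lambda>s. f s = g s) D"
    by (simp add: ucls_def)
next
  assume *: "eventually (\<lambda>s. f s = g s) D"
  have "eventually (\<lambda>s. h s = f s) D \<longleftrightarrow> eventually (\<lambda>s. h s = g s) D" for h
    by (rule eventually_cong[OF *]) simp
  then show "ucls D f = ucls D g"
    by (simp add: ucls_def)
qed

lemma ucls_urep_ucls [simp]: "ucls D (urep D (ucls D f)) = ucls D f"
  unfolding urep_def by (rule someI[of "\<lambda>g. ucls D g = ucls D f" f]) simp

lemma eventually_urep_ucls: "eventually (\<lambda>s. urep D (ucls D f) s = f s) D"
  using ucls_eq_iff[of "urep D (ucls D f)" f] by simp

lemma ucls_in_ultraprod_iff [simp]: "ucls D f \<in> ultraprod D A \<longleftrightarrow> eventually (\<lambda>s. f s \<in> A s) D"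
proof
  assume "ucls D f \<in> ultraprod D A"
  then obtain g where "eventually (\<lambda>s. f s = g s) D" "eventually (\<lambda>s. g s \<in> A s) D"
    by (auto simp: ultraprod_def ucls_eq_iff)
  then show "eventually (\<lambda>s. f s \<in> A s) D"
    by (rule eventually_elim2) simp
qed (auto simp: ultraprod_def)

lemma ultraprod_cases:
  assumes "x \<in> ultraprod D A"
  obtains f where "x = ucls D f" "eventually (\<lambda>s. f s \<in> A s) D"
  using assms by (auto simp: ultraprod_def)

lemma ucls_urep [simp]: "x \<in> ultraprod D A \<Longrightarrow> ucls D (urep D x) = x"
  by (auto elim: ultraprod_cases)

lemma eventually_urep_in: "x \<in> ultraprod D A \<Longrightarrow> eventually (\<lambda>s. urep D x s \<in> A s) D"
  by (metis ucls_in_ultraprod_iff ucls_urep)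

lemma ultraprod_mono:
  assumes "eventually (\<lambda>s. A s \<subseteq> B s) D"
  shows "ultraprod D A \<subseteq> ultraprod D B"
proof
  fix x assume "x \<in> ultraprod D A"
  then obtain f where f: "x = ucls D f" "eventually (\<lambda>s. f s \<in> A s) D"
    by (rule ultraprod_cases)
  from assms f(2) have "eventually (\<lambda>s. f s \<in> B s) D"
    by (rule eventually_elim2) blast
  then show "x \<in> ultraprod D B"
    by (simp add: f(1))
qed

lemma carrier_U: "carrier U = ultraprod D (\<lambda>s. carrier (Om s))"
  by (simp add: ultra_ring_def)

lemma U_simps [simp]:
  "ucls D f \<otimes>\<^bsub>U\<^esub> ucls D g = ucls D (\<lambda>s. f s \<otimes>\<^bsub>Om s\<^esub> g s)"
  "ucls D f \<oplus>\<^bsub>U\<^esub> ucls D g = ucls D (\<lambda>s. f s \<oplus>\<^bsub>Om s\<^esub> g s)"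
  "\<one>\<^bsub>U\<^esub> = ucls D (\<lambda>s. \<one>\<^bsub>Om s\<^esub>)" "\<zero>\<^bsub>U\<^esub> = ucls D (\<lambda>s. \<zero>\<^bsub>Om s\<^esub>)"
  using eventually_urep_ucls[of f] eventually_urep_ucls[of g]
  by (auto simp: ultra_ring_def umult_def uadd_def ucls_eq_iff elim: eventually_elim2)

text \<open>Overwriting the exceptional coordinates by zero gives a representative inside the
  carriers everywhere, so ring laws apply in each coordinate without exceptions.\<close>

lemma carrier_U_cases:
  assumes "x \<in> carrier U"
  obtains f where "x = ucls D f" "\<And>s. f s \<in> carrier (Om s)"
proof -
  obtain f where f: "x = ucls D f" "eventually (\<lambda>s. f s \<in> carrier (Om s)) D"
    using assms by (auto simp: carrier_U elim: ultraprod_cases)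
  let ?g = "\<lambda>s. if f s \<in> carrier (Om s) then f s else \<zero>\<^bsub>Om s\<^esub>"
  have "x = ucls D ?g"
    unfolding f(1) ucls_eq_iff using f(2) by (rule eventually_mono) simp
  then show thesis
    by (rule that) simp
qed

lemma ucls_carrier: "(\<And>s. f s \<in> carrier (Om s)) \<Longrightarrow> ucls D f \<in> carrier U"
  by (simp add: carrier_U)

lemma field_U: "field U"
proof -
  have "abelian_group U"
  proof (rule abelian_groupI)
    show "x \<oplus>\<^bsub>U\<^esub> y \<in> carrier U" if "x \<in> carrier U" "y \<in> carrier U" for x y
      using that by (elim carrier_U_cases) (simp add: carrier_U)
    show "x \<oplus>\<^bsub>U\<^esub> y \<oplus>\<^bsub>U\<^esub> z = x \<oplus>\<^bsub>U\<^esub> (y \<oplus>\<^bsub>U\<^esub> z)" if "x \<in> carrier U" "y \<in> carrier U" "z \<in> carrier U" for x y z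
      using that by (elim carrier_U_cases) (simp add: Om.a_assoc)
    show "x \<oplus>\<^bsub>U\<^esub> y = y \<oplus>\<^bsub>U\<^esub> x" if "x \<in> carrier U" "y \<in> carrier U" for x y
      using that by (elim carrier_U_cases) (simp add: Om.a_comm)
    show "\<zero>\<^bsub>U\<^esub> \<oplus>\<^bsub>U\<^esub> x = x" if "x \<in> carrier U" for x
      using that by (elim carrier_U_cases) simp
    show "\<exists>y\<in>carrier U. y \<oplus>\<^bsub>U\<^esub> x = \<zero>\<^bsub>U\<^esub>" if "x \<in> carrier U" for x
    proof -
      obtain f where f: "x = ucls D f" "\<And>s. f s \<in> carrier (Om s)"
        using \<open>x \<in> carrier U\<close> by (rule carrier_U_cases) blast
      show ?thesis
        using f(2) by (intro bexI[of _ "ucls D (\<lambda>s. \<ominus>\<^bsub>Om s\<^esub> f s)"]) (simp_all add: f(1) carrier_U Om.l_neg)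
    qed
  qed (simp add: carrier_U)
  moreover have "comm_monoid U"
  proof (rule comm_monoidI)
    show "x \<otimes>\<^bsub>U\<^esub> y \<in> carrier U" if "x \<in> carrier U" "y \<in> carrier U" for x y
      using that by (elim carrier_U_cases) (simp add: carrier_U)
    show "x \<otimes>\<^bsub>U\<^esub> y \<otimes>\<^bsub>U\<^esub> z = x \<otimes>\<^bsub>U\<^esub> (y \<otimes>\<^bsub>U\<^esub> z)" if "x \<in> carrier U" "y \<in> carrier U" "z \<in> carrier U" for x y z
      using that by (elim carrier_U_cases) (simp add: Om.m_assoc)
    show "x \<otimes>\<^bsub>U\<^esub> y = y \<otimes>\<^bsub>U\<^esub> x" if "x \<in> carrier U" "y \<in> carrier U" for x y
      using that by (elim carrier_U_cases) (simp add: Om.m_comm)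
    show "\<one>\<^bsub>U\<^esub> \<otimes>\<^bsub>U\<^esub> x = x" if "x \<in> carrier U" for x
      using that by (elim carrier_U_cases) simp
  qed (simp add: carrier_U)
  moreover have "(x \<oplus>\<^bsub>U\<^esub> y) \<otimes>\<^bsub>U\<^esub> z = x \<otimes>\<^bsub>U\<^esub> z \<oplus>\<^bsub>U\<^esub> y \<otimes>\<^bsub>U\<^esub> z"
    if "x \<in> carrier U" "y \<in> carrier U" "z \<in> carrier U" for x y z
    using that by (elim carrier_U_cases) (simp add: Om.l_distr)
  ultimately interpret U: cring U
    by (rule cringI)
  show ?thesis
  proof (rule U.cring_fieldI2)
    show "\<zero>\<^bsub>U\<^esub> \<noteq> \<one>\<^bsub>U\<^esub>"
      by (simp add: ucls_eq_iff D_ne)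
    show "\<exists>b\<in>carrier U. a \<otimes>\<^bsub>U\<^esub> b = \<one>\<^bsub>U\<^esub>" if a: "a \<in> carrier U" "a \<noteq> \<zero>\<^bsub>U\<^esub>" for a
    proof -
      obtain f where f: "a = ucls D f" "\<And>s. f s \<in> carrier (Om s)"
        using a(1) by (rule carrier_U_cases) blast
      \<comment> \<open>A nonzero class fails to vanish almost everywhere; for an ultrafilter this
        means that it is nonzero almost everywhere.\<close>
      then have ne: "eventually (\<lambda>s. f s \<noteq> \<zero>\<^bsub>Om s\<^esub>) D"
        using a(2) by (simp add: ucls_eq_iff eventually_not_iff)
      have "eventually (\<lambda>s. inv\<^bsub>Om s\<^esub> f s \<in> carrier (Om s) \<and> f s \<otimes>\<^bsub>Om s\<^esub> inv\<^bsub>Om s\<^esub> f s = \<one>\<^bsub>Om s\<^esub>) D"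
        using ne by (rule eventually_mono) (use f(2) in \<open>simp add: Om.field_Units\<close>)
      then show ?thesis
        by (intro bexI[of _ "ucls D (\<lambda>s. inv\<^bsub>Om s\<^esub> f s)"])
          (auto simp: f(1) carrier_U ucls_eq_iff elim: eventually_mono)
    qed
  qed
qed

interpretation U: field U
  by (rule field_U)

lemma U_pow [simp]: "ucls D f [^]\<^bsub>U\<^esub> (n::nat) = ucls D (\<lambda>s. f s [^]\<^bsub>Om s\<^esub> n)"
  by (induct n) (simp_all add: U.nat_pow_0 U.nat_pow_Suc)

text \<open>As \<open>urep\<close> picks an arbitrary representative, \<open>coords\<close> is only determined almost everywhere.\<close>
definition coords :: "('s \<Rightarrow> 'a) set list \<Rightarrow> 's \<Rightarrow> 'a list" where
  "coords p s = map (\<lambda>c. urep D c s) p"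

text \<open>The length \<open>n\<close> is prescribed: a coefficientwise limit of lists makes sense
  only when almost all of them share one length.\<close>

definition ulist :: "nat \<Rightarrow> ('s \<Rightarrow> 'a list) \<Rightarrow> ('s \<Rightarrow> 'a) set list" where
  "ulist n ps = map (\<lambda>i. ucls D (\<lambda>s. ps s ! i)) [0..<n]"

lemma length_coords [simp]: "length (coords p s) = length p"
  by (simp add: coords_def)

lemma length_ulist [simp]: "length (ulist n ps) = n"
  by (simp add: ulist_def)

lemma eventually_coords_ulist:
  assumes "eventually (\<lambda>s. length (ps s) = n) D"
  shows "eventually (\<lambda>s. coords (ulist n ps) s = ps s) D"
proof -
  have "eventually (\<lambda>s. \<forall>i\<in>{..<n}. urep D (ucls D (\<lambda>s. ps s ! i)) s = ps s ! i) D"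
    by (rule eventually_ball_finite) (auto intro: eventually_urep_ucls)
  then show ?thesis
    using assms by (rule eventually_elim2) (auto simp: coords_def ulist_def intro: nth_equalityI)
qed

lemma eventually_set_coords:
  assumes "set p \<subseteq> ultraprod D A"
  shows "eventually (\<lambda>s. set (coords p s) \<subseteq> A s) D"
proof -
  have "eventually (\<lambda>s. \<forall>c\<in>set p. urep D c s \<in> A s) D"
    by (rule eventually_ball_finite) (use assms eventually_urep_in in auto)
  then show ?thesis
    by (rule eventually_mono) (auto simp: coords_def)
qed

lemma set_ulist:
  assumes "eventually (\<lambda>s. length (ps s) = n \<and> set (ps s) \<subseteq> A s) D"
  shows "set (ulist n ps) \<subseteq> ultraprod D A"
proof -
  have "eventually (\<lambda>s. ps s ! i \<in> A s) D" if "i < n" for i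
    using assms by (rule eventually_mono) (use that nth_mem in blast)
  then show ?thesis
    by (auto simp: ulist_def)
qed

text \<open>Evaluation is a finite expression in the coefficients, so it commutes with passing to
  representatives.\<close>

lemma eval_coords:
  assumes "set p \<subseteq> carrier U"
  shows "U.eval p (ucls D f) = ucls D (\<lambda>s. Om.eval s (coords p s) (f s))"
  using assms
proof (induct p)
  case Nil
  then show ?case by (simp add: coords_def)
next
  case (Cons a p)
  then have "a \<in> ultraprod D (\<lambda>s. carrier (Om s))"
    by (simp add: carrier_U)
  then have "ucls D (urep D a) = a"
    by (rule ucls_urep)
  then have "a \<otimes>\<^bsub>U\<^esub> ucls D g = ucls D (\<lambda>s. urep D a s \<otimes>\<^bsub>Om s\<^esub> g s)" for g
    by (metis U_simps(1))
  then show ?case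
    using Cons by (simp add: coords_def)
qed

lemma eventually_eval_coords:
  assumes "set p \<subseteq> carrier U"
  shows "eventually (\<lambda>s. Om.eval s (coords p s) (f s) = \<zero>\<^bsub>Om s\<^esub>) D \<longleftrightarrow> U.eval p (ucls D f) = \<zero>\<^bsub>U\<^esub>"
  using eval_coords[OF assms, of f] by (simp add: ucls_eq_iff)

lemma eventually_coords_poly:
  assumes p: "p \<in> carrier ((ultraprod D A)[X]\<^bsub>U\<^esub>)"
  shows "eventually (\<lambda>s. coords p s \<in> carrier ((A s)[X]\<^bsub>Om s\<^esub>)) D"
proof (cases p)
  case Nil
  then show ?thesis
    by (simp add: coords_def univ_poly_def polynomial_def)
next
  case (Cons a q)
  then have a: "a \<in> ultraprod D A" "a \<noteq> \<zero>\<^bsub>U\<^esub>" and sub: "set p \<subseteq> ultraprod D A"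
    using p by (auto simp: univ_poly_def polynomial_def)
  then have "ucls D (urep D a) \<noteq> ucls D (\<lambda>s. \<zero>\<^bsub>Om s\<^esub>)"
    by simp
  then have "eventually (\<lambda>s. urep D a s \<noteq> \<zero>\<^bsub>Om s\<^esub>) D"
    by (simp only: ucls_eq_iff eventually_not_iff not_False_eq_True)
  then show ?thesis
    using eventually_set_coords[OF sub]
    by (rule eventually_elim2) (auto simp: univ_poly_def polynomial_def coords_def Cons)
qed

lemma ulist_poly:
  assumes "eventually (\<lambda>s. length (ps s) = n \<and> ps s \<in> carrier ((A s)[X]\<^bsub>Om s\<^esub>)) D"
  shows "ulist n ps \<in> carrier ((ultraprod D A)[X]\<^bsub>U\<^esub>)"
proof (cases "n = 0")
  case False
  have "eventually (\<lambda>s. length (ps s) = n \<and> set (ps s) \<subseteq> A s) D"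
    using assms by (rule eventually_mono) (auto simp: univ_poly_def polynomial_def)
  then have "set (ulist n ps) \<subseteq> ultraprod D A"
    by (rule set_ulist)
  moreover have "eventually (\<lambda>s. ps s ! 0 \<noteq> \<zero>\<^bsub>Om s\<^esub>) D"
    using assms
  proof (rule eventually_mono)
    fix s assume "length (ps s) = n \<and> ps s \<in> carrier ((A s)[X]\<^bsub>Om s\<^esub>)"
    then show "ps s ! 0 \<noteq> \<zero>\<^bsub>Om s\<^esub>"
      using False by (cases "ps s") (auto simp: univ_poly_def polynomial_def)
  qed
  then have "hd (ulist n ps) \<noteq> \<zero>\<^bsub>U\<^esub>"
    using False by (simp add: ulist_def hd_map upt_conv_Cons ucls_eq_iff eventually_not_iff)
  ultimately show ?thesis
    by (simp add: univ_poly_def polynomial_def)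
qed (simp add: ulist_def univ_poly_def polynomial_def)

text \<open>Coordinate polynomials keep the length of \<open>p\<close>, so they are nonconstant and
  have roots almost everywhere; a choice of roots is a root in the limit.\<close>

lemma U_algebraically_closed: "algebraically_closed U"
proof (rule U.algebraically_closedI)
  fix p assume p: "p \<in> carrier (poly_ring U)" and deg: "degree p > 1"
  have pc: "set p \<subseteq> carrier U"
    using p by (auto simp: univ_poly_def polynomial_def)
  have "eventually (\<lambda>s. \<exists>a. a \<in> carrier (Om s) \<and> Om.eval s (coords p s) a = \<zero>\<^bsub>Om s\<^esub>) D"
    using eventually_coords_poly[OF p[unfolded carrier_U]]
  proof (rule eventually_mono)
    fix s assume "coords p s \<in> carrier (poly_ring (Om s))"
    moreover have "degree (coords p s) \<noteq> 0"
      using deg by simp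
    ultimately obtain a where "Om.is_root s (coords p s) a"
      by (rule Om.root_exists)
    then show "\<exists>a. a \<in> carrier (Om s) \<and> Om.eval s (coords p s) a = \<zero>\<^bsub>Om s\<^esub>"
      by (auto simp: Om.is_root_def)
  qed
  then obtain f where f: "eventually (\<lambda>s. f s \<in> carrier (Om s) \<and> Om.eval s (coords p s) (f s) = \<zero>\<^bsub>Om s\<^esub>) D"
    by (rule eventually_choice)
  then have "ucls D f \<in> carrier U" "U.eval p (ucls D f) = \<zero>\<^bsub>U\<^esub>"
    using eventually_eval_coords[OF pc, of f] by (simp_all add: carrier_U eventually_conj_iff)
  then show "\<exists>x\<in>carrier U. U.eval p x = \<zero>\<^bsub>U\<^esub>"
    by blast
qed

interpretation U: algebraically_closed U
  by (rule U_algebraically_closed)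

lemma subfield_ultraprod:
  assumes A: "eventually (\<lambda>s. subfield (A s) (Om s)) D"
  shows "subfield (ultraprod D A) U"
proof (rule U.subfieldI'[OF U.subringI])
  have sub: "eventually (\<lambda>s. A s \<subseteq> carrier (Om s)) D"
    using A by (rule eventually_mono) (rule subfieldE(3))
  show sub': "ultraprod D A \<subseteq> carrier U"
    unfolding carrier_U by (rule ultraprod_mono[OF sub])
  show "\<one>\<^bsub>U\<^esub> \<in> ultraprod D A"
    using A by (auto elim!: eventually_mono intro: subringE(3) subfieldE(1))
  show "h \<oplus>\<^bsub>U\<^esub> k \<in> ultraprod D A" "h \<otimes>\<^bsub>U\<^esub> k \<in> ultraprod D A"
    if hk: "h \<in> ultraprod D A" "k \<in> ultraprod D A" for h k
  proof -
    obtain f g where fg: "h = ucls D f" "k = ucls D g" "eventually (\<lambda>s. f s \<in> A s) D"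
      "eventually (\<lambda>s. g s \<in> A s) D"
      using hk by (auto elim!: ultraprod_cases)
    have "eventually (\<lambda>s. subfield (A s) (Om s) \<and> f s \<in> A s \<and> g s \<in> A s) D"
      using A fg(3,4) by (simp add: eventually_conj_iff)
    then have "eventually (\<lambda>s. f s \<oplus>\<^bsub>Om s\<^esub> g s \<in> A s \<and> f s \<otimes>\<^bsub>Om s\<^esub> g s \<in> A s) D"
      by (rule eventually_mono) (blast intro: subringE(6,7) subfieldE(1))
    then show "h \<oplus>\<^bsub>U\<^esub> k \<in> ultraprod D A" "h \<otimes>\<^bsub>U\<^esub> k \<in> ultraprod D A"
      by (auto simp: fg(1,2) elim: eventually_mono)
  qed
  show "\<ominus>\<^bsub>U\<^esub> h \<in> ultraprod D A" if h: "h \<in> ultraprod D A" for h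
  proof -
    obtain f where f: "h = ucls D f" "eventually (\<lambda>s. f s \<in> A s) D"
      using h by (auto elim!: ultraprod_cases)
    have 1: "eventually (\<lambda>s. \<ominus>\<^bsub>Om s\<^esub> f s \<in> A s) D"
      using A f(2) by (rule eventually_elim2) (blast intro: subringE(5) subfieldE(1))
    moreover have "eventually (\<lambda>s. \<ominus>\<^bsub>Om s\<^esub> f s \<oplus>\<^bsub>Om s\<^esub> f s = \<zero>\<^bsub>Om s\<^esub>) D"
      using sub f(2) by (rule eventually_elim2) (auto intro: Om.l_neg)
    then have "ucls D (\<lambda>s. \<ominus>\<^bsub>Om s\<^esub> f s) \<oplus>\<^bsub>U\<^esub> h = \<zero>\<^bsub>U\<^esub>"
      by (simp add: f(1) ucls_eq_iff)
    ultimately have "\<ominus>\<^bsub>U\<^esub> h = ucls D (\<lambda>s. \<ominus>\<^bsub>Om s\<^esub> f s)"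
      using U.minus_equality h sub' ucls_in_ultraprod_iff by blast
    then show ?thesis
      using 1 by simp
  qed
  show "inv\<^bsub>U\<^esub> h \<in> ultraprod D A" if h: "h \<in> ultraprod D A - {\<zero>\<^bsub>U\<^esub>}" for h
  proof -
    obtain f where f: "h = ucls D f" "eventually (\<lambda>s. f s \<in> A s) D"
      using h by (auto elim!: ultraprod_cases)
    have "eventually (\<lambda>s. f s \<noteq> \<zero>\<^bsub>Om s\<^esub>) D"
      using h f(1) by (simp add: ucls_eq_iff eventually_not_iff)
    then have *: "eventually (\<lambda>s. subfield (A s) (Om s) \<and> f s \<in> A s - {\<zero>\<^bsub>Om s\<^esub>}) D"
      using A f(2) by (simp add: eventually_conj_iff)
    have 1: "eventually (\<lambda>s. inv\<^bsub>Om s\<^esub> f s \<in> A s) D"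
      using * by (rule eventually_mono) (use Om.subfield_m_inv(1) in blast)
    have "eventually (\<lambda>s. f s \<otimes>\<^bsub>Om s\<^esub> inv\<^bsub>Om s\<^esub> f s = \<one>\<^bsub>Om s\<^esub>) D"
      using * by (rule eventually_mono) (use Om.subfield_m_inv(2) in blast)
    then have "h \<otimes>\<^bsub>U\<^esub> ucls D (\<lambda>s. inv\<^bsub>Om s\<^esub> f s) = \<one>\<^bsub>U\<^esub>"
      by (simp add: f(1) ucls_eq_iff)
    then have "inv\<^bsub>U\<^esub> h = ucls D (\<lambda>s. inv\<^bsub>Om s\<^esub> f s)"
      using U.comm_inv_char[of h "ucls D (\<lambda>s. inv\<^bsub>Om s\<^esub> f s)"] 1 h sub'
        ucls_in_ultraprod_iff[of "\<lambda>s. inv\<^bsub>Om s\<^esub> f s" A] by blast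
    then show ?thesis
      using 1 by simp
  qed
qed

end

lemma (in ring) Gal_mult_closed:
  assumes E: "subring E R" "K \<subseteq> E"
    and \<rho>: "\<rho> \<in> carrier (Gal R K E)" and \<tau>: "\<tau> \<in> carrier (Gal R K E)"
  shows "\<rho> \<otimes>\<^bsub>Gal R K E\<^esub> \<tau> \<in> carrier (Gal R K E)"
proof -
  have \<tau>E: "\<tau> y \<in> E" if "y \<in> E" for y
    using \<tau> that by (auto simp: Gal_iff dest: bij_betw_apply)
  have "bij_betw (restrict (\<rho> \<circ> \<tau>) E) E E"
    using \<rho> \<tau> bij_betw_trans[of \<tau> E E \<rho> E] by (simp add: Gal_iff cong: bij_betw_cong)
  moreover have "y \<oplus> z \<in> E" "y \<otimes> z \<in> E" if "y \<in> E" "z \<in> E" for y z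
    using subringE(6,7)[OF E(1)] that by auto
  ultimately have "restrict (\<rho> \<circ> \<tau>) E \<in> carrier (Gal R K E)"
    using \<rho> \<tau> \<tau>E E(2) by (simp add: Gal_iff subset_iff)
  then show ?thesis
    by (simp add: Gal_def)
qed

text \<open>The inverse is multiplicative because \<open>h\<close> can be cancelled on a product,
  for which the product must lie in the source; hence the closure hypothesis.\<close>

lemma iso_sym_if_mult_closed:
  assumes h: "h \<in> iso G H"
    and closed: "\<And>a b. \<lbrakk>a \<in> carrier G; b \<in> carrier G\<rbrakk> \<Longrightarrow> a \<otimes>\<^bsub>G\<^esub> b \<in> carrier G"
  shows "H \<cong> G"
proof -
  let ?k = "inv_into (carrier G) h"
  have hom: "h \<in> hom G H" and bij: "bij_betw h (carrier G) (carrier H)"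
    using h by (auto simp: iso_def)
  have bij': "bij_betw ?k (carrier H) (carrier G)"
    by (rule bij_betw_inv_into[OF bij])
  have "?k \<in> hom H G"
  proof (rule homI)
    show "?k a \<in> carrier G" if "a \<in> carrier H" for a
      using bij_betw_apply[OF bij' that] .
    show "?k (a \<otimes>\<^bsub>H\<^esub> b) = ?k a \<otimes>\<^bsub>G\<^esub> ?k b" if "a \<in> carrier H" "b \<in> carrier H" for a b
    proof -
      have ab: "?k a \<in> carrier G" "?k b \<in> carrier G"
        using bij_betw_apply[OF bij'] that by auto
      have "h (?k a \<otimes>\<^bsub>G\<^esub> ?k b) = a \<otimes>\<^bsub>H\<^esub> b"
        using hom_mult[OF hom ab] bij_betw_inv_into_right[OF bij] that by simp
      then show ?thesis
        using bij_betw_inv_into_left[OF bij closed[OF ab]] by simp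
    qed
  qed
  then show ?thesis
    using bij' by (auto simp: is_iso_def iso_def)
qed

section \<open>Simple extensions of an ultraproduct of subfields\<close>

locale ultraproduct_extension = ultraproduct D Om for D :: "'s filter" and Om :: "'s \<Rightarrow> 'a ring" +
  fixes A :: "'s \<Rightarrow> 'a set" and xs :: "'s \<Rightarrow> 'a"
  assumes subfield_A: "subfield (A s) (Om s)"
    and xs_carrier: "ucls D xs \<in> carrier (ultra_ring D Om)"
    and xs_algebraic: "(ring.algebraic (ultra_ring D Om) over (ultraprod D A)) (ucls D xs)"
begin

interpretation Om: algebraically_closed "Om s" for s
  by (rule algebraically_closed_Om)

interpretation U: algebraically_closed U
  by (rule U_algebraically_closed)

abbreviation "UA \<equiv> ultraprod D A"
abbreviation "x \<equiv> ucls D xs"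
abbreviation "f \<equiv> U.Irr UA x"
abbreviation "E s \<equiv> Om.simple_extension s (A s) (xs s)"
abbreviation "EU \<equiv> ultraprod D E"
abbreviation "Gs s \<equiv> Gal (Om s) (A s) (E s)"
text \<open>The coordinates at which the minimal polynomial of the limit is the true minimal
  polynomial of \<open>xs s\<close>; pointwise arguments take place there.\<close>

abbreviation "regular s \<equiv> xs s \<in> carrier (Om s) \<and> (Om.algebraic s over (A s)) (xs s) \<and>
  Om.Irr s (A s) (xs s) = coords f s"

lemma subfield_UA: "subfield UA U"
  by (rule subfield_ultraprod) (simp add: subfield_A)

lemmas f_facts = U.Irr_facts[OF subfield_UA xs_carrier xs_algebraic]
  and f_Irr = U.IrrE[OF subfield_UA xs_carrier xs_algebraic]
  and UE = U.algebraic_simple_extension[OF subfield_UA xs_carrier xs_algebraic]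

lemma f_in_carrier: "set f \<subseteq> carrier U"
  using f_facts(3) subfieldE(3)[OF subfield_UA] by blast

text \<open>Almost everywhere \<open>coords f s\<close> is monic and vanishes at
  \<open>xs s\<close>. If the minimal polynomials in the coordinates had smaller degree almost
  everywhere, one degree \<open>d < degree f\<close> would occur almost everywhere, and their limit
  would be a nonzero polynomial over \<open>UA\<close> of degree \<open>d\<close> vanishing at
  \<open>x\<close>.\<close>

lemma eventually_Irr:
  "eventually (\<lambda>s. regular s) D"
proof -
  define g where "g s \<longleftrightarrow> xs s \<in> carrier (Om s) \<and> coords f s \<in> carrier ((A s)[X]\<^bsub>Om s\<^esub>) \<and>
    Om.eval s (coords f s) (xs s) = \<zero>\<^bsub>Om s\<^esub> \<and> hd (coords f s) = \<one>\<^bsub>Om s\<^esub>" for s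
  have xc: "eventually (\<lambda>s. xs s \<in> carrier (Om s)) D"
    using xs_carrier by (simp add: carrier_U)
  have "ucls D (urep D (hd f)) = hd f"
    using f_facts(2,3) by (intro ucls_urep[of _ A]) (cases f, auto)
  then have "ucls D (urep D (hd f)) = ucls D (\<lambda>s. \<one>\<^bsub>Om s\<^esub>)"
    using f_Irr(3) by simp
  then have hd: "eventually (\<lambda>s. urep D (hd f) s = \<one>\<^bsub>Om s\<^esub>) D"
    by (simp only: ucls_eq_iff)
  have hd: "eventually (\<lambda>s. hd (coords f s) = \<one>\<^bsub>Om s\<^esub>) D"
    using hd by (rule eventually_mono) (simp add: coords_def hd_map f_facts(2))
  have g: "eventually g D"
    unfolding g_def
    using xc eventually_coords_poly[OF f_Irr(1)] hd eventually_eval_coords[OF f_in_carrier, of xs] f_Irr(4)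
    by (simp add: eventually_conj_iff)
  have ne: "coords f s \<noteq> []" for s
    using f_facts(2) by (metis length_0_conv length_coords)
  have alg: "(Om.algebraic s over (A s)) (xs s)" if "g s" for s
  proof (rule Om.algebraicI[OF _ ne])
    show "coords f s \<in> carrier ((A s)[X]\<^bsub>Om s\<^esub>)" "Om.eval s (coords f s) (xs s) = \<zero>\<^bsub>Om s\<^esub>"
      using that by (simp_all add: g_def)
  qed
  have "eventually (\<lambda>s. degree f \<le> degree (Om.Irr s (A s) (xs s))) D"
  proof (rule ccontr)
    assume "\<not> eventually (\<lambda>s. degree f \<le> degree (Om.Irr s (A s) (xs s))) D"
    then have "eventually (\<lambda>s. \<not> degree f \<le> degree (Om.Irr s (A s) (xs s))) D"
      by (simp only: eventually_not_iff not_False_eq_True)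
    then have "eventually (\<lambda>s. \<exists>d\<in>{..<degree f}. degree (Om.Irr s (A s) (xs s)) = d \<and> g s) D"
      using g by (rule eventually_elim2) auto
    then obtain d where d: "d < degree f" "eventually (\<lambda>s. degree (Om.Irr s (A s) (xs s)) = d \<and> g s) D"
      by (rule eventually_bex_finite[rotated]) auto
    let ?ps = "\<lambda>s. Om.Irr s (A s) (xs s)"
    have "eventually (\<lambda>s. length (?ps s) = Suc d \<and> ?ps s \<in> carrier ((A s)[X]\<^bsub>Om s\<^esub>) \<and>
        Om.eval s (?ps s) (xs s) = \<zero>\<^bsub>Om s\<^esub>) D"
      using d(2)
    proof (rule eventually_mono)
      fix s assume s: "degree (?ps s) = d \<and> g s"
      then have "xs s \<in> carrier (Om s)" "(Om.algebraic s over (A s)) (xs s)"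
        using alg by (auto simp: g_def)
      \<comment> \<open>\<open>degree\<close> is the truncated length minus one; its positivity
        excludes the empty list, so the length is exactly \<open>Suc d\<close>.\<close>
      note I = Om.IrrE(1,4)[OF subfield_A this] and F = Om.Irr_facts(4)[OF subfield_A this]
      show "length (?ps s) = Suc d \<and> ?ps s \<in> carrier ((A s)[X]\<^bsub>Om s\<^esub>) \<and>
          Om.eval s (?ps s) (xs s) = \<zero>\<^bsub>Om s\<^esub>"
        using I F s by auto
    qed
    then have ps: "eventually (\<lambda>s. length (?ps s) = Suc d) D"
      "eventually (\<lambda>s. length (?ps s) = Suc d \<and> ?ps s \<in> carrier ((A s)[X]\<^bsub>Om s\<^esub>)) D"
      "eventually (\<lambda>s. Om.eval s (?ps s) (xs s) = \<zero>\<^bsub>Om s\<^esub>) D"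
      by (simp_all add: eventually_conj_iff)
    let ?p = "ulist (Suc d) ?ps"
    have p: "?p \<in> carrier (UA[X]\<^bsub>U\<^esub>)"
      by (rule ulist_poly[OF ps(2)])
    then have pc: "set ?p \<subseteq> carrier U"
      using subfieldE(3)[OF subfield_UA] by (auto simp: univ_poly_def polynomial_def)
    have p0: "?p \<noteq> []"
      by (metis length_ulist list.size(3) nat.distinct(1))
    have "eventually (\<lambda>s. Om.eval s (coords ?p s) (xs s) = \<zero>\<^bsub>Om s\<^esub>) D"
      using ps(3) eventually_coords_ulist[OF ps(1)] by (rule eventually_elim2) simp
    then have "U.eval ?p x = \<zero>\<^bsub>U\<^esub>"
      by (simp only: eventually_eval_coords[OF pc])
    then have "f pdivides\<^bsub>U\<^esub> ?p"
      by (rule U.Irr_minimal[OF subfield_UA xs_carrier xs_algebraic p])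
    then have "degree f \<le> degree ?p"
      by (rule U.pdivides_imp_degree_le[OF subfieldE(1)[OF subfield_UA] f_Irr(1) p p0])
    then show False
      using d(1) by simp
  qed
  with g show ?thesis
  proof (rule eventually_elim2)
    fix s assume s: "g s" "degree f \<le> degree (Om.Irr s (A s) (xs s))"
    then have "coords f s = Om.Irr s (A s) (xs s)"
      by (intro Om.Irr_eqI[OF subfield_A _ _ ne]) (simp_all add: g_def)
    then show "regular s"
      using alg[OF s(1)] s(1) by (simp add: g_def)
  qed
qed

text \<open>An element of \<open>E s\<close> is a combination of powers of \<open>xs s\<close> below
  \<open>degree f\<close>, a bound independent of \<open>s\<close>. This is what allows the
  polynomials representing a tuple of elements to have a limit.\<close>

lemma ultraprod_E: "EU = U.simple_extension UA x"
proof
  show "EU \<subseteq> U.simple_extension UA x"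
  proof
    fix y assume "y \<in> EU"
    then obtain ys where y: "y = ucls D ys" "eventually (\<lambda>s. ys s \<in> E s) D"
      by (rule ultraprod_cases)
    have "eventually (\<lambda>s. \<exists>p. p \<in> carrier ((A s)[X]\<^bsub>Om s\<^esub>) \<and> length p \<le> degree f \<and> ys s = Om.eval s p (xs s)) D"
      using eventually_Irr y(2)
    proof (rule eventually_elim2)
      fix s assume s: "regular s" and ys: "ys s \<in> E s"
      have "ys s \<in> Om.Span s (A s) (Om.exp_base s (xs s) (degree f))"
        using Om.Span_exp_base[OF subfield_A, of "xs s"] s ys by (metis length_coords)
      then show "\<exists>p. p \<in> carrier ((A s)[X]\<^bsub>Om s\<^esub>) \<and> length p \<le> degree f \<and> ys s = Om.eval s p (xs s)"
        using Om.Span_eq_eval_img[OF subfield_A, of "xs s" s "degree f"] s by blast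
    qed
    then obtain ps where "eventually (\<lambda>s. ps s \<in> carrier ((A s)[X]\<^bsub>Om s\<^esub>) \<and> length (ps s) \<le> degree f \<and>
        ys s = Om.eval s (ps s) (xs s)) D"
      by (rule eventually_choice)
    then have "eventually (\<lambda>s. \<exists>n\<in>{..degree f}. length (ps s) = n \<and> ps s \<in> carrier ((A s)[X]\<^bsub>Om s\<^esub>) \<and>
        ys s = Om.eval s (ps s) (xs s)) D"
      by (rule eventually_mono) auto
    then obtain n where "eventually (\<lambda>s. length (ps s) = n \<and> ps s \<in> carrier ((A s)[X]\<^bsub>Om s\<^esub>) \<and>
        ys s = Om.eval s (ps s) (xs s)) D"
      by (rule eventually_bex_finite[rotated]) auto
    then have ps: "eventually (\<lambda>s. length (ps s) = n) D"
      "eventually (\<lambda>s. length (ps s) = n \<and> ps s \<in> carrier ((A s)[X]\<^bsub>Om s\<^esub>)) D"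
      "eventually (\<lambda>s. ys s = Om.eval s (ps s) (xs s)) D"
      by (simp_all add: eventually_conj_iff)
    let ?p = "ulist n ps"
    have p: "?p \<in> carrier (UA[X]\<^bsub>U\<^esub>)"
      by (rule ulist_poly[OF ps(2)])
    then have pc: "set ?p \<subseteq> carrier U"
      using subfieldE(3)[OF subfield_UA] by (auto simp: univ_poly_def polynomial_def)
    have "eventually (\<lambda>s. ys s = Om.eval s (coords ?p s) (xs s)) D"
      using ps(3) eventually_coords_ulist[OF ps(1)] by (rule eventually_elim2) simp
    then have "y = U.eval ?p x"
      using y(1) by (simp only: eval_coords[OF pc] ucls_eq_iff)
    then show "y \<in> U.simple_extension UA x"
      using p U.simple_extension_as_eval_img[OF subfieldE(3)[OF subfield_UA] xs_carrier] by auto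
  qed
  show "U.simple_extension UA x \<subseteq> EU"
  proof
    fix y assume "y \<in> U.simple_extension UA x"
    then obtain p where p: "set p \<subseteq> UA" "y = U.eval p x"
      by (rule U.simple_extension_cases[OF subfield_UA xs_carrier]) blast
    then have pc: "set p \<subseteq> carrier U"
      using subfieldE(3)[OF subfield_UA] by blast
    have "eventually (\<lambda>s. Om.eval s (coords p s) (xs s) \<in> E s) D"
      using eventually_Irr eventually_set_coords[OF p(1)]
    proof (rule eventually_elim2)
      fix s assume s: "regular s" and ps: "set (coords p s) \<subseteq> A s"
      then have "xs s \<in> carrier (Om s)" "(Om.algebraic s over (A s)) (xs s)"
        by auto
      note e = Om.algebraic_simple_extension[OF subfield_A this]
      show "Om.eval s (coords p s) (xs s) \<in> E s"
        using Om.eval_in_subring[OF e(5) _ e(3)] ps e(2) by blast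
    qed
    then show "y \<in> EU"
      by (simp add: p(2) eval_coords[OF pc])
  qed
qed

text \<open>Finitely many distinct roots in \<open>U\<close> have pairwise distinct coordinates
  almost everywhere. They provide \<open>degree f\<close> roots of \<open>coords f s\<close>, and
  there cannot be more, so every root in a coordinate comes from the limit.\<close>

lemma eventually_roots:
  assumes sep: "card {a. U.is_root f a} = degree f"
  shows "eventually (\<lambda>s. {a. Om.is_root s (coords f s) a} = (\<lambda>a. urep D a s) ` {a. U.is_root f a} \<and>
    card {a. Om.is_root s (coords f s) a} = degree f) D"
proof -
  let ?R = "{a. U.is_root f a}"
  have fin: "finite ?R"
    by (rule U.finite_number_of_roots[OF f_facts(1)])
  have R: "ucls D (urep D a) = a" "a \<in> ultraprod D (\<lambda>s. carrier (Om s))" if "a \<in> ?R" for a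
  proof -
    show "a \<in> ultraprod D (\<lambda>s. carrier (Om s))"
      using that by (simp add: U.is_root_def carrier_U)
    then show "ucls D (urep D a) = a"
      by (rule ucls_urep)
  qed
  have "eventually (\<lambda>s. \<forall>a\<in>?R. \<forall>b\<in>?R. a \<noteq> b \<longrightarrow> urep D a s \<noteq> urep D b s) D"
  proof (intro eventually_ball_finite[OF fin] ballI)
    fix a b assume ab: "a \<in> ?R" "b \<in> ?R"
    show "eventually (\<lambda>s. a \<noteq> b \<longrightarrow> urep D a s \<noteq> urep D b s) D"
    proof (cases "a = b")
      case False
      then have "ucls D (urep D a) \<noteq> ucls D (urep D b)"
        using R(1)[OF ab(1)] R(1)[OF ab(2)] by simp
      then have "eventually (\<lambda>s. urep D a s \<noteq> urep D b s) D"
        by (simp only: ucls_eq_iff eventually_not_iff not_False_eq_True)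
      then show ?thesis
        by (rule eventually_mono) simp
    qed simp
  qed
  moreover have "eventually (\<lambda>s. \<forall>a\<in>?R. urep D a s \<in> carrier (Om s) \<and>
      Om.eval s (coords f s) (urep D a s) = \<zero>\<^bsub>Om s\<^esub>) D"
  proof (intro eventually_ball_finite[OF fin] ballI)
    fix a assume a: "a \<in> ?R"
    then have "U.eval f (ucls D (urep D a)) = \<zero>\<^bsub>U\<^esub>"
      unfolding R(1)[OF a] by (simp add: U.is_root_def)
    then have "eventually (\<lambda>s. Om.eval s (coords f s) (urep D a s) = \<zero>\<^bsub>Om s\<^esub>) D"
      by (simp only: eventually_eval_coords[OF f_in_carrier])
    then show "eventually (\<lambda>s. urep D a s \<in> carrier (Om s) \<and>
      Om.eval s (coords f s) (urep D a s) = \<zero>\<^bsub>Om s\<^esub>) D"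
      using eventually_urep_in[OF R(2)[OF a]] by (simp add: eventually_conj_iff)
  qed
  ultimately have "eventually (\<lambda>s. inj_on (\<lambda>a. urep D a s) ?R \<and>
      (\<lambda>a. urep D a s) ` ?R \<subseteq> {a. Om.is_root s (coords f s) a}) D"
  proof (rule eventually_elim2)
    fix s assume s: "\<forall>a\<in>?R. \<forall>b\<in>?R. a \<noteq> b \<longrightarrow> urep D a s \<noteq> urep D b s"
      "\<forall>a\<in>?R. urep D a s \<in> carrier (Om s) \<and> Om.eval s (coords f s) (urep D a s) = \<zero>\<^bsub>Om s\<^esub>"
    have "coords f s \<noteq> []"
      using f_facts(2) by (metis length_0_conv length_coords)
    then show "inj_on (\<lambda>a. urep D a s) ?R \<and> (\<lambda>a. urep D a s) ` ?R \<subseteq> {a. Om.is_root s (coords f s) a}"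
      using s by (auto simp: Om.is_root_def inj_on_def)
  qed
  with eventually_Irr show ?thesis
  proof (rule eventually_elim2)
    fix s assume s: "regular s"
      and inj: "inj_on (\<lambda>a. urep D a s) ?R \<and> (\<lambda>a. urep D a s) ` ?R \<subseteq> {a. Om.is_root s (coords f s) a}"
    have c: "coords f s \<in> carrier (poly_ring (Om s))"
      using Om.Irr_facts(1)[OF subfield_A, of "xs s"] s by metis
    have fin: "finite {a. Om.is_root s (coords f s) a}"
      by (rule Om.finite_number_of_roots[OF c])
    have "card ((\<lambda>a. urep D a s) ` ?R) = degree f"
      using inj sep by (simp add: card_image)
    moreover have "card {a. Om.is_root s (coords f s) a} \<le> degree f"
      using Om.card_roots_le_degree[OF c] by simp
    ultimately show "{a. Om.is_root s (coords f s) a} = (\<lambda>a. urep D a s) ` ?R \<and>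
        card {a. Om.is_root s (coords f s) a} = degree f"
      using inj card_subset_eq[OF fin] card_mono[OF fin] by (metis le_antisym)
  qed
qed

section \<open>Galois groups of ultraproduct extensions\<close>

lemma uact_ucls [simp]: "uact D \<rho> (ucls D g) = ucls D (\<lambda>s. \<rho> s (g s))"
  unfolding uact_def ucls_eq_iff using eventually_urep_ucls[of g] by (rule eventually_mono) simp

lemma eventually_E:
  "eventually (\<lambda>s. subfield (E s) (Om s) \<and> A s \<subseteq> E s \<and> xs s \<in> E s \<and> E s \<subseteq> carrier (Om s)) D"
  using eventually_Irr
proof (rule eventually_mono)
  fix s assume "regular s"
  then have "xs s \<in> carrier (Om s)" "(Om.algebraic s over (A s)) (xs s)"
    by auto
  then show "subfield (E s) (Om s) \<and> A s \<subseteq> E s \<and> xs s \<in> E s \<and> E s \<subseteq> carrier (Om s)"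
    using Om.algebraic_simple_extension(1-4)[OF subfield_A] by simp
qed

text \<open>Compatibility with the operations and with \<open>UA\<close> is checked in coordinates;
  bijectivity then follows from algebraicity of \<open>EU\<close> over \<open>UA\<close>.\<close>

lemma restrict_uact_in_Gal:
  assumes \<rho>: "eventually (\<lambda>s. \<rho> s \<in> carrier (Gs s)) D"
  shows "restrict (uact D \<rho>) EU \<in> carrier (Gal U UA EU)"
proof -
  have \<rho>': "eventually (\<lambda>s. Om.embedding_over s (A s) (E s) (\<rho> s) \<and> \<rho> s ` E s = E s) D"
    using eventually_E \<rho>
  proof (rule eventually_elim2)
    fix s assume s: "subfield (E s) (Om s) \<and> A s \<subseteq> E s \<and> xs s \<in> E s \<and> E s \<subseteq> carrier (Om s)"
      and \<rho>s: "\<rho> s \<in> carrier (Gs s)"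
    then have "E s \<subseteq> carrier (Om s)"
      by simp
    then show "Om.embedding_over s (A s) (E s) (\<rho> s) \<and> \<rho> s ` E s = E s"
      using Om.Gal_embedding(1,2)[OF \<rho>s] by simp
  qed
  have "uact D \<rho> ` EU \<subseteq> EU"
  proof clarify
    fix y assume "y \<in> EU"
    then obtain ys where y: "y = ucls D ys" "eventually (\<lambda>s. ys s \<in> E s) D"
      by (rule ultraprod_cases)
    from \<rho>' y(2) have "eventually (\<lambda>s. \<rho> s (ys s) \<in> E s) D"
      by (rule eventually_elim2) blast
    then show "uact D \<rho> y \<in> EU"
      by (simp add: y(1))
  qed
  moreover have "U.embedding_over UA EU (uact D \<rho>)"
    unfolding U.embedding_over_def
  proof (intro conjI ballI)
    show "uact D \<rho> ` EU \<subseteq> carrier U"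
      using calculation UE(4) ultraprod_E by blast
    show "uact D \<rho> k = k" if "k \<in> UA" for k
    proof -
      from that obtain ks where k: "k = ucls D ks" "eventually (\<lambda>s. ks s \<in> A s) D"
        by (rule ultraprod_cases)
      from \<rho>' k(2) have "eventually (\<lambda>s. \<rho> s (ks s) = ks s) D"
        by (rule eventually_elim2) (blast dest: Om.embedding_overD(2))
      then show ?thesis
        by (simp add: k(1) ucls_eq_iff)
    qed
    fix y z assume "y \<in> EU" "z \<in> EU"
    then obtain ys zs where y: "y = ucls D ys" "eventually (\<lambda>s. ys s \<in> E s) D"
      and z: "z = ucls D zs" "eventually (\<lambda>s. zs s \<in> E s) D"
      by (auto elim!: ultraprod_cases)
    have "eventually (\<lambda>s. (Om.embedding_over s (A s) (E s) (\<rho> s) \<and> \<rho> s ` E s = E s) \<and> ys s \<in> E s \<and> zs s \<in> E s) D"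
      using \<rho>' y(2) z(2) by (simp add: eventually_conj_iff)
    then have "eventually (\<lambda>s. \<rho> s (ys s \<oplus>\<^bsub>Om s\<^esub> zs s) = \<rho> s (ys s) \<oplus>\<^bsub>Om s\<^esub> \<rho> s (zs s) \<and>
        \<rho> s (ys s \<otimes>\<^bsub>Om s\<^esub> zs s) = \<rho> s (ys s) \<otimes>\<^bsub>Om s\<^esub> \<rho> s (zs s)) D"
      by (rule eventually_mono) (blast dest: Om.embedding_overD(3,4))
    then show "uact D \<rho> (y \<oplus>\<^bsub>U\<^esub> z) = uact D \<rho> y \<oplus>\<^bsub>U\<^esub> uact D \<rho> z"
      "uact D \<rho> (y \<otimes>\<^bsub>U\<^esub> z) = uact D \<rho> y \<otimes>\<^bsub>U\<^esub> uact D \<rho> z"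
      by (simp_all add: y(1) z(1) ucls_eq_iff eventually_conj_iff)
  qed
  ultimately show ?thesis
    using U.GalI[OF subfield_UA, of "EU" "uact D \<rho>"] UE(1,2,6) by (simp add: ultraprod_E)
qed

lemma x_in_E: "x \<in> EU"
  using UE(3) by (simp add: ultraprod_E)

text \<open>An automorphism \<open>\<tau>\<close> sends \<open>x\<close> to a root of
  \<open>f\<close> in \<open>EU\<close>, whose coordinates are almost everywhere conjugates of
  \<open>xs s\<close> in \<open>E s\<close>. Automorphisms of \<open>E s\<close> realizing these
  conjugates form a family that agrees with \<open>\<tau>\<close> at the generator.\<close>

lemma carrier_Gal_ultraprod:
  "carrier (Gal U UA EU) =
    {restrict (uact D \<rho>) EU | \<rho>. eventually (\<lambda>s. \<rho> s \<in> carrier (Gs s)) D}"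
proof
  show "carrier (Gal U UA EU) \<subseteq> {restrict (uact D \<rho>) EU | \<rho>.
      eventually (\<lambda>s. \<rho> s \<in> carrier (Gs s)) D}"
  proof
    fix \<tau> assume \<tau>: "\<tau> \<in> carrier (Gal U UA EU)"
    note G = U.Gal_embedding[OF \<tau>[unfolded ultraprod_E] UE(4)]
    have root: "U.is_root f (\<tau> x)"
      by (rule U.embedding_over_root[OF subfield_UA UE(5,2) G(1) UE(3) xs_algebraic])
    have "\<tau> x \<in> EU"
      using G(2) UE(3) unfolding ultraprod_E by blast
    then obtain ys where y: "\<tau> x = ucls D ys" "eventually (\<lambda>s. ys s \<in> E s) D"
      by (rule ultraprod_cases)
    have "U.eval f (ucls D ys) = \<zero>\<^bsub>U\<^esub>"
      using root unfolding y(1) by (simp add: U.is_root_def)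
    then have "eventually (\<lambda>s. Om.eval s (coords f s) (ys s) = \<zero>\<^bsub>Om s\<^esub>) D"
      by (simp only: eventually_eval_coords[OF f_in_carrier])
    then have "eventually (\<lambda>s. Om.eval s (coords f s) (ys s) = \<zero>\<^bsub>Om s\<^esub> \<and> ys s \<in> E s) D"
      using y(2) by (simp add: eventually_conj_iff)
    with eventually_Irr have "eventually (\<lambda>s. \<exists>\<rho>. \<rho> \<in> carrier (Gs s) \<and> \<rho> (xs s) = ys s) D"
    proof (rule eventually_elim2)
      fix s assume s: "regular s" and ys: "Om.eval s (coords f s) (ys s) = \<zero>\<^bsub>Om s\<^esub> \<and> ys s \<in> E s"
      then have x: "xs s \<in> carrier (Om s)" "(Om.algebraic s over (A s)) (xs s)"
        by auto
      note e = Om.algebraic_simple_extension[OF subfield_A x]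
      have "Om.is_root s (Om.Irr s (A s) (xs s)) (ys s)"
        using s ys e(4) Om.Irr_facts(2)[OF subfield_A x] by (auto simp: Om.is_root_def)
      then show "\<exists>\<rho>. \<rho> \<in> carrier (Gs s) \<and> \<rho> (xs s) = ys s"
        using Om.Gal_simple_extension_exists[OF subfield_A x] ys by blast
    qed
    then obtain \<rho> where "eventually (\<lambda>s. \<rho> s \<in> carrier (Gs s) \<and> \<rho> s (xs s) = ys s) D"
      by (rule eventually_choice)
    then have \<rho>: "eventually (\<lambda>s. \<rho> s \<in> carrier (Gs s)) D"
      and "ucls D (\<lambda>s. \<rho> s (xs s)) = ucls D ys"
      by (simp_all add: eventually_conj_iff ucls_eq_iff)
    then have "\<tau> x = restrict (uact D \<rho>) EU x"
      using y(1) x_in_E by simp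
    then have "\<tau> = restrict (uact D \<rho>) EU"
      using U.Gal_simple_extension_eqI[OF subfield_UA xs_carrier xs_algebraic] \<tau> restrict_uact_in_Gal[OF \<rho>]
      unfolding ultraprod_E by blast
    then show "\<tau> \<in> {restrict (uact D \<rho>) EU | \<rho>.
      eventually (\<lambda>s. \<rho> s \<in> carrier (Gs s)) D}"
      using \<rho> by blast
  qed
qed (use restrict_uact_in_Gal in blast)

text \<open>Equality on \<open>EU\<close> gives a separate exceptional set for each element; since
  the generator determines an automorphism, the set belonging to \<open>x\<close> alone
  suffices.\<close>

lemma eventually_eq_if_restrict_uact_eq:
  assumes "eventually (\<lambda>s. \<rho> s \<in> carrier (Gs s)) D"
    and "eventually (\<lambda>s. \<tau> s \<in> carrier (Gs s)) D"
    and "restrict (uact D \<rho>) EU = restrict (uact D \<tau>) EU"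
  shows "eventually (\<lambda>s. \<rho> s = \<tau> s) D"
proof -
  have "uact D \<rho> x = uact D \<tau> x"
    using fun_cong[OF assms(3), of x] x_in_E by simp
  then have "eventually (\<lambda>s. \<rho> s \<in> carrier (Gs s) \<and>
      \<tau> s \<in> carrier (Gs s) \<and> \<rho> s (xs s) = \<tau> s (xs s)) D"
    using assms(1,2) by (simp add: ucls_eq_iff eventually_conj_iff)
  with eventually_Irr show ?thesis
  proof (rule eventually_elim2)
    fix s assume s: "regular s" and eq: "\<rho> s \<in> carrier (Gs s) \<and>
      \<tau> s \<in> carrier (Gs s) \<and> \<rho> s (xs s) = \<tau> s (xs s)"
    show "\<rho> s = \<tau> s"
      by (rule Om.Gal_simple_extension_eqI[OF subfield_A]) (use s eq in auto)
  qed
qed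

text \<open>Choose a representing family \<open>c g\<close> for each \<open>g\<close> of the limit
  group. This group is finite, so the conditions that make \<open>g \<mapsto> c g s\<close> an
  injective homomorphism, finitely many in number, hold together at almost every
  \<open>s\<close>.\<close>

lemma eventually_Gal_iso:
  "eventually (\<lambda>s. Gs s \<cong> Gal U UA EU) D"
proof -
  let ?G = "Gal U UA EU"
  have finG: "finite (carrier ?G)"
    using U.finite_Gal_simple_extension[OF subfield_UA xs_carrier xs_algebraic]
    by (simp add: ultraprod_E)
  have closedG: "g \<otimes>\<^bsub>?G\<^esub> h \<in> carrier ?G" if "g \<in> carrier ?G" "h \<in> carrier ?G" for g h
    using U.Gal_mult_closed[OF UE(5,2)] that unfolding ultraprod_E by blast
  have "\<forall>g\<in>carrier ?G. \<exists>\<rho>. eventually (\<lambda>s. \<rho> s \<in> carrier (Gs s)) D \<and> restrict (uact D \<rho>) EU = g"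
    unfolding carrier_Gal_ultraprod by auto
  then obtain c where "\<forall>g\<in>carrier ?G. eventually (\<lambda>s. c g s \<in> carrier (Gs s)) D \<and>
      restrict (uact D (c g)) EU = g"
    using bchoice[of "carrier ?G" "\<lambda>g \<rho>. eventually (\<lambda>s. \<rho> s \<in> carrier (Gs s)) D \<and> restrict (uact D \<rho>) EU = g"]
    by blast
  then have c: "eventually (\<lambda>s. c g s \<in> carrier (Gs s)) D" "restrict (uact D (c g)) EU = g"
    if "g \<in> carrier ?G" for g
    using that by simp_all
  have mem: "eventually (\<lambda>s. \<forall>g\<in>carrier ?G. c g s \<in> carrier (Gs s)) D"
    by (intro eventually_ball_finite[OF finG] ballI c(1))
  have mult: "eventually (\<lambda>s. c (g \<otimes>\<^bsub>?G\<^esub> h) s = c g s \<otimes>\<^bsub>Gs s\<^esub> c h s) D"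
    if gh: "g \<in> carrier ?G" "h \<in> carrier ?G" for g h
  proof (rule eventually_eq_if_restrict_uact_eq[OF c(1)[OF closedG[OF gh]]])
    have "eventually (\<lambda>s. c g s \<in> carrier (Gs s) \<and> c h s \<in> carrier (Gs s)) D"
      using c(1)[OF gh(1)] c(1)[OF gh(2)] by (simp add: eventually_conj_iff)
    with eventually_E show "eventually (\<lambda>s. c g s \<otimes>\<^bsub>Gs s\<^esub> c h s \<in> carrier (Gs s)) D"
    proof (rule eventually_elim2)
      fix s assume s: "subfield (E s) (Om s) \<and> A s \<subseteq> E s \<and> xs s \<in> E s \<and> E s \<subseteq> carrier (Om s)"
        and m: "c g s \<in> carrier (Gs s) \<and> c h s \<in> carrier (Gs s)"
      show "c g s \<otimes>\<^bsub>Gs s\<^esub> c h s \<in> carrier (Gs s)"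
        by (rule Om.Gal_mult_closed) (use s m in \<open>auto intro: subfieldE(1)\<close>)
    qed
    have "uact D (\<lambda>s. c g s \<otimes>\<^bsub>Gs s\<^esub> c h s) y = g (h y)" if y: "y \<in> EU" for y
    proof -
      obtain ys where ys: "y = ucls D ys" "eventually (\<lambda>s. ys s \<in> E s) D"
        using y by (rule ultraprod_cases)
      have "h y \<in> EU"
        using gh(2) y by (auto simp: U.Gal_iff dest: bij_betw_apply)
      have app: "k z = uact D (c k) z" if "k \<in> carrier ?G" "z \<in> EU" for k z
        using fun_cong[OF c(2)[OF that(1)], of z] that(2) by simp
      have "g (h y) = uact D (c g) (uact D (c h) y)"
        using app[OF gh(1) \<open>h y \<in> EU\<close>] app[OF gh(2) y] by simp
      also have "\<dots> = ucls D (\<lambda>s. c g s (c h s (ys s)))"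
        by (simp add: ys(1))
      also have "\<dots> = uact D (\<lambda>s. c g s \<otimes>\<^bsub>Gs s\<^esub> c h s) y"
        unfolding ys(1) uact_ucls ucls_eq_iff
        using ys(2) by (rule eventually_mono) (simp add: Gal_def)
      finally show ?thesis by simp
    qed
    then have "restrict (uact D (\<lambda>s. c g s \<otimes>\<^bsub>Gs s\<^esub> c h s)) EU = g \<otimes>\<^bsub>?G\<^esub> h"
      by (auto simp: Gal_def fun_eq_iff restrict_def)
    then show "restrict (uact D (c (g \<otimes>\<^bsub>?G\<^esub> h))) EU =
        restrict (uact D (\<lambda>s. c g s \<otimes>\<^bsub>Gs s\<^esub> c h s)) EU"
      using c(2)[OF closedG[OF gh]] by simp
  qed
  have mult: "eventually (\<lambda>s. \<forall>g\<in>carrier ?G. \<forall>h\<in>carrier ?G. c (g \<otimes>\<^bsub>?G\<^esub> h) s = c g s \<otimes>\<^bsub>Gs s\<^esub> c h s) D"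
    by (intro eventually_ball_finite[OF finG] ballI mult)
  have "eventually (\<lambda>s. c g s = c h s \<longrightarrow> g = h) D" if gh: "g \<in> carrier ?G" "h \<in> carrier ?G" for g h
  proof (cases "eventually (\<lambda>s. c g s = c h s) D")
    case True
    have "uact D (c g) y = uact D (c h) y" if y: "y \<in> EU" for y
    proof -
      obtain ys where ys: "y = ucls D ys"
        using y by (rule ultraprod_cases)
      show ?thesis
        unfolding ys uact_ucls ucls_eq_iff using True by (rule eventually_mono) simp
    qed
    then have "restrict (uact D (c g)) EU = restrict (uact D (c h)) EU"
      by (rule restrict_ext)
    then show ?thesis
      using c(2)[OF gh(1)] c(2)[OF gh(2)] by simp
  next
    case False
    then have "eventually (\<lambda>s. c g s \<noteq> c h s) D"
      by (simp add: eventually_not_iff)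
    then show ?thesis
      by (rule eventually_mono) simp
  qed
  then have inj: "eventually (\<lambda>s. \<forall>g\<in>carrier ?G. \<forall>h\<in>carrier ?G. c g s = c h s \<longrightarrow> g = h) D"
    by (intro eventually_ball_finite[OF finG] ballI)
  \<comment> \<open>Automorphisms missed by \<open>c\<close> at almost every \<open>s\<close> would
    assemble into an element \<open>?g\<close> of the limit group, and then agree with
    \<open>c ?g\<close> almost everywhere.\<close>
  have surj: "eventually (\<lambda>s. \<forall>\<tau>\<in>carrier (Gs s). \<exists>g\<in>carrier ?G. \<tau> = c g s) D"
  proof (rule ccontr)
    assume "\<not> ?thesis"
    then have "eventually (\<lambda>s. \<not> (\<forall>\<tau>\<in>carrier (Gs s). \<exists>g\<in>carrier ?G. \<tau> = c g s)) D"
      by (simp only: eventually_not_iff not_False_eq_True)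
    then have "eventually (\<lambda>s. \<exists>\<tau>. \<tau> \<in> carrier (Gs s) \<and> (\<forall>g\<in>carrier ?G. \<tau> \<noteq> c g s)) D"
      by (rule eventually_mono) blast
    then obtain \<tau> where "eventually (\<lambda>s. \<tau> s \<in> carrier (Gs s) \<and> (\<forall>g\<in>carrier ?G. \<tau> s \<noteq> c g s)) D"
      by (rule eventually_choice)
    then have \<tau>: "eventually (\<lambda>s. \<tau> s \<in> carrier (Gs s)) D"
      and ne: "eventually (\<lambda>s. \<forall>g\<in>carrier ?G. \<tau> s \<noteq> c g s) D"
      by (simp_all add: eventually_conj_iff)
    let ?g = "restrict (uact D \<tau>) EU"
    have g: "?g \<in> carrier ?G"
      by (rule restrict_uact_in_Gal[OF \<tau>])
    have "eventually (\<lambda>s. \<tau> s = c ?g s) D"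
      by (rule eventually_eq_if_restrict_uact_eq[OF \<tau> c(1)[OF g]]) (simp add: c(2)[OF g])
    then have "eventually (\<lambda>s. False) D"
      using ne by (rule eventually_elim2) (use g in blast)
    then show False
      using D_ne(2) by simp
  qed
  let ?I = "\<lambda>s. (\<forall>g\<in>carrier ?G. c g s \<in> carrier (Gs s)) \<and>
      (\<forall>g\<in>carrier ?G. \<forall>h\<in>carrier ?G. c (g \<otimes>\<^bsub>?G\<^esub> h) s = c g s \<otimes>\<^bsub>Gs s\<^esub> c h s) \<and>
      (\<forall>g\<in>carrier ?G. \<forall>h\<in>carrier ?G. c g s = c h s \<longrightarrow> g = h) \<and>
      (\<forall>\<tau>\<in>carrier (Gs s). \<exists>g\<in>carrier ?G. \<tau> = c g s)"
  have "eventually (\<lambda>s. ?I s) D"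
    using mem mult inj surj by (simp only: eventually_conj_iff)
  then show ?thesis
  proof (rule eventually_mono)
    fix s assume s: "?I s"
    then have "(\<lambda>g. c g s) \<in> hom ?G (Gs s)"
      by (intro homI) simp_all
    moreover have "bij_betw (\<lambda>g. c g s) (carrier ?G) (carrier (Gs s))"
      unfolding bij_betw_def inj_on_def using s by blast
    ultimately have "(\<lambda>g. c g s) \<in> iso ?G (Gs s)"
      by (simp add: iso_def)
    then show "Gs s \<cong> ?G"
      by (rule iso_sym_if_mult_closed) (rule closedG)
  qed
qed

end

section \<open>Rational functions algebraic over bounded coefficients\<close>

text \<open>A generator \<open>g\<close> of the ideal of \<open>p\<close> and \<open>q\<close> is
  cancelled from its own representation; it is nonzero because \<open>q\<close> is.\<close>

lemma (in principal_domain) bezout_coprime: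
  assumes p: "p \<in> carrier R" and q: "q \<in> carrier R" "q \<noteq> \<zero>"
  obtains g p' q' u v where "g \<in> carrier R" "g \<noteq> \<zero>" "p' \<in> carrier R" "q' \<in> carrier R"
    "u \<in> carrier R" "v \<in> carrier R" "p = p' \<otimes> g" "q = q' \<otimes> g" "u \<otimes> p' \<oplus> v \<otimes> q' = \<one>"
proof -
  obtain g where g: "g \<in> carrier R" and I: "PIdl p <+>\<^bsub>R\<^esub> PIdl q = PIdl g"
    using exists_gen[OF add_ideals[OF cgenideal_ideal[OF p] cgenideal_ideal[OF q(1)]]] by blast
  have mem: "x \<otimes> p \<oplus> y \<otimes> q \<in> PIdl g" if "x \<in> carrier R" "y \<in> carrier R" for x y
  proof -
    have "x \<otimes> p \<oplus> y \<otimes> q \<in> PIdl p <+>\<^bsub>R\<^esub> PIdl q"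
      unfolding set_add_def' cgenideal_def using that by blast
    then show ?thesis
      by (simp only: I)
  qed
  have "p \<in> PIdl g" "q \<in> PIdl g"
    using mem[of \<one> \<zero>] mem[of \<zero> \<one>] p q by simp_all
  then obtain p' q' where p': "p' \<in> carrier R" "p = p' \<otimes> g" and q': "q' \<in> carrier R" "q = q' \<otimes> g"
    by (auto simp: cgenideal_def)
  have "g \<in> PIdl p <+>\<^bsub>R\<^esub> PIdl q"
    unfolding I by (rule cgenideal_self[OF g])
  then obtain u v where uv: "u \<in> carrier R" "v \<in> carrier R" "g = u \<otimes> p \<oplus> v \<otimes> q"
    unfolding set_add_def' cgenideal_def by blast
  have g0: "g \<noteq> \<zero>"
    using q q' by auto
  have "(u \<otimes> p' \<oplus> v \<otimes> q') \<otimes> g = u \<otimes> (p' \<otimes> g) \<oplus> v \<otimes> (q' \<otimes> g)"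
    using g p'(1) q'(1) uv(1,2) by algebra
  also have "\<dots> = \<one> \<otimes> g"
    using uv(3) p'(2) q'(2) g by simp
  finally have "u \<otimes> p' \<oplus> v \<otimes> q' = \<one>"
    using m_rcancel[OF g0 g, THEN iffD1] p'(1) q'(1) uv(1,2) by simp
  then show thesis
    using that g g0 p' q' uv by blast
qed

text \<open>Read \<open>x\<close> as the fraction \<open>b / c\<close>: the highest power of
  \<open>x\<close> in \<open>g\<close> has exponent \<open>length g - 1\<close>, so that power of
  \<open>c\<close> clears all denominators.\<close>

lemma (in cring) eval_clear_denominator:
  assumes T: "subring T R" and g: "set g \<subseteq> T" and bc: "b \<in> T" "c \<in> T"
    and x: "x \<in> carrier R" "x \<otimes> c = b"
  shows "c [^] (length g - 1) \<otimes> eval g x \<in> T"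
  using g
proof (induct g)
  case Nil
  then show ?case
    using subringE(1,2)[OF T] bc by auto
next
  case (Cons a g)
  have Tc: "y \<in> carrier R" if "y \<in> T" for y
    using that subringE(1)[OF T] by blast
  have pow: "y [^] (n::nat) \<in> T" if "y \<in> T" for y n
    using that subringE(3,6)[OF T] by (induct n) auto
  have aT: "a \<in> T" and gT: "set g \<subseteq> T"
    using Cons(2) by auto
  have ev: "eval g x \<in> carrier R"
    using gT Tc x(1) by (intro eval_in_carrier) auto
  have "c [^] length g \<otimes> (a \<otimes> x [^] length g) = a \<otimes> (x \<otimes> c) [^] length g"
    using aT bc Tc x(1) nat_pow_distrib[OF x(1) Tc[OF bc(2)], of "length g"]
    by (simp add: m_ac)
  also have "\<dots> \<in> T"
    using aT pow[OF bc(1)] x(2) subringE(6)[OF T] by simp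
  finally have 1: "c [^] length g \<otimes> (a \<otimes> x [^] length g) \<in> T" .
  \<comment> \<open>The induction hypothesis is one power of \<open>c\<close> short, except for
    empty \<open>g\<close>, where the truncated exponent is already zero.\<close>
  have 2: "c [^] length g \<otimes> eval g x \<in> T"
  proof (cases "length g")
    case 0
    then show ?thesis
      using subringE(2)[OF T] by simp
  next
    case (Suc n)
    have "c [^] length g \<otimes> eval g x = c \<otimes> (c [^] (length g - 1) \<otimes> eval g x)"
      using Suc bc Tc ev by (simp add: m_ac)
    then show ?thesis
      using Cons(1)[OF gT] bc(2) subringE(6)[OF T] by simp
  qed
  have "c [^] (length (a # g) - 1) \<otimes> eval (a # g) x =
      c [^] length g \<otimes> (a \<otimes> x [^] length g) \<oplus> c [^] length g \<otimes> eval g x"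
    using aT bc Tc x(1) ev by (simp add: r_distr)
  then show ?case
    using subringE(7)[OF T 1 2] by simp
qed

text \<open>Multiply \<open>a b^n\<close> by \<open>u b + v c = 1\<close>: one summand is divisible
  by \<open>c\<close> through the hypothesis, the other visibly. Thus the powers of \<open>b\<close>
  are removed one at a time.\<close>

lemma (in cring) dvd_if_dvd_mult_pow_coprime:
  assumes T: "subring T R" and abc: "a \<in> T" "b \<in> T" "c \<in> T" "u \<in> T" "v \<in> T"
    and bezout: "u \<otimes> b \<oplus> v \<otimes> c = \<one>"
    and "e \<in> T" "a \<otimes> b [^] (n::nat) = c \<otimes> e"
  shows "\<exists>e'\<in>T. a = c \<otimes> e'"
  using assms(8-)
proof (induct n arbitrary: e)
  case 0
  then have "a = c \<otimes> e"
    using subsetD[OF subringE(1)[OF T] abc(1)] by simp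
  then show ?case
    using 0(1) by blast
next
  case (Suc n)
  have Tc: "y \<in> carrier R" if "y \<in> T" for y
    using that subringE(1)[OF T] by blast
  have pow: "b [^] n \<in> T"
    using abc subringE(3,6)[OF T] by (induct n) auto
  note c = Tc[OF abc(1)] Tc[OF abc(2)] Tc[OF abc(3)] Tc[OF abc(4)] Tc[OF abc(5)] Tc[OF pow] Tc[OF Suc(2)]
  have "a \<otimes> b [^] n = a \<otimes> b [^] n \<otimes> (u \<otimes> b \<oplus> v \<otimes> c)"
    using c by (simp add: bezout)
  also have "\<dots> = u \<otimes> (a \<otimes> (b [^] n \<otimes> b)) \<oplus> c \<otimes> (v \<otimes> (a \<otimes> b [^] n))"
    using c by (simp add: r_distr m_ac)
  also have "a \<otimes> (b [^] n \<otimes> b) = c \<otimes> e"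
    using Suc(3) by simp
  also have "u \<otimes> (c \<otimes> e) \<oplus> c \<otimes> (v \<otimes> (a \<otimes> b [^] n)) = c \<otimes> (u \<otimes> e \<oplus> v \<otimes> (a \<otimes> b [^] n))"
    using c by (simp add: r_distr m_ac)
  finally show ?case
    using Suc(1)[of "u \<otimes> e \<oplus> v \<otimes> (a \<otimes> b [^] n)"] subringE(6,7)[OF T] abc pow Suc(2) by simp
qed

text \<open>After clearing denominators in \<open>g(b / c) = 0\<close>, every term but the leading
  one carries a factor \<open>c\<close>, and every term but the constant one a factor
  \<open>b\<close>. The Bezout identity then removes the powers of the other factor.\<close>

lemma (in domain) rational_root:
  assumes T: "subring T R" and g: "set g \<subseteq> T" "g \<noteq> []"
    and bc: "b \<in> T" "c \<in> T" and uv: "u \<in> T" "v \<in> T" "u \<otimes> b \<oplus> v \<otimes> c = \<one>"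
    and x: "x \<in> carrier R" "x \<otimes> c = b" "eval g x = \<zero>"
  shows "\<exists>e\<in>T. hd g = c \<otimes> e" "\<exists>e\<in>T. last g = b \<otimes> e"
proof -
  have Tc: "y \<in> carrier R" if "y \<in> T" for y
    using that subringE(1)[OF T] by blast
  have cc: "c \<in> carrier R" and bcar: "b \<in> carrier R"
    using Tc bc by auto
  obtain a h where ah: "g = a # h"
    using g(2) by (cases g) auto
  have aT: "a \<in> T" and hT: "set h \<subseteq> T"
    using g(1) ah by auto
  have evh: "eval h x \<in> carrier R"
    using hT Tc x(1) by (intro eval_in_carrier) auto
  have "\<exists>e\<in>T. a \<otimes> b [^] length h = c \<otimes> e"
  proof (cases "length h")
    case 0
    then have "a = \<zero>"
      using x(1,3) aT Tc ah by simp
    then show ?thesis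
      using subringE(2)[OF T] bcar cc by (intro bexI[of _ \<zero>]) simp_all
  next
    case (Suc n)
    let ?w = "c [^] (length h - 1) \<otimes> eval h x"
    have w: "?w \<in> T"
      by (rule eval_clear_denominator[OF T hT bc x(1,2)])
    have "c [^] length h \<otimes> (a \<otimes> x [^] length h) = a \<otimes> (x \<otimes> c) [^] length h"
      using aT bc Tc x(1) nat_pow_distrib[OF x(1) cc, of "length h"] by (simp add: m_ac)
    then have 1: "a \<otimes> b [^] length h = c [^] length h \<otimes> (a \<otimes> x [^] length h)"
      using x(2) by simp
    have "a \<otimes> x [^] length h \<oplus> eval h x = \<zero>"
      using x(3) ah by simp
    then have "a \<otimes> x [^] length h = \<ominus> eval h x"
      using Tc[OF aT] x(1) evh by (simp add: sum_zero_eq_neg)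
    then have "a \<otimes> b [^] length h = c [^] length h \<otimes> (\<ominus> eval h x)"
      using 1 by simp
    also have "\<dots> = c \<otimes> (\<ominus> ?w)"
      using Suc cc evh by (simp add: m_ac r_minus)
    finally show ?thesis
      using subringE(5)[OF T w] by blast
  qed
  then obtain e where e: "e \<in> T" "a \<otimes> b [^] length h = c \<otimes> e"
    by blast
  show "\<exists>e\<in>T. hd g = c \<otimes> e"
    using dvd_if_dvd_mult_pow_coprime[OF T aT bc uv e] ah by simp
  obtain h' a' where ah': "g = h' @ [a']"
    using g(2) by (cases g rule: rev_cases) auto
  have a'T: "a' \<in> T" and h'T: "set h' \<subseteq> T"
    using g(1) ah' by auto
  have evh': "eval h' x \<in> carrier R"
    using h'T Tc x(1) by (intro eval_in_carrier) auto
  let ?w = "c [^] (length h' - 1) \<otimes> eval h' x"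
  have w: "?w \<in> T"
    by (rule eval_clear_denominator[OF T h'T bc x(1,2)])
  have h'c: "set h' \<subseteq> carrier R"
    using h'T Tc by blast
  have "eval h' x \<otimes> x \<oplus> a' = \<zero>"
    using x(3) eval_append_aux[OF h'c Tc[OF a'T] x(1)] ah' by simp
  then have "a' \<oplus> eval h' x \<otimes> x = \<zero>"
    using evh' x(1) Tc[OF a'T] by (simp add: a_comm)
  then have a'eq: "a' = \<ominus> (eval h' x \<otimes> x)"
    using evh' x(1) Tc[OF a'T] by (simp add: sum_zero_eq_neg)
  have "\<exists>e\<in>T. a' \<otimes> c [^] length h' = b \<otimes> e"
  proof (cases "length h'")
    case 0
    then have "a' = \<zero>"
      using a'eq x(1) by simp
    then show ?thesis
      using subringE(2)[OF T] bcar cc by (intro bexI[of _ \<zero>]) simp_all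
  next
    case (Suc n)
    have "a' \<otimes> c [^] length h' = (x \<otimes> c) \<otimes> (\<ominus> ?w)"
      unfolding a'eq using Suc cc evh' x(1) by (simp add: m_ac r_minus l_minus)
    then show ?thesis
      using x(2) subringE(5)[OF T w] by auto
  qed
  then obtain e' where e': "e' \<in> T" "a' \<otimes> c [^] length h' = b \<otimes> e'"
    by blast
  \<comment> \<open>The coprimality argument again, with numerator and denominator
    exchanged.\<close>
  have "v \<otimes> c \<oplus> u \<otimes> b = \<one>"
    using uv Tc bc by (simp add: a_comm)
  then show "\<exists>e\<in>T. last g = b \<otimes> e"
    using dvd_if_dvd_mult_pow_coprime[OF T a'T bc(2,1) uv(2,1) _ e'] ah' by simp
qed

section \<open>Fractions of polynomials in one element\<close>

lemma (in field) generate_field_insert_eq_fractions: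
  assumes K: "subfield K R" and t: "t \<in> carrier R" and y: "y \<in> generate_field R (insert t K)"
  obtains p q where "p \<in> carrier (K[X])" "q \<in> carrier (K[X])" "eval q t \<noteq> \<zero>" "y \<otimes> eval q t = eval p t"
proof -
  note Ks = subfieldE(1)[OF K]
  interpret ev: ring_hom_ring "K[X]" R "\<lambda>p. eval p t"
    by (rule eval_ring_hom[OF Ks t])
  note closed = ev.hom_closed
  define Q where "Q y \<longleftrightarrow> y \<in> carrier R \<and>
    (\<exists>p\<in>carrier (K[X]). \<exists>q\<in>carrier (K[X]). eval q t \<noteq> \<zero> \<and> y \<otimes> eval q t = eval p t)" for y
  have QI: "Q y" if "y \<in> carrier R" "p \<in> carrier (K[X])" "q \<in> carrier (K[X])" "eval q t \<noteq> \<zero>"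
    "y \<otimes> eval q t = eval p t" for y p q
    using that by (auto simp: Q_def)
  have onep: "\<one>\<^bsub>K[X]\<^esub> \<in> carrier (K[X])" "eval \<one>\<^bsub>K[X]\<^esub> t = \<one>"
    using ev.R.one_closed ev.hom_one by auto
  have int: "eval p t \<otimes> eval q t \<noteq> \<zero>" if "p \<in> carrier (K[X])" "q \<in> carrier (K[X])" "eval p t \<noteq> \<zero>" "eval q t \<noteq> \<zero>" for p q
    using that closed integral by blast
  have "Q y"
    using y
  proof (induct rule: generate_field.induct)
    case one
    show ?case
      by (rule QI[OF one_closed onep(1) onep(1)]) (use onep in simp_all)
  next
    case (incl h)
    show ?case
    proof (cases "h = t")
      case True
      show ?thesis
        by (rule QI[OF _ var_closed(1)[OF Ks] onep(1)]) (use True t onep eval_var in simp_all)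
    next
      case False
      then have h: "h \<in> K" "h \<in> carrier R"
        using incl subfieldE(3)[OF K] by auto
      show ?thesis
      proof (cases "h = \<zero>")
        case True
        show ?thesis
          by (rule QI[OF _ ev.R.zero_closed onep(1)]) (use True onep in simp_all)
      next
        case False
        then have "[h] \<in> carrier (K[X])"
          using h by (auto simp: univ_poly_def polynomial_def)
        then show ?thesis
          by (rule QI[OF h(2) _ onep(1)]) (use h onep t in simp_all)
      qed
    qed
  next
    case (a_inv h)
    then obtain p q where pq: "h \<in> carrier R" "p \<in> carrier (K[X])" "q \<in> carrier (K[X])" "eval q t \<noteq> \<zero>"
      "h \<otimes> eval q t = eval p t"
      by (auto simp: Q_def)
    show ?case
      by (rule QI[of _ "\<ominus>\<^bsub>K[X]\<^esub> p" q]) (use pq closed[OF pq(3)] in \<open>simp_all add: l_minus\<close>)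
  next
    case (m_inv h)
    then obtain p q where pq: "h \<in> carrier R" "p \<in> carrier (K[X])" "q \<in> carrier (K[X])" "eval q t \<noteq> \<zero>"
      "h \<otimes> eval q t = eval p t"
      by (auto simp: Q_def)
    have u: "inv h \<in> carrier R" "inv h \<otimes> h = \<one>"
      using pq(1) m_inv(3) field_Units by auto
    have "inv h \<otimes> eval p t = eval q t"
      using pq(5)[symmetric] pq(1) u closed[OF pq(3)] by (simp add: m_assoc[symmetric])
    moreover have "eval p t \<noteq> \<zero>"
      using calculation pq(4) u by auto
    ultimately show ?case
      using QI[OF u(1) pq(3,2)] by simp
  next
    case (eng_add h k)
    then obtain p q p' q' where pq: "h \<in> carrier R" "p \<in> carrier (K[X])" "q \<in> carrier (K[X])" "eval q t \<noteq> \<zero>"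
      "h \<otimes> eval q t = eval p t" and pq': "k \<in> carrier R" "p' \<in> carrier (K[X])" "q' \<in> carrier (K[X])"
      "eval q' t \<noteq> \<zero>" "k \<otimes> eval q' t = eval p' t"
      by (auto simp: Q_def)
    have "(h \<oplus> k) \<otimes> (eval q t \<otimes> eval q' t) = (h \<otimes> eval q t) \<otimes> eval q' t \<oplus> eval q t \<otimes> (k \<otimes> eval q' t)"
      using pq(1) pq'(1) closed[OF pq(3)] closed[OF pq'(3)] by algebra
    then show ?case
      using int[OF pq(3) pq'(3) pq(4) pq'(4)] pq pq'
      by (intro QI[of _ "p \<otimes>\<^bsub>K[X]\<^esub> q' \<oplus>\<^bsub>K[X]\<^esub> q \<otimes>\<^bsub>K[X]\<^esub> p'" "q \<otimes>\<^bsub>K[X]\<^esub> q'"]) simp_all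
  next
    case (eng_mult h k)
    then obtain p q p' q' where pq: "h \<in> carrier R" "p \<in> carrier (K[X])" "q \<in> carrier (K[X])" "eval q t \<noteq> \<zero>"
      "h \<otimes> eval q t = eval p t" and pq': "k \<in> carrier R" "p' \<in> carrier (K[X])" "q' \<in> carrier (K[X])"
      "eval q' t \<noteq> \<zero>" "k \<otimes> eval q' t = eval p' t"
      by (auto simp: Q_def)
    have "(h \<otimes> k) \<otimes> (eval q t \<otimes> eval q' t) = (h \<otimes> eval q t) \<otimes> (k \<otimes> eval q' t)"
      using pq(1) pq'(1) closed[OF pq(3)] closed[OF pq'(3)] by algebra
    then show ?case
      using int[OF pq(3) pq'(3) pq(4) pq'(4)] pq pq'
      by (intro QI[of _ "p \<otimes>\<^bsub>K[X]\<^esub> p'" "q \<otimes>\<^bsub>K[X]\<^esub> q'"]) simp_all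
  qed
  then show thesis
    using that by (auto simp: Q_def)
qed

lemma (in field) fractionI:
  assumes K: "subfield K R" and t: "t \<in> carrier R" and y: "y \<in> carrier R"
    and pq: "p \<in> carrier (K[X])" "q \<in> carrier (K[X])" "eval q t \<noteq> \<zero>" "y \<otimes> eval q t = eval p t"
  shows "y \<in> generate_field R (insert t K)"
proof -
  have c: "insert t K \<subseteq> carrier R"
    using t subfieldE(3)[OF K] by auto
  note F = generate_field_is_subfield[OF c]
  have ev: "eval p t \<in> generate_field R (insert t K)" if "p \<in> carrier (K[X])" for p
    using that by (intro eval_in_subring[OF subfieldE(1)[OF F]])
      (auto simp: univ_poly_def polynomial_def intro: generate_field.incl)
  have "eval q t \<otimes> y \<in> generate_field R (insert t K)"
    using ev[OF pq(1)] pq(4) y subfieldE(3)[OF F] ev[OF pq(2)] m_comm by (metis subsetD)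
  then show ?thesis
    using subfield_m_inv_simprule[OF F, of "eval q t" y] ev[OF pq(2)] pq(3) y by simp
qed

text \<open>Turns a polynomial over \<open>K(t)\<close> into one with coefficients in
  \<open>K[t]\<close>, as the rational root theorem requires. The lengths of the new coefficients
  are the source of the uniform degree bounds.\<close>

lemma (in field) common_denominator:
  assumes K: "subfield K R" and t: "t \<in> carrier R"
    and g: "set g \<subseteq> generate_field R (insert t K)"
  obtains Ps q where "q \<in> carrier (K[X])" "eval q t \<noteq> \<zero>" "set Ps \<subseteq> carrier (K[X])"
    "map (\<lambda>P. eval P t) Ps = map (\<lambda>a. a \<otimes> eval q t) g"
proof -
  note Ks = subfieldE(1)[OF K]
  interpret ev: ring_hom_ring "K[X]" R "\<lambda>p. eval p t"
    by (rule eval_ring_hom[OF Ks t])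
  have c: "insert t K \<subseteq> carrier R"
    using t subfieldE(3)[OF K] by auto
  have "\<exists>Ps. \<exists>q\<in>carrier (K[X]). eval q t \<noteq> \<zero> \<and> set Ps \<subseteq> carrier (K[X]) \<and>
      map (\<lambda>P. eval P t) Ps = map (\<lambda>a. a \<otimes> eval q t) g"
    using g
  proof (induct g)
    case Nil
    show ?case
      by (intro exI[of _ "[]"] bexI[of _ "\<one>\<^bsub>K[X]\<^esub>"]) simp_all
  next
    case (Cons a g)
    then obtain Ps q where q: "q \<in> carrier (K[X])" "eval q t \<noteq> \<zero>" "set Ps \<subseteq> carrier (K[X])"
      "map (\<lambda>P. eval P t) Ps = map (\<lambda>a. a \<otimes> eval q t) g"
      by auto
    have "a \<in> generate_field R (insert t K)"
      using Cons by simp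
    then obtain p' q' where p': "p' \<in> carrier (K[X])" "q' \<in> carrier (K[X])" "eval q' t \<noteq> \<zero>"
      "a \<otimes> eval q' t = eval p' t"
      by (rule generate_field_insert_eq_fractions[OF K t])
    have gc: "set (a # g) \<subseteq> carrier R"
      using Cons(2) generate_field_incl[OF c] by blast
    let ?Ps = "(p' \<otimes>\<^bsub>K[X]\<^esub> q) # map (\<lambda>P. P \<otimes>\<^bsub>K[X]\<^esub> q') Ps" and ?q = "q \<otimes>\<^bsub>K[X]\<^esub> q'"
    have "map (\<lambda>P. eval P t) (map (\<lambda>P. P \<otimes>\<^bsub>K[X]\<^esub> q') Ps) = map (\<lambda>y. y \<otimes> eval q' t) (map (\<lambda>P. eval P t) Ps)"
      using q(3) p'(2) by auto
    also have "\<dots> = map (\<lambda>a. a \<otimes> eval ?q t) g"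
      using gc q(1) p'(2) ev.hom_closed unfolding q(4) by (auto simp: m_assoc)
    moreover have "eval (p' \<otimes>\<^bsub>K[X]\<^esub> q) t = a \<otimes> eval ?q t"
      using p' q(1) gc ev.hom_closed[OF q(1)] ev.hom_closed[OF p'(2)]
      by (simp add: p'(4)[symmetric] m_ac)
    moreover have "eval ?q t \<noteq> \<zero>"
      using q(1,2) p'(2,3) ev.hom_closed integral by (metis ev.hom_mult)
    ultimately show ?case
      using q p' by (intro exI[of _ ?Ps] bexI[of _ ?q]) auto
  qed
  then show thesis
    using that by blast
qed

text \<open>Numerator and denominator of a root divide the constant and the leading coefficient; hence
  the degree of the root is bounded by those of the coefficients, independently of the field.\<close>
lemma (in field) root_degree_bound:
  assumes K: "subfield K R" and t: "t \<in> carrier R" "(transcendental over K) t"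
    and y: "y \<in> generate_field R (insert t K)"
    and Ps: "set Ps \<subseteq> carrier (K[X])" "Ps \<noteq> []" "hd Ps \<noteq> []" "last Ps \<noteq> []"
    and root: "eval (map (\<lambda>P. eval P t) Ps) y = \<zero>"
  obtains p q where "p \<in> carrier (K[X])" "q \<in> carrier (K[X])" "q \<noteq> []"
    "length p \<le> length (last Ps)" "length q \<le> length (hd Ps)" "y \<otimes> eval q t = eval p t"
proof -
  note Ks = subfieldE(1)[OF K]
  interpret ev: ring_hom_ring "K[X]" R "\<lambda>p. eval p t"
    by (rule eval_ring_hom[OF Ks t(1)])
  interpret UP: principal_domain "K[X]"
    by (rule univ_poly_is_principal[OF K])
  have inj: "inj_on (\<lambda>p. eval p t) (carrier (K[X]))"
    using t(2) by (simp add: transcendental_def over_def)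
  let ?T = "simple_extension K t"
  have T: "subring ?T R"
    by (rule simple_extension_is_subring[OF Ks t(1)])
  have img: "?T = (\<lambda>p. eval p t) ` carrier (K[X])"
    by (rule simple_extension_as_eval_img[OF subfieldE(3)[OF K] t(1)])
  have yc: "y \<in> carrier R"
    using y generate_field_incl[of "insert t K"] t(1) subfieldE(3)[OF K] by blast
  obtain p0 q0 where p0: "p0 \<in> carrier (K[X])" "q0 \<in> carrier (K[X])" "eval q0 t \<noteq> \<zero>" "y \<otimes> eval q0 t = eval p0 t"
    using generate_field_insert_eq_fractions[OF K t(1) y] by blast
  have "q0 \<noteq> \<zero>\<^bsub>K[X]\<^esub>"
    using p0(3) by (auto simp: univ_poly_zero)
  then obtain g p q u v where g: "g \<in> carrier (K[X])" "g \<noteq> \<zero>\<^bsub>K[X]\<^esub>" and pq: "p \<in> carrier (K[X])" "q \<in> carrier (K[X])"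
    and uv: "u \<in> carrier (K[X])" "v \<in> carrier (K[X])" and eq: "p0 = p \<otimes>\<^bsub>K[X]\<^esub> g" "q0 = q \<otimes>\<^bsub>K[X]\<^esub> g"
    and bez: "u \<otimes>\<^bsub>K[X]\<^esub> p \<oplus>\<^bsub>K[X]\<^esub> v \<otimes>\<^bsub>K[X]\<^esub> q = \<one>\<^bsub>K[X]\<^esub>"
    using UP.bezout_coprime[OF p0(1,2)] by metis
  have evg: "eval g t \<noteq> \<zero>" and evq: "eval q t \<noteq> \<zero>"
    using p0(3) ev.hom_closed[OF g(1)] ev.hom_closed[OF pq(2)] by (auto simp: eq(2) pq g)
  have "(y \<otimes> eval q t) \<otimes> eval g t = eval p t \<otimes> eval g t"
    using p0(4) pq g yc ev.hom_closed by (simp add: eq m_assoc)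
  then have yq: "y \<otimes> eval q t = eval p t"
    using m_rcancel[OF evg ev.hom_closed[OF g(1)]] yc pq ev.hom_closed by simp
  have "eval u t \<otimes> eval p t \<oplus> eval v t \<otimes> eval q t = \<one>"
    using arg_cong[OF bez, of "\<lambda>p. eval p t"] uv pq by simp
  moreover have "set (map (\<lambda>P. eval P t) Ps) \<subseteq> ?T"
    using Ps(1) by (auto simp: img)
  moreover have "eval p t \<in> ?T" "eval q t \<in> ?T" "eval u t \<in> ?T" "eval v t \<in> ?T"
    using pq uv by (auto simp: img)
  ultimately have div: "\<exists>e\<in>?T. hd (map (\<lambda>P. eval P t) Ps) = eval q t \<otimes> e"
    "\<exists>e\<in>?T. last (map (\<lambda>P. eval P t) Ps) = eval p t \<otimes> e"
    using rational_root[OF T, of "map (\<lambda>P. eval P t) Ps" "eval p t" "eval q t" "eval u t" "eval v t" y]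
      Ps(2) yc yq root by blast+
  \<comment> \<open>Transcendence of \<open>t\<close> turns divisibility of values into divisibility
    of polynomials, which compares degrees.\<close>
  have bound: "length a \<le> length b"
    if e: "e \<in> ?T" "eval b t = eval a t \<otimes> e" and ab: "a \<in> carrier (K[X])" "b \<in> carrier (K[X])" "b \<noteq> []" for a b e
  proof -
    obtain r where r: "r \<in> carrier (K[X])" "e = eval r t"
      using e(1) by (auto simp: img)
    then have "eval b t = eval (a \<otimes>\<^bsub>K[X]\<^esub> r) t"
      using e(2) ab by simp
    then have "b = a \<otimes>\<^bsub>K[X]\<^esub> r"
      using inj_onD[OF inj] ab r by blast
    then have "a divides\<^bsub>K[X]\<^esub> b"
      using r(1) by (auto simp: factor_def)
    then have "degree a \<le> degree b"
      using pdivides_imp_degree_le[OF Ks ab] pdivides_iff_shell[OF K ab(1,2)] by blast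
    moreover have "length b > 0"
      using ab(3) by simp
    ultimately show ?thesis by linarith
  qed
  have hl: "hd Ps \<in> carrier (K[X])" "last Ps \<in> carrier (K[X])"
    using Ps(1,2) by auto
  have "length q \<le> length (hd Ps)"
    using div(1) bound[OF _ _ pq(2) hl(1) Ps(3)] Ps(2) by (auto simp: hd_map)
  moreover have "length p \<le> length (last Ps)"
    using div(2) bound[OF _ _ pq(1) hl(2) Ps(4)] Ps(2) by (auto simp: last_map)
  moreover have "q \<noteq> []"
    using evq by auto
  ultimately show thesis
    using that pq yq by blast
qed

text \<open>The powers of \<open>t\<close> are pairwise distinct, even when \<open>K\<close> is
  finite.\<close>

lemma (in field) infinite_generate_field_transcendental:
  assumes K: "subfield K R" and t: "t \<in> carrier R" "(transcendental over K) t"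
  shows "infinite (generate_field R (insert t K))"
proof
  assume fin: "finite (generate_field R (insert t K))"
  note Ks = subfieldE(1)[OF K]
  have inj: "inj_on (\<lambda>p. eval p t) (carrier (K[X]))"
    using t(2) by (simp add: transcendental_def over_def)
  have m: "monom \<one> n \<in> carrier (K[X])" for n
    using monom_is_polynomial[OF Ks, of \<one> n] subringE(3)[OF Ks] by (simp add: univ_poly_carrier)
  have "inj (\<lambda>n. eval (monom \<one> n) t)"
  proof (rule injI)
    fix n k assume "eval (monom \<one> n) t = eval (monom \<one> k) t"
    then have "monom \<one> n = monom \<one> k"
      using inj_onD[OF inj] m by blast
    then have "length (monom \<one> n) = length (monom \<one> k)"
      by simp
    then show "n = k"
      by (simp add: monom_def)
  qed
  moreover have "range (\<lambda>n. eval (monom \<one> n) t) \<subseteq> generate_field R (insert t K)"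
  proof clarify
    fix n
    have c: "insert t K \<subseteq> carrier R"
      using t(1) subfieldE(3)[OF K] by auto
    have "set (monom \<one> n) \<subseteq> generate_field R (insert t K)"
      using m[of n] by (auto simp: univ_poly_def polynomial_def intro: generate_field.incl)
    then show "eval (monom \<one> n) t \<in> generate_field R (insert t K)"
      by (intro eval_in_subring[OF subfieldE(1)[OF generate_field_is_subfield[OF c]]])
        (auto intro: generate_field.incl)
  qed
  ultimately show False
    using fin by (metis finite_subset infinite_UNIV_nat finite_imageD)
qed

section \<open>Ultraproducts of rational function fields\<close>

lemma (in cring) eval_map_mult_right:
  assumes "set h \<subseteq> carrier R" "c \<in> carrier R" "y \<in> carrier R"
  shows "eval (map (\<lambda>a. a \<otimes> c) h) y = eval h y \<otimes> c"
  using assms(1)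
proof (induct h)
  case (Cons b h)
  then have "b \<in> carrier R" "eval h y \<in> carrier R"
    using eval_in_carrier[of h y] assms by auto
  moreover have "b \<otimes> c \<otimes> y [^] length h = b \<otimes> y [^] length h \<otimes> c"
    using Cons assms by (simp add: m_ac)
  ultimately show ?case
    using Cons assms by (simp add: l_distr)
qed (use assms in simp)

locale function_field_ultraproduct = ultraproduct D Om for D :: "'s filter" and Om :: "'s \<Rightarrow> 'a ring" +
  fixes Fs :: "'s \<Rightarrow> 'a set" and ts :: "'s \<Rightarrow> 'a"
  assumes Fs_subfield: "subfield (Fs s) (Om s)"
    and ts_carrier: "ts s \<in> carrier (Om s)"
    and ts_transcendental: "ring.transcendental (Om s) (Fs s) (ts s)"
begin

interpretation Om: algebraically_closed "Om s" for s
  by (rule algebraically_closed_Om)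

interpretation U: algebraically_closed U
  by (rule U_algebraically_closed)

abbreviation "FF s \<equiv> generate_field (Om s) (insert (ts s) (Fs s))"
abbreviation "K \<equiv> ultraprod D Fs"
abbreviation "t \<equiv> ucls D ts"
abbreviation "polys s \<equiv> carrier ((Fs s)[X]\<^bsub>Om s\<^esub>)"
abbreviation "KX \<equiv> carrier (K[X]\<^bsub>U\<^esub>)"
abbreviation "UF \<equiv> ultraprod D FF"
abbreviation "F \<equiv> generate_field U (insert t K)"

lemma FF_subfield: "subfield (FF s) (Om s)"
  using Om.generate_field_is_subfield[of "insert (ts s) (Fs s)" s] ts_carrier subfieldE(3)[OF Fs_subfield] by blast

lemma K_subfield: "subfield K U"
  by (rule subfield_ultraprod) (simp add: Fs_subfield)

lemma UF_subfield: "subfield UF U"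
  by (rule subfield_ultraprod) (simp add: FF_subfield)

lemma t_carrier: "t \<in> carrier U"
  by (rule ucls_carrier) (rule ts_carrier)

lemma tK_carrier: "insert t K \<subseteq> carrier U"
  using t_carrier subfieldE(3)[OF K_subfield] by blast

lemma F_subfield: "subfield F U"
  by (rule U.generate_field_is_subfield[OF tK_carrier])

lemma F_subset_UF: "F \<subseteq> UF"
proof (rule U.generate_field_min_subfield1[OF tK_carrier UF_subfield])
  have "K \<subseteq> UF"
    by (rule ultraprod_mono) (auto intro!: always_eventually generate_field.incl)
  moreover have "t \<in> UF"
    by (auto intro!: always_eventually generate_field.incl)
  ultimately show "insert t K \<subseteq> UF" by blast
qed

text \<open>A relation for \<open>t\<close> over \<open>K\<close> becomes one for
  \<open>ts s\<close> over \<open>Fs s\<close> almost everywhere, hence is empty there. Coordinates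
  keep the length of \<open>p\<close>, so one such \<open>s\<close> suffices.\<close>

lemma eval_t_eq_zero_imp:
  assumes p: "p \<in> KX" and "U.eval p t = \<zero>\<^bsub>U\<^esub>"
  shows "p = []"
proof -
  have pc: "set p \<subseteq> carrier U"
    using p subfieldE(3)[OF K_subfield] by (auto simp: univ_poly_def polynomial_def)
  have "eventually (\<lambda>s. Om.eval s (coords p s) (ts s) = \<zero>\<^bsub>Om s\<^esub>) D"
    using assms(2) by (simp only: eventually_eval_coords[OF pc])
  with eventually_coords_poly[OF p] have "eventually (\<lambda>s. p = []) D"
  proof (rule eventually_elim2)
    fix s assume "coords p s \<in> polys s" "Om.eval s (coords p s) (ts s) = \<zero>\<^bsub>Om s\<^esub>"
    then have "coords p s = []"
      using Om.eval_transcendental[where K = "Fs s" and x = "ts s"] ts_transcendental[of s] by (simp add: over_def)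
    then show "p = []"
      by (metis length_0_conv length_coords)
  qed
  then show ?thesis
    using D_ne by (cases "p = []") simp_all
qed

lemma t_transcendental: "(U.transcendental over K) t"
proof (rule U.trivial_ker_imp_transcendental[OF subfieldE(1)[OF K_subfield] t_carrier])
  show "a_kernel (K[X]\<^bsub>U\<^esub>) U (\<lambda>p. U.eval p t) = {[]}"
    using eval_t_eq_zero_imp by (auto simp: a_kernel_def' univ_poly_zero_closed)
qed

lemma infinite_F: "infinite F"
  by (rule U.infinite_generate_field_transcendental[OF K_subfield t_carrier t_transcendental])

lemma eventually_root_coords:
  assumes Ps: "set Ps \<subseteq> KX"
    and root: "U.eval (map (\<lambda>P. U.eval P t) Ps) (ucls D ys) = \<zero>\<^bsub>U\<^esub>"
  shows "eventually (\<lambda>s. Om.eval s (map (\<lambda>P. Om.eval s (coords P s) (ts s)) Ps) (ys s) = \<zero>\<^bsub>Om s\<^esub>) D"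
proof -
  have Pc: "set P \<subseteq> carrier U" if "P \<in> set Ps" for P
    using that Ps subfieldE(3)[OF K_subfield] by (force simp: univ_poly_def polynomial_def)
  have "eventually (\<lambda>s. \<forall>P\<in>set Ps. urep D (U.eval P t) s = Om.eval s (coords P s) (ts s)) D"
    by (rule eventually_ball_finite) (simp_all add: eval_coords[OF Pc] eventually_urep_ucls)
  moreover have "eventually (\<lambda>s. Om.eval s (coords (map (\<lambda>P. U.eval P t) Ps) s) (ys s) = \<zero>\<^bsub>Om s\<^esub>) D"
  proof -
    have "set (map (\<lambda>P. U.eval P t) Ps) \<subseteq> carrier U"
      using U.eval_in_carrier[OF Pc t_carrier] by auto
    then show ?thesis
      using root by (simp only: eventually_eval_coords)
  qed
  ultimately show ?thesis
  proof (rule eventually_elim2)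
    fix s assume "\<forall>P\<in>set Ps. urep D (U.eval P t) s = Om.eval s (coords P s) (ts s)"
    then have "coords (map (\<lambda>P. U.eval P t) Ps) s = map (\<lambda>P. Om.eval s (coords P s) (ts s)) Ps"
      by (simp add: coords_def)
    then show "Om.eval s (map (\<lambda>P. Om.eval s (coords P s) (ts s)) Ps) (ys s) = \<zero>\<^bsub>Om s\<^esub>"
      if "Om.eval s (coords (map (\<lambda>P. U.eval P t) Ps) s) (ys s) = \<zero>\<^bsub>Om s\<^esub>"
      using that by simp
  qed
qed

text \<open>The lengths of the cleared coefficients \<open>Ps\<close> of the minimal polynomial are
  the same in all coordinates, so \<open>root_degree_bound\<close> represents almost every
  \<open>ys s\<close> by a fraction of bounded length. The limits of numerators and denominators
  exhibit \<open>y\<close> as a fraction over \<open>K\<close>.\<close>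

lemma relatively_closed:
  assumes y: "y \<in> UF" and alg: "(U.algebraic over F) y"
  shows "y \<in> F"
proof (cases "y = \<zero>\<^bsub>U\<^esub>")
  case True
  then show ?thesis
    using subringE(2)[OF subfieldE(1)[OF F_subfield]] by blast
next
  case False
  have yc: "y \<in> carrier U"
    using y subfieldE(3)[OF UF_subfield] by blast
  define g where "g = U.Irr F y"
  note G = U.IrrE[OF F_subfield yc alg, folded g_def] and G' = U.Irr_facts[OF F_subfield yc alg, folded g_def]
  have gc: "set g \<subseteq> carrier U"
    using G'(3) subfieldE(3)[OF F_subfield] by blast
  obtain g' a where ga: "g = g' @ [a]"
    using G'(2) by (cases g rule: rev_cases) auto
  \<comment> \<open>The constant coefficient is to bound the numerator, so it must not vanish.
    Otherwise the nonzero \<open>y\<close> would be a root of \<open>g'\<close>, whose degree is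
    smaller than that of \<open>g\<close>.\<close>
  have a0: "a \<noteq> \<zero>\<^bsub>U\<^esub>"
  proof
    assume a: "a = \<zero>\<^bsub>U\<^esub>"
    have g'0: "g' \<noteq> []"
      using G'(4) ga by auto
    then have g'F: "g' \<in> carrier (F[X]\<^bsub>U\<^esub>)"
      using G(1) G(3) ga by (auto simp: univ_poly_def polynomial_def)
    have g'c: "set g' \<subseteq> carrier U"
      using gc ga by simp
    have "U.eval g' y \<otimes>\<^bsub>U\<^esub> y = \<zero>\<^bsub>U\<^esub>"
      using U.eval_append_aux[OF g'c _ yc, of a] G(4) ga a U.eval_in_carrier[OF g'c yc] yc
      by (simp del: U_simps)
    then have "U.eval g' y = \<zero>\<^bsub>U\<^esub>"
      using False U.integral[OF _ U.eval_in_carrier[OF g'c yc] yc] by blast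
    then have "g pdivides\<^bsub>U\<^esub> g'"
      using U.Irr_minimal[OF F_subfield yc alg g'F] by (simp add: g_def)
    then have "degree g \<le> degree g'"
      using U.pdivides_imp_degree_le[OF subfieldE(1)[OF F_subfield] G(1) g'F g'0] by blast
    then show False
      using ga g'0 by (cases g') auto
  qed
  obtain Ps q where q: "q \<in> KX" "U.eval q t \<noteq> \<zero>\<^bsub>U\<^esub>" "set Ps \<subseteq> KX"
    and Ps: "map (\<lambda>P. U.eval P t) Ps = map (\<lambda>a. a \<otimes>\<^bsub>U\<^esub> U.eval q t) g"
    by (rule U.common_denominator[OF K_subfield t_carrier G'(3)])
  define c where "c = U.eval q t"
  have cc: "c \<in> carrier U"
    unfolding c_def using q(1) subfieldE(3)[OF K_subfield]
    by (intro U.eval_in_carrier t_carrier) (auto simp: univ_poly_def polynomial_def)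
  have root: "U.eval (map (\<lambda>P. U.eval P t) Ps) y = \<zero>\<^bsub>U\<^esub>"
    using U.eval_map_mult_right[OF gc cc yc] G(4) cc unfolding Ps c_def[symmetric] by (simp del: U_simps)
  have Ps0: "Ps \<noteq> []"
    using Ps G'(2) by auto
  have nil: "U.eval [] t = \<zero>\<^bsub>U\<^esub>"
    by (simp only: U.eval.simps)
  have "U.eval (hd Ps) t = hd (map (\<lambda>P. U.eval P t) Ps)"
    by (simp only: hd_map[OF Ps0])
  also have "\<dots> = hd g \<otimes>\<^bsub>U\<^esub> c"
    unfolding Ps c_def by (simp only: hd_map[OF G'(2)])
  also have "\<dots> = c"
    by (simp only: G(3) U.l_one[OF cc])
  finally have hd0: "hd Ps \<noteq> []"
    using q(2) nil c_def by metis
  have aU: "a \<in> carrier U"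
    using gc ga by simp
  have "U.eval (last Ps) t = last (map (\<lambda>P. U.eval P t) Ps)"
    by (simp only: last_map[OF Ps0])
  also have "\<dots> = last g \<otimes>\<^bsub>U\<^esub> c"
    unfolding Ps c_def by (simp only: last_map[OF G'(2)])
  also have "last g = a"
    using ga by simp
  finally have "U.eval (last Ps) t = a \<otimes>\<^bsub>U\<^esub> c" .
  moreover have "a \<otimes>\<^bsub>U\<^esub> c \<noteq> \<zero>\<^bsub>U\<^esub>"
    using U.integral[OF _ aU cc] a0 q(2) unfolding c_def by blast
  ultimately have last0: "last Ps \<noteq> []"
    using nil by metis
  obtain ys where ys: "y = ucls D ys" "eventually (\<lambda>s. ys s \<in> FF s) D"
    using y by (rule ultraprod_cases)
  let ?B = "\<lambda>s p q. p \<in> polys s \<and> q \<in> polys s \<and> q \<noteq> [] \<and>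
      length p \<le> length (last Ps) \<and> length q \<le> length (hd Ps) \<and>
      ys s \<otimes>\<^bsub>Om s\<^esub> Om.eval s q (ts s) = Om.eval s p (ts s)"
  have "eventually (\<lambda>s. \<forall>P\<in>set Ps. coords P s \<in> polys s) D"
    by (rule eventually_ball_finite) (use q(3) eventually_coords_poly in auto)
  then have "eventually (\<lambda>s. (\<forall>P\<in>set Ps. coords P s \<in> polys s) \<and> ys s \<in> FF s) D"
    using ys(2) by (simp add: eventually_conj_iff)
  with eventually_root_coords[OF q(3) root[unfolded ys(1)]]
  have "eventually (\<lambda>s. \<exists>pq. ?B s (fst pq) (snd pq)) D"
  proof (rule eventually_elim2)
    fix s assume r: "Om.eval s (map (\<lambda>P. Om.eval s (coords P s) (ts s)) Ps) (ys s) = \<zero>\<^bsub>Om s\<^esub>"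
      and P: "(\<forall>P\<in>set Ps. coords P s \<in> polys s) \<and> ys s \<in> FF s"
    let ?Ps = "map (\<lambda>P. coords P s) Ps"
    have hl: "hd ?Ps \<noteq> []" "last ?Ps \<noteq> []" "length (hd ?Ps) = length (hd Ps)"
      "length (last ?Ps) = length (last Ps)" and ne: "?Ps \<noteq> []"
      using Ps0 hd0 last0 by (auto simp: hd_map last_map coords_def)
    have tr: "(Om.transcendental s over (Fs s)) (ts s)"
      using ts_transcendental by (simp add: over_def)
    have set_Ps: "set ?Ps \<subseteq> polys s" and yF: "ys s \<in> FF s"
      using P by auto
    have root_s: "Om.eval s (map (\<lambda>P. Om.eval s P (ts s)) ?Ps) (ys s) = \<zero>\<^bsub>Om s\<^esub>"
      using r by (simp add: comp_def)
    obtain p q where "p \<in> polys s" "q \<in> polys s"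
      "q \<noteq> []" "length p \<le> length (last ?Ps)" "length q \<le> length (hd ?Ps)"
      "ys s \<otimes>\<^bsub>Om s\<^esub> Om.eval s q (ts s) = Om.eval s p (ts s)"
      by (rule Om.root_degree_bound[OF Fs_subfield ts_carrier tr yF set_Ps ne hl(1,2) root_s])
    then show "\<exists>pq. ?B s (fst pq) (snd pq)"
      using hl(3,4) by (intro exI[of _ "(p, q)"]) simp
  qed
  then obtain pq where pq: "eventually (\<lambda>s. ?B s (fst (pq s)) (snd (pq s))) D"
    by (rule eventually_choice)
  define ps qs where "ps s = fst (pq s)" and "qs s = snd (pq s)" for s
  \<comment> \<open>The pairs of lengths range over a finite set, so one pair \<open>nm\<close>
    occurs almost everywhere. A nonzero second entry keeps the limit denominator from being the zero
    polynomial.\<close>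
  let ?C = "\<lambda>s nm. length (ps s) = fst nm \<and> length (qs s) = snd nm \<and> ps s \<in> polys s \<and>
      qs s \<in> polys s \<and> snd nm \<noteq> 0 \<and>
      ys s \<otimes>\<^bsub>Om s\<^esub> Om.eval s (qs s) (ts s) = Om.eval s (ps s) (ts s)"
  have "eventually (\<lambda>s. \<exists>nm\<in>{..length (last Ps)} \<times> {..length (hd Ps)}.
      ?C s nm) D"
    using pq by (rule eventually_mono) (auto simp: ps_def qs_def)
  then obtain nm where nm: "eventually (\<lambda>s. ?C s nm) D"
    by (rule eventually_bex_finite[rotated]) auto
  let ?p = "ulist (fst nm) ps" and ?q = "ulist (snd nm) qs"
  have len: "eventually (\<lambda>s. length (ps s) = fst nm) D" "eventually (\<lambda>s. length (qs s) = snd nm) D"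
    and poly: "eventually (\<lambda>s. length (ps s) = fst nm \<and> ps s \<in> polys s) D"
      "eventually (\<lambda>s. length (qs s) = snd nm \<and> qs s \<in> polys s) D"
    and n0: "snd nm \<noteq> 0"
    and frac: "eventually (\<lambda>s. ys s \<otimes>\<^bsub>Om s\<^esub> Om.eval s (qs s) (ts s) = Om.eval s (ps s) (ts s)) D"
    using nm D_ne by (simp_all add: eventually_conj_iff)
  have P: "?p \<in> KX" and Q: "?q \<in> KX"
    using ulist_poly[OF poly(1)] ulist_poly[OF poly(2)] by auto
  then have Pc: "set ?p \<subseteq> carrier U" and Qc: "set ?q \<subseteq> carrier U"
    using subfieldE(3)[OF K_subfield] by (auto simp: univ_poly_def polynomial_def)
  have "?q \<noteq> []"
    using n0 by (metis length_ulist list.size(3))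
  then have "U.eval ?q t \<noteq> \<zero>\<^bsub>U\<^esub>"
    using eval_t_eq_zero_imp[OF Q] by blast
  moreover have "y \<otimes>\<^bsub>U\<^esub> U.eval ?q t = U.eval ?p t"
  proof -
    have "eventually (\<lambda>s. coords ?p s = ps s \<and> coords ?q s = qs s) D"
      using eventually_coords_ulist[OF len(1)] eventually_coords_ulist[OF len(2)]
      by (simp add: eventually_conj_iff)
    with frac have "eventually (\<lambda>s. ys s \<otimes>\<^bsub>Om s\<^esub> Om.eval s (coords ?q s) (ts s) = Om.eval s (coords ?p s) (ts s)) D"
      by (rule eventually_elim2) simp
    then show ?thesis
      by (simp add: ys(1) eval_coords[OF Pc] eval_coords[OF Qc] ucls_eq_iff)
  qed
  ultimately show "y \<in> F"
    by (rule U.fractionI[OF K_subfield t_carrier yc P Q])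
qed

end

section \<open>Shadows\<close>

locale function_field_extension = function_field_ultraproduct D Om Fs ts
  for D :: "'s filter" and Om :: "'s \<Rightarrow> 'a ring" and Fs ts +
  fixes xs :: "'s \<Rightarrow> 'a"
  assumes xs_separable: "separable_elt (ultra_ring D Om)
    (generate_field (ultra_ring D Om) (insert (ucls D ts) (ultraprod D Fs))) (ucls D xs)"
begin

interpretation Om: algebraically_closed "Om s" for s
  by (rule algebraically_closed_Om)

interpretation U: algebraically_closed U
  by (rule U_algebraically_closed)

lemma x_carrier: "ucls D xs \<in> carrier U"
  using xs_separable by (simp only: separable_elt_def)

lemma x_algebraic: "(U.algebraic over F) (ucls D xs)"
  and x_roots: "card {a. U.is_root (U.Irr F (ucls D xs)) a} = degree (U.Irr F (ucls D xs))"
  using xs_separable U.separable_elt_iff[OF F_subfield x_carrier] by blast+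

sublocale ext: ultraproduct_extension D Om FF xs
  by (rule ultraproduct_extension.intro[OF ultraproduct_axioms ultraproduct_extension_axioms.intro])
    (rule FF_subfield, rule x_carrier, rule U.algebraic_mono[OF F_subset_UF x_algebraic])

abbreviation "m \<equiv> degree (U.Irr F (ucls D xs))"
abbreviation "HF \<equiv> U.simple_extension F (ucls D xs)"
text \<open>The description of the roots by \<open>urep\<close> is kept beside separability because
  normality of the shadows depends on where the roots lie.\<close>

abbreviation "good s \<equiv> separable_elt (Om s) (FF s) (xs s) \<and> degree (Om.Irr s (FF s) (xs s)) = m \<and>
  {a. Om.is_root s (Om.Irr s (FF s) (xs s)) a} = (\<lambda>a. urep D a s) ` {a. U.is_root (U.Irr F (ucls D xs)) a}"

lemma Irr_UF: "U.Irr UF (ucls D xs) = U.Irr F (ucls D xs)"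
  by (rule U.Irr_eq_if_relatively_closed[OF F_subfield UF_subfield F_subset_UF relatively_closed x_carrier x_algebraic])

lemma HF_eq: "{y \<in> ultraprod D ext.E. (U.algebraic over F) y} = HF"
  unfolding ext.ultraprod_E
  by (rule U.relatively_closed_simple_extension[OF F_subfield infinite_F UF_subfield F_subset_UF
        relatively_closed x_carrier x_algebraic x_roots])

lemma HF_eq': "ultraprod D ext.E \<inter> {y \<in> carrier U. \<not> U.transcendental F y} = HF"
proof -
  have "ultraprod D ext.E \<subseteq> carrier U"
    using ext.UE(4) by (simp only: ext.ultraprod_E)
  then show ?thesis
    using HF_eq by (auto simp: over_def)
qed

lemma separable_UF: "separable_elt U UF (ucls D xs)"
  using U.separable_elt_iff[OF UF_subfield x_carrier] ext.xs_algebraic x_roots Irr_UF by simp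

lemma fin_sep_ext_UF: "fin_sep_ext U UF (ultraprod D ext.E) m"
  using U.fin_sep_ext_simple_extension[OF UF_subfield separable_UF] by (simp add: ext.ultraprod_E Irr_UF)

lemma eventually_separable:
  "eventually (\<lambda>s. good s) D"
  using ext.eventually_Irr ext.eventually_roots[unfolded Irr_UF, OF x_roots]
proof (rule eventually_elim2)
  fix s assume s: "ext.regular s"
    and r: "{a. Om.is_root s (coords (U.Irr F (ucls D xs)) s) a} =
        (\<lambda>a. urep D a s) ` {a. U.is_root (U.Irr F (ucls D xs)) a} \<and>
      card {a. Om.is_root s (coords (U.Irr F (ucls D xs)) s) a} = m"
  then have I: "Om.Irr s (FF s) (xs s) = coords (U.Irr F (ucls D xs)) s"
    by (simp only: Irr_UF)
  have xc: "xs s \<in> carrier (Om s)" and alg: "(Om.algebraic s over (FF s)) (xs s)"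
    using s by simp_all
  have card_r: "card {a. Om.is_root s (coords (U.Irr F (ucls D xs)) s) a} = degree (coords (U.Irr F (ucls D xs)) s)"
    using conjunct2[OF r] by (simp only: length_coords)
  have "separable_elt (Om s) (FF s) (xs s)"
    unfolding Om.separable_elt_iff[OF FF_subfield xc] I using alg card_r by (rule conjI)
  then show "good s"
    using r unfolding I by simp
qed

lemma eventually_fin_sep_ext: "eventually (\<lambda>s. fin_sep_ext (Om s) (FF s) (ext.E s) m) D"
  using eventually_separable
proof (rule eventually_mono)
  fix s assume "good s"
  then have sep: "separable_elt (Om s) (FF s) (xs s)" and deg: "degree (Om.Irr s (FF s) (xs s)) = m"
    by auto
  from Om.fin_sep_ext_simple_extension[OF FF_subfield sep]
  show "fin_sep_ext (Om s) (FF s) (ext.E s) m"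
    by (simp only: deg)
qed

text \<open>A competing family contains the coordinates \<open>xs s\<close> almost everywhere,
  because the class of \<open>xs\<close> lies in \<open>HF\<close>. Then \<open>xs s\<close>
  generates a subfield of \<open>G s\<close> of the full degree \<open>m\<close>.\<close>

lemma shadow_unique:
  assumes G: "eventually (\<lambda>s. fin_sep_ext (Om s) (FF s) (G s) m) D"
    and eq: "ultraprod D G \<inter> {y \<in> carrier U. \<not> U.transcendental F y} = HF"
  shows "eventually (\<lambda>s. G s = ext.E s) D"
proof -
  have "ucls D xs \<in> HF"
    by (rule U.simple_extension_mem[OF subfieldE(1)[OF F_subfield] x_carrier])
  then have "ucls D xs \<in> ultraprod D G"
    using eq by blast
  then have "eventually (\<lambda>s. xs s \<in> G s) D"
    by simp
  then have "eventually (\<lambda>s. fin_sep_ext (Om s) (FF s) (G s) m \<and> xs s \<in> G s) D"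
    using G by (simp add: eventually_conj_iff)
  with eventually_separable show ?thesis
  proof (rule eventually_elim2)
    fix s assume s: "good s"
      and g: "fin_sep_ext (Om s) (FF s) (G s) m \<and> xs s \<in> G s"
    have "subring (G s) (Om s)" "Om.dimension s m (FF s) (G s)"
      using g subfieldE(1) by (auto simp: fin_sep_ext_def)
    then have "ext.E s = G s"
      by (rule Om.degree_Irr_le_dimension(3)[OF FF_subfield]) (use s g in simp_all)
    then show "G s = ext.E s" by simp
  qed
qed

lemma restrict_iso:
  "(\<lambda>\<rho>. restrict \<rho> HF) \<in>
    iso (Gal U UF (ultraprod D ext.E)) (Gal U F HF)"
  unfolding ext.ultraprod_E
  by (rule U.restrict_Gal_iso[OF F_subfield UF_subfield F_subset_UF x_carrier x_algebraic Irr_UF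
        HF_eq[unfolded ext.ultraprod_E]])

lemma Gal_UF_iso: "Gal U UF (ultraprod D ext.E) \<cong> Gal U F HF"
  using restrict_iso by (auto simp: is_iso_def)

lemma carrier_Gal_F:
  "carrier (Gal U F HF) =
    (\<lambda>\<rho>. restrict \<rho> HF) ` carrier (Gal U UF (ultraprod D ext.E))"
  using restrict_iso by (auto simp: iso_def bij_betw_def)

lemma eventually_Gal_iso_F:
  "eventually (\<lambda>s. Gal (Om s) (FF s) (ext.E s) \<cong> Gal U F HF) D"
  using ext.eventually_Gal_iso by (rule eventually_mono) (rule iso_trans[OF _ Gal_UF_iso])

text \<open>Normality puts the roots of the minimal polynomial into \<open>HF\<close>. They are
  finite in number, so almost every \<open>ext.E s\<close> contains the coordinates of all of them,
  which are all the conjugates of \<open>xs s\<close>.\<close>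

lemma galois_ext_shadows:
  assumes gal: "galois_ext U F HF k"
  shows "galois_ext U UF (ultraprod D ext.E) m"
    and "eventually (\<lambda>s. galois_ext (Om s) (FF s) (ext.E s) m) D"
proof -
  let ?R = "{a. U.is_root (U.Irr F (ucls D xs)) a}"
  have "?R \<subseteq> HF"
    by (rule U.galois_ext_imp_roots[OF gal U.simple_extension_mem[OF subfieldE(1)[OF F_subfield] x_carrier]])
  then have R: "?R \<subseteq> ultraprod D ext.E"
    using HF_eq by blast
  show "galois_ext U UF (ultraprod D ext.E) m"
    using U.galois_ext_simple_extension[OF UF_subfield separable_UF] R
    by (simp only: ext.ultraprod_E Irr_UF)
  have "finite ?R"
    by (rule U.finite_number_of_roots[OF U.Irr_facts(1)[OF F_subfield x_carrier x_algebraic]])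
  then have "eventually (\<lambda>s. \<forall>a\<in>?R. urep D a s \<in> ext.E s) D"
    by (rule eventually_ball_finite) (use R eventually_urep_in in blast)
  with eventually_separable show "eventually (\<lambda>s. galois_ext (Om s) (FF s) (ext.E s) m) D"
  proof (rule eventually_elim2)
    fix s assume s: "good s"
      and r: "\<forall>a\<in>?R. urep D a s \<in> ext.E s"
    then have sep: "separable_elt (Om s) (FF s) (xs s)" and deg: "degree (Om.Irr s (FF s) (xs s)) = m"
      by auto
    have "{a. Om.is_root s (Om.Irr s (FF s) (xs s)) a} \<subseteq> ext.E s"
      using s r by (metis image_subsetI)
    from Om.galois_ext_simple_extension[OF FF_subfield sep this]
    show "galois_ext (Om s) (FF s) (ext.E s) m"
      by (simp only: deg)
  qed
qed

lemma ultraprod_cong: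
  assumes "eventually (\<lambda>s. A s = B s) D"
  shows "ultraprod D A = ultraprod D B"
  using ultraprod_mono[of A B] ultraprod_mono[of B A] assms
  by (metis (mono_tags, lifting) eventually_mono subset_antisym subset_refl)

lemma eventually_E_eq_generate_field:
  "eventually (\<lambda>s. generate_field (Om s) (insert (xs s) (FF s)) = ext.E s) D"
  using ext.eventually_Irr
proof (rule eventually_mono)
  fix s assume s: "ext.regular s"
  show "generate_field (Om s) (insert (xs s) (FF s)) = ext.E s"
    by (rule Om.generate_field_insert_algebraic[OF FF_subfield]) (use s in auto)
qed

lemma simple_extension_eq_generate_field:
  "HF = generate_field U (insert (ucls D xs) F)"
  "U.simple_extension UF (ucls D xs) = generate_field U (insert (ucls D xs) UF)"
  using U.generate_field_insert_algebraic[OF F_subfield x_carrier x_algebraic]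
    U.generate_field_insert_algebraic[OF UF_subfield x_carrier ext.xs_algebraic] by simp_all

end

text \<open>Both halves are instances of \<open>function_field_extension\<close>: the first for a
  primitive element of \<open>HH\<close> found by the maximal degree argument, the second for the
  given generator and the given representative of it.\<close>

theorem mainTheorem9:
  fixes D :: "'s filter"
    and Om :: "'s \<Rightarrow> 'a ring"      \<comment> \<open>Om s = the chosen algebraic closure of F_s(t)\<close>
    and Fs :: "'s \<Rightarrow> 'a set"       \<comment> \<open>the field F_s, as a subfield of Om s\<close>
    and ts :: "'s \<Rightarrow> 'a"           \<comment> \<open>the variable t of F_s(t)\<close>
    and HH :: "('s \<Rightarrow> 'a) set set"  \<comment> \<open>the extension H of F\<close>
    and m :: nat
  defines "FF \<equiv> \<lambda>s. generate_field (Om s) (insert (ts s) (Fs s))"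
    and "FsepS \<equiv> \<lambda>s. {x \<in> carrier (Om s).
                   separable_elt (Om s) (generate_field (Om s) (insert (ts s) (Fs s))) x}"
    and "U \<equiv> ultra_ring D Om"
    and "K \<equiv> ultraprod D Fs"
    and "UF \<equiv> ultraprod D (\<lambda>s. generate_field (Om s) (insert (ts s) (Fs s)))"
    and "F \<equiv> generate_field (ultra_ring D Om) (insert (ucls D ts) (ultraprod D Fs))"
    and "Falg \<equiv> {x \<in> carrier (ultra_ring D Om).
                   \<not> ring.transcendental (ultra_ring D Om)
                       (generate_field (ultra_ring D Om) (insert (ucls D ts) (ultraprod D Fs))) x}"
    and "Fsep \<equiv> {x \<in> carrier (ultra_ring D Om).
                   separable_elt (ultra_ring D Om)
                       (generate_field (ultra_ring D Om) (insert (ucls D ts) (ultraprod D Fs))) x}"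
  assumes S_inf: "infinite (UNIV :: 's set)"
    and D_ultra: "nonprincipal_ultrafilter D"
    and Fs_field: "\<And>s. subfield (Fs s) (Om s)"
    and Om_field: "\<And>s. field (Om s)"
    and ts_in: "\<And>s. ts s \<in> carrier (Om s)"
    and ts_transc: "\<And>s. ring.transcendental (Om s) (Fs s) (ts s)"
    and Om_closure: "\<And>s. algebraic_closure (Om s) (FF s)"
    and H_ext: "fin_sep_ext U F HH m"
    and H_sep: "HH \<subseteq> Fsep"
  shows
    \<comment> \<open>(a) existence, uniqueness, and part (b) for the family of shadows\<close>
    "(\<exists>H :: 's \<Rightarrow> 'a set.
        eventually (\<lambda>s. fin_sep_ext (Om s) (FF s) (H s) m \<and> H s \<subseteq> FsepS s) D
      \<and> ultraprod D H \<inter> Falg = HH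
      \<and> (\<forall>G :: 's \<Rightarrow> 'a set.
            eventually (\<lambda>s. fin_sep_ext (Om s) (FF s) (G s) m) D
            \<and> ultraprod D G \<inter> Falg = HH
            \<longrightarrow> eventually (\<lambda>s. G s = H s) D)
      \<and> (galois_ext U F HH m \<longrightarrow>
           \<comment> \<open>(i)\<close>
           eventually (\<lambda>s. galois_ext (Om s) (FF s) (H s) m
                          \<and> Gal (Om s) (FF s) (H s) \<cong> Gal U F HH) D
           \<comment> \<open>(ii)\<close>
         \<and> galois_ext U UF (ultraprod D H) m
         \<and> Gal U UF (ultraprod D H) \<cong> Gal U F HH
           \<comment> \<open>(iii)\<close>
         \<and> carrier (Gal U F HH) = (\<lambda>\<sigma>. restrict \<sigma> HH) ` carrier (Gal U UF (ultraprod D H))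
         \<and> carrier (Gal U UF (ultraprod D H)) =
             {restrict (uact D \<sigma>s) (ultraprod D H) | \<sigma>s.
                eventually (\<lambda>s. \<sigma>s s \<in> carrier (Gal (Om s) (FF s) (H s))) D}
         \<and> (\<forall>\<sigma>s \<tau>s.
              eventually (\<lambda>s. \<sigma>s s \<in> carrier (Gal (Om s) (FF s) (H s))
                             \<and> \<tau>s s \<in> carrier (Gal (Om s) (FF s) (H s))) D
              \<longrightarrow> restrict (uact D \<sigma>s) (ultraprod D H) = restrict (uact D \<tau>s) (ultraprod D H)
              \<longrightarrow> eventually (\<lambda>s. \<sigma>s s = \<tau>s s) D)))
     \<comment> \<open>(a) explicit description via a primitive element\<close>
   \<and> (\<forall>\<alpha> \<alpha>s. HH = generate_field U (insert \<alpha> F) \<longrightarrow> \<alpha> = ucls D \<alpha>s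
        \<longrightarrow> eventually (\<lambda>s. \<alpha>s s \<in> FsepS s) D
        \<longrightarrow> (let H = (\<lambda>s. generate_field (Om s) (insert (\<alpha>s s) (FF s))) in
               eventually (\<lambda>s. fin_sep_ext (Om s) (FF s) (H s) m) D
             \<and> ultraprod D H \<inter> Falg = HH
             \<and> ultraprod D H = generate_field U (insert \<alpha> UF)
             \<and> fin_sep_ext U UF (ultraprod D H) m))"
proof -
  have closed: "algebraically_closed (Om s)" for s
  proof -
    interpret algebraic_closure "Om s" "FF s"
      by (rule Om_closure)
    show ?thesis
      by unfold_locales
  qed
  interpret P: function_field_ultraproduct D Om Fs ts
    by (rule function_field_ultraproduct.intro[OF ultraproduct.intro function_field_ultraproduct_axioms.intro])
      (rule D_ultra closed Fs_field ts_in ts_transc)+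
  interpret U: algebraically_closed P.U
    by (rule P.U_algebraically_closed)
  note defs = FF_def FsepS_def U_def K_def UF_def F_def Falg_def Fsep_def
  note ext = H_ext[unfolded U_def F_def]
  have HH: "subfield HH P.U" "subring HH P.U"
    and dim: "U.dimension m P.F HH"
    and sep: "\<And>x. x \<in> HH \<Longrightarrow> separable_elt P.U
      P.F x"
    using ext subfieldE(1) by (auto simp: fin_sep_ext_def)
  show ?thesis
  proof (rule conjI, goal_cases)
    case 1
    obtain \<alpha> where \<alpha>: "\<alpha> \<in> HH" and HH_eq: "U.simple_extension
        P.F \<alpha> = HH"
      and deg: "degree (U.Irr P.F \<alpha>) = m"
      using U.fin_sep_ext_imp_simple[OF ext P.infinite_F] by blast
    have "\<alpha> \<in> ultraprod D (\<lambda>s. carrier (Om s))"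
      using \<alpha> subringE(1)[OF HH(2)] by (auto simp: P.carrier_U)
    then obtain xs where xs: "\<alpha> = ucls D xs"
      by (rule P.ultraprod_cases)
    interpret X: function_field_extension D Om Fs ts xs
      by (rule function_field_extension.intro[OF P.function_field_ultraproduct_axioms
            function_field_extension_axioms.intro]) (use sep[OF \<alpha>] xs in simp)
    note eq = HH_eq[unfolded xs] and deg' = deg[unfolded xs]
    show ?case
      unfolding defs
    proof (intro exI[of _ X.ext.E] conjI allI impI)
      show "eventually (\<lambda>s. fin_sep_ext (Om s) (P.FF s) (X.ext.E s) m \<and>
          X.ext.E s \<subseteq> {x \<in> carrier (Om s). separable_elt (Om s) (P.FF s) x}) D"
        using X.eventually_fin_sep_ext[unfolded deg']
        by (rule eventually_mono) (auto simp: fin_sep_ext_def separable_elt_def)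
      show "ultraprod D X.ext.E \<inter> {x \<in> carrier P.U. \<not> U.transcendental P.F x} = HH"
        using X.HF_eq' eq by simp
      show "eventually (\<lambda>s. G s = X.ext.E s) D"
        if "eventually (\<lambda>s. fin_sep_ext (Om s) (P.FF s) (G s) m) D \<and>
          ultraprod D G \<inter> {x \<in> carrier P.U. \<not> U.transcendental P.F x} = HH" for G
        using X.shadow_unique[unfolded eq deg'] that by blast
      assume gal: "galois_ext P.U P.F HH m"
      note G = X.galois_ext_shadows[unfolded eq deg', OF gal]
      show "eventually (\<lambda>s. galois_ext (Om s) (P.FF s) (X.ext.E s) m \<and>
          Gal (Om s) (P.FF s) (X.ext.E s) \<cong> Gal P.U P.F HH) D"
        using G(2) X.eventually_Gal_iso_F[unfolded eq] by (simp add: eventually_conj_iff)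
      show "galois_ext P.U P.UF (ultraprod D X.ext.E) m"
        by (rule G(1))
      show "Gal P.U P.UF (ultraprod D X.ext.E) \<cong> Gal P.U P.F HH"
        by (rule X.Gal_UF_iso[unfolded eq])
      show "carrier (Gal P.U P.F HH) =
          (\<lambda>\<rho>. restrict \<rho> HH) ` carrier (Gal P.U P.UF (ultraprod D X.ext.E))"
        by (rule X.carrier_Gal_F[unfolded eq])
      show "carrier (Gal P.U P.UF (ultraprod D X.ext.E)) =
          {restrict (uact D \<rho>s) (ultraprod D X.ext.E) | \<rho>s.
            eventually (\<lambda>s. \<rho>s s \<in> carrier (Gal (Om s) (P.FF s) (X.ext.E s))) D}"
        by (rule X.ext.carrier_Gal_ultraprod)
      show "eventually (\<lambda>s. \<rho>s s = \<tau>s s) D"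
        if "eventually (\<lambda>s. \<rho>s s \<in> carrier (Gal (Om s) (P.FF s) (X.ext.E s)) \<and>
            \<tau>s s \<in> carrier (Gal (Om s) (P.FF s) (X.ext.E s))) D"
          and "restrict (uact D \<rho>s) (ultraprod D X.ext.E) = restrict (uact D \<tau>s) (ultraprod D X.ext.E)"
        for \<rho>s \<tau>s
        using X.ext.eventually_eq_if_restrict_uact_eq that by (simp add: eventually_conj_iff)
    qed
  next
    case 2
    show ?case
    proof (intro allI impI)
      fix \<alpha> \<alpha>s
      assume HH_eq: "HH = generate_field U (insert \<alpha> F)" and \<alpha>s: "\<alpha> = ucls D \<alpha>s"
      have \<alpha>: "\<alpha> \<in> HH"
        unfolding HH_eq by (rule generate_field.incl) simp
      interpret X: function_field_extension D Om Fs ts \<alpha>s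
        by (rule function_field_extension.intro[OF P.function_field_ultraproduct_axioms
            function_field_extension_axioms.intro]) (use sep[OF \<alpha>] \<alpha>s in simp)
      have eq: "U.simple_extension P.F (ucls D \<alpha>s) = HH"
        using X.simple_extension_eq_generate_field(1) HH_eq \<alpha>s by (simp add: U_def F_def)
      \<comment> \<open>\<open>m\<close> is given as the dimension of \<open>HH\<close>, whereas
        \<open>X.m\<close> is the degree of the generator; uniqueness of dimension identifies
        them.\<close>
      have "U.dimension X.m P.F (U.simple_extension P.F (ucls D \<alpha>s))"
        by (rule U.dimension_simple_extension[OF P.F_subfield X.x_carrier X.x_algebraic])
      then have deg: "X.m = m"
        using U.dimension_is_inj[OF P.F_subfield _ dim] eq by simp
      \<comment> \<open>The generated field is known to be the simple extension where
        \<open>\<alpha>s s\<close> is algebraic, hence almost everywhere, which is enough for equal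
        ultraproducts.\<close>
      let ?H = "\<lambda>s. generate_field (Om s) (insert (\<alpha>s s) (P.FF s))"
      have uH: "ultraprod D ?H = ultraprod D X.ext.E"
        by (rule X.ultraprod_cong[OF X.eventually_E_eq_generate_field])
      have "eventually (\<lambda>s. fin_sep_ext (Om s) (P.FF s) (?H s) m) D"
        using X.eventually_fin_sep_ext[unfolded deg] X.eventually_E_eq_generate_field
        by (rule eventually_elim2) simp
      moreover have "ultraprod D ?H \<inter> {x \<in> carrier P.U. \<not> U.transcendental P.F x} = HH"
        using X.HF_eq' uH eq by simp
      moreover have "ultraprod D ?H = generate_field P.U (insert (ucls D \<alpha>s) P.UF)"
        using uH X.ext.ultraprod_E X.simple_extension_eq_generate_field(2) by simp
      moreover have "fin_sep_ext P.U P.UF (ultraprod D ?H) m"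
        using X.fin_sep_ext_UF[unfolded deg] uH by simp
      ultimately show "let H = (\<lambda>s. generate_field (Om s) (insert (\<alpha>s s) (FF s))) in
               eventually (\<lambda>s. fin_sep_ext (Om s) (FF s) (H s) m) D
             \<and> ultraprod D H \<inter> Falg = HH
             \<and> ultraprod D H = generate_field U (insert \<alpha> UF)
             \<and> fin_sep_ext U UF (ultraprod D H) m"
        unfolding defs \<alpha>s Let_def by blast
    qed
  qed
qed

end
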